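(* Let $s\in(0,1)$, let $\Omega\subset\mathbb{R}^n$ be a bounded Lipschitz domain, let $f\in L^2(\Omega)$ and $g\in L^1(\mathbb{R}^n\setminus\Omega)$. Suppose that there exists a $C^2$ function $\psi$ on $\mathbb{R}^n$ such that $\mathcal{N}_s\psi=g$ in $\mathbb{R}^n\setminus\overline{\Omega}$. Then the problem $$(-\Delta)^su=f\ \text{ in }\Omega,\qquad \mathcal{N}_su=g\ \text{ in }\mathbb{R}^n\setminus\overline{\Omega}$$ admits a weak solution $u\in H^s_{\Omega,0}$ if and only if $$\int_\Omega f=-\int_{\mathbb{R}^n\setminus\Omega} g.$$ Moreover, if this compatibility condition holds, the weak solution is unique up to an additive constant.
   Context: A domain is a nonempty open set; connectedness is not required here. $\mathcal{C}\Omega=\mathbb{R}^n\setminus\Omega$ and $(\mathcal{C}\Omega)^2=\mathcal{C}\Omega\times\mathcal{C}\Omega$. The fractional Laplacian is $$(-\Delta)^su(x)=c_{n,s}\,\mathrm{PV}\int_{\mathbb{R}^n}\frac{u(x)-u(y)}{|x-y|^{n+2s}}\,dy,$$ where $c_{n,s}>0$ is the normalization constant $c_{n,s}=\left(\int_{\mathbb{R}^n}\frac{1-\cos\zeta_1}{|\zeta|^{n+2s}}\,d\zeta\right)^{-1}$. The nonlocal normal derivative is $$\mathcal{N}_su(x)=c_{n,s}\int_\Omega\frac{u(x)-u(y)}{|x-y|^{n+2s}}\,dy,\qquad x\in\mathbb{R}^n\setminus\overline{\Omega}.$$ For $g\in L^1(\mathbb{R}^n\setminus\Omega)$, $H^s_{\Omega,g}$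 is the space of measurable $u:\mathbb{R}^n\to\mathbb{R}$ (modulo a.e. equality) with $$\|u\|_{H^s_{\Omega,g}}^2=\|u\|_{L^2(\Omega)}^2+\||g|^{1/2}u\|_{L^2(\mathbb{R}^n\setminus\Omega)}^2+\int_{\mathbb{R}^{2n}\setminus(\mathcal{C}\Omega)^2}\frac{|u(x)-u(y)|^2}{|x-y|^{n+2s}}\,dx\,dy<\infty,$$ and $H^s_{\Omega,0}$ is this space for $g\equiv0$. Weak solution: $u\in H^s_{\Omega,0}$ is a weak solution of the problem $(-\Delta)^su=f$ in $\Omega$, $\mathcal{N}_su=g$ in $\mathbb{R}^n\setminus\overline\Omega$, if $$\frac{c_{n,s}}{2}\int_{\mathbb{R}^{2n}\setminus(\mathcal{C}\Omega)^2}\frac{(u(x)-u(y))(v(x)-v(y))}{|x-y|^{n+2s}}\,dx\,dy=\int_\Omega f\,v+\int_{\mathbb{R}^n\setminus\Omega}g\,v$$ for all $v\in H^s_{\Omega,g}$.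
   Formalization: The C² function ψ is also assumed to lie in H^s_{Ω,0} (finite energy); for unbounded ψ existence can fail, e.g. n=1, s=1/2, Ω=(-1,1), ψ=(1+x²)^{3/8}. Every bounded C² ψ satisfies this. *)

theory Defs
  imports "HOL-Analysis.Analysis"
begin

(* The open set is locally the strict epigraph of a Lipschitz function.  Instead of a rigid
   motion, the "vertical" direction is a unit vector e, and the graph function is evaluated
   on the orthogonal projection of x to the hyperplane orthogonal to e (for n = 1 this
   hyperplane is {0}).  Connectedness is not required. *)
definition lipschitz_domain :: "(real ^ 'n) set \<Rightarrow> bool" where
  "lipschitz_domain \<Omega> \<longleftrightarrow> open \<Omega> \<and> \<Omega> \<noteq> {} \<and>
     (\<forall>p \<in> frontier \<Omega>. \<exists>e r L \<gamma>. norm e = 1 \<and> r > 0 \<and> L-lipschitz_on {z. e \<bullet> z = 0} \<gamma> \<and>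
        \<Omega> \<inter> ball p r = {x \<in> ball p r. e \<bullet> x > \<gamma> (x - (e \<bullet> x) *\<^sub>R e)})"

(* G is the gradient and H the Hessian matrix of \<psi>. *)
definition C2_function :: "(real ^ 'n \<Rightarrow> real) \<Rightarrow> bool" where
  "C2_function \<psi> \<longleftrightarrow> (\<exists>(G :: real ^ 'n \<Rightarrow> real ^ 'n) (H :: real ^ 'n \<Rightarrow> real ^ 'n ^ 'n).
     (\<forall>x. (\<psi> has_derivative (\<lambda>h. G x \<bullet> h)) (at x)) \<and>
     (\<forall>x. (G has_derivative (\<lambda>h. H x *v h)) (at x)) \<and>
     continuous_on UNIV H)"

(* The denominator |x - y|^(n + 2s).  It vanishes on the diagonal, which is a null set, so the
   convention a / 0 = 0 is harmless below. *)
definition frac_den :: "real \<Rightarrow> real ^ 'n \<Rightarrow> real ^ 'n \<Rightarrow> real" where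
  "frac_den s x y = norm (x - y) powr (real CARD('n) + 2 * s)"

(* An arbitrary coordinate plays the role of the first one, as the index type carries no order;
   by symmetry the value of the integral does not depend on it. *)
definition frac_const :: "'n::finite itself \<Rightarrow> real \<Rightarrow> real" where
  "frac_const _ s = inverse (LINT \<zeta> | (lebesgue :: (real ^ 'n) measure).
     (1 - cos (\<zeta> $ (SOME i. True))) / frac_den s \<zeta> 0)"

definition nonlocal_normal_deriv ::
    "real \<Rightarrow> (real ^ 'n) set \<Rightarrow> (real ^ 'n \<Rightarrow> real) \<Rightarrow> real ^ 'n \<Rightarrow> real" where
  "nonlocal_normal_deriv s \<Omega> u x =
     frac_const TYPE('n) s * (LINT y | lebesgue_on \<Omega>. (u x - u y) / frac_den s x y)"

definition cross_region :: "(real ^ 'n) set \<Rightarrow> ((real ^ 'n) \<times> (real ^ 'n)) set" where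
  "cross_region \<Omega> = UNIV - (UNIV - \<Omega>) \<times> (UNIV - \<Omega>)"

definition Hs_norm_sq ::
    "real \<Rightarrow> (real ^ 'n) set \<Rightarrow> (real ^ 'n \<Rightarrow> real) \<Rightarrow> (real ^ 'n \<Rightarrow> real) \<Rightarrow> ennreal" where
  "Hs_norm_sq s \<Omega> g u =
     (\<integral>\<^sup>+ x. ennreal ((u x)\<^sup>2) \<partial>lebesgue_on \<Omega>) +
     (\<integral>\<^sup>+ x. ennreal ((sqrt \<bar>g x\<bar> * u x)\<^sup>2) \<partial>lebesgue_on (UNIV - \<Omega>)) +
     (\<integral>\<^sup>+ (x, y). ennreal (\<bar>u x - u y\<bar>\<^sup>2 / frac_den s x y) \<partial>lebesgue_on (cross_region \<Omega>))"

(* Elements are functions, not classes; almost everywhere equality is spelled out where it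
   matters. *)
definition Hs_space ::
    "real \<Rightarrow> (real ^ 'n) set \<Rightarrow> (real ^ 'n \<Rightarrow> real) \<Rightarrow> (real ^ 'n \<Rightarrow> real) set" where
  "Hs_space s \<Omega> g = {u \<in> borel_measurable lebesgue. Hs_norm_sq s \<Omega> g u < \<infinity>}"

definition weak_neumann_solution ::
    "real \<Rightarrow> (real ^ 'n) set \<Rightarrow> (real ^ 'n \<Rightarrow> real) \<Rightarrow> (real ^ 'n \<Rightarrow> real) \<Rightarrow> (real ^ 'n \<Rightarrow> real) \<Rightarrow> bool"
  where
  "weak_neumann_solution s \<Omega> f g u \<longleftrightarrow>
     u \<in> Hs_space s \<Omega> (\<lambda>_. 0) \<and>
     (\<forall>v \<in> Hs_space s \<Omega> g.
        frac_const TYPE('n) s / 2 *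
          (LINT (x, y) | lebesgue_on (cross_region \<Omega>).
             (u x - u y) * (v x - v y) / frac_den s x y) =
        (LINT x | lebesgue_on \<Omega>. f x * v x) + (LINT x | lebesgue_on (UNIV - \<Omega>). g x * v x))"

end

theory Submission
  imports Defs
begin

text \<open>
  Testing with \<open>v = 1\<close> gives necessity. For existence, the right-hand side
  \<open>F v = (\<integral>\<^sub>\<Omega> f v) + (\<integral> g v)\<close> vanishes on constants, and the form dominates the weight
  \<open>(1 + \<bar>x\<bar>) powr - (n + 2 * s)\<close> in \<open>L\<^sup>2\<close> on functions of mean zero over \<open>\<Omega>\<close> (the kernel is bounded below,
  so neither compactness nor connectedness is needed). Hence it suffices to bound \<open>F\<close> by the form and
  the \<open>L\<^sup>2(\<Omega>)\<close> norm. Replacing \<open>g\<close> by the normal derivative of \<open>\<psi>\<close> with the kernel truncated at distance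
  \<open>\<epsilon>\<close>, an integration by parts and the second differences of \<open>\<psi>\<close> bound the functional uniformly
  in \<open>\<epsilon>\<close>. The error lives in an \<open>\<epsilon>\<close>-layer around \<open>\<Omega>\<close>, of measure \<open>O(\<epsilon>)\<close> for a Lipschitz domain, where the
  truncated normal derivative is \<open>O(\<epsilon> powr - s)\<close>.

  The test functions may form a smaller space than the solutions, so \<open>u\<close> is a limit of test functions
  only. For uniqueness, the difference of two solutions is tested with its truncations.
\<close>

subsection \<open>Integrals of power kernels\<close>

text \<open>The obstacle is the pairing of \<open>v\<close> with the normal derivative of
  \<open>\<psi>\<close>. Writing \<open>v x = (v x - v y) + v y\<close>, the first part is a
  Cauchy-Schwarz product of increments. In the second, the kernel times
  \<open>\<bar>\<psi> x - \<psi> y\<bar>\<close> is only bounded by a multiple of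
  \<open>norm (x - y) powr (1 - n - 2 * s)\<close>, which is not integrable at the diagonal for
  \<open>s \<ge> 1 / 2\<close>. Cancellation has to replace absolute values, and cancellation needs
  integrals that may be split and reordered. Cutting off the kernel provides these: every piece
  converges absolutely, while the final bounds do not see \<open>\<epsilon>\<close>. In the boundary
  layer only the integrability of \<open>g\<close> and the size of the truncated derivative are
  known, so the limit is taken for bounded \<open>v\<close>. Clamping, which increases neither the
  energy nor the norm in \<open>\<Omega>\<close>, then reaches all test functions. The bounds come
  out in the inhomogeneous form \<open>K * (1 + E + L2)\<close>, since products are split by
  \<open>2 a b \<le> a\<^sup>2 + b\<^sup>2\<close> throughout. Replacing \<open>v\<close> by its
  multiples \<open>t v\<close> restores homogeneity at the end.\<close>

lemma nn_integral_dyadic_le: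
  fixes F :: "'a::euclidean_space \<Rightarrow> ennreal" and a r :: "nat \<Rightarrow> real"
  assumes cover: "\<And>h. F h \<noteq> 0 \<Longrightarrow> \<exists>j. norm h < r j \<and> F h \<le> ennreal (a j)"
    and nonneg: "\<And>j. 0 \<le> a j" "\<And>j. 0 \<le> r j"
    and sums: "(\<lambda>j. a j * (unit_ball_vol (real DIM('a)) * r j ^ DIM('a))) sums S"
  shows "(\<integral>\<^sup>+h. F h \<partial>lborel) \<le> ennreal S"
proof -
  have "(\<integral>\<^sup>+h. F h \<partial>lborel) \<le> (\<integral>\<^sup>+h. (\<Sum>j. ennreal (a j) * indicator (ball 0 (r j)) h) \<partial>(lborel :: 'a measure))"
  proof (rule nn_integral_mono)
    fix h :: 'a
    show "F h \<le> (\<Sum>j. ennreal (a j) * indicator (ball 0 (r j)) h)"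
    proof (cases "F h = 0")
      case False
      then obtain j where j: "norm h < r j" "F h \<le> ennreal (a j)" using cover by blast
      \<comment> \<open>Whole balls replace disjoint annuli: the ball that \<open>cover\<close>
        provides gives the bound, and overlaps only enlarge the sum.\<close>
      have "F h \<le> (\<Sum>i<Suc j. ennreal (a i) * indicator (ball 0 (r i)) h)"
        using j by (simp add: add_increasing)
      also have "\<dots> \<le> (\<Sum>j. ennreal (a j) * indicator (ball 0 (r j)) h)"
        by (rule sum_le_suminf) auto
      finally show ?thesis .
    qed simp
  qed
  also have "\<dots> = (\<Sum>j. ennreal (a j) * emeasure lborel (ball (0::'a) (r j)))"
    by (subst nn_integral_suminf) (auto simp: nn_integral_cmult_indicator intro!: borel_measurable_times_ennreal borel_measurable_indicator)
  also have "\<dots> = (\<Sum>j. ennreal (a j * (unit_ball_vol (real DIM('a)) * r j ^ DIM('a))))"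
    using nonneg by (simp add: emeasure_ball ennreal_mult')
  also have "\<dots> = ennreal S"
    using sums nonneg by (subst suminf_ennreal2) (auto simp: sums_iff)
  finally show ?thesis .
qed

lemma dyadic_above:
  fixes t :: real assumes "1 \<le> t"
  shows "\<exists>j::nat. 2 ^ j \<le> t \<and> t < 2 ^ Suc j"
proof -
  define j where "j = nat \<lfloor>log 2 t\<rfloor>"
  have 0: "0 \<le> log 2 t" using assms by simp
  have "real j \<le> log 2 t" "log 2 t < real (Suc j)" using 0 unfolding j_def by linarith+
  then have "2 powr real j \<le> t" "t < 2 powr real (Suc j)"
    using assms by (simp_all add: le_log_iff log_less_iff)
  then show ?thesis by (auto simp: powr_realpow simp del: power_Suc of_nat_Suc)
qed

text \<open>On the annulus between the radii \<open>2 ^ j * \<epsilon>\<close> and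
  \<open>2 ^ Suc j * \<epsilon>\<close>, the supremum of the kernel times the volume of the outer
  ball is a constant times \<open>\<epsilon> powr - b * (2 powr - b) ^ j\<close>, a geometric
  series. It is applied with \<open>b = 2 * s\<close> to the truncated kernel and with
  \<open>b = s\<close> in the boundary layer.\<close>

lemma nn_integral_kernel_far:
  fixes b :: real assumes b: "0 < b"
  shows "\<exists>C\<ge>0. \<forall>\<epsilon>>0. (\<integral>\<^sup>+h. indicator {h. \<epsilon> \<le> norm h} h * ennreal (norm h powr - (real DIM('a) + b)) \<partial>(lborel :: 'a::euclidean_space measure))
     \<le> ennreal (C * \<epsilon> powr - b)" (is "\<exists>C\<ge>0. \<forall>\<epsilon>>0. ?I \<epsilon> \<le> _")
proof -
  let ?n = "real DIM('a)"
  define C where "C = unit_ball_vol ?n * 2 powr ?n * (1 / (1 - 2 powr - b))"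
  have lt1: "2 powr - b < 1" using b by (simp add: powr_less_one)
  have C0: "C \<ge> 0" using lt1 by (simp add: C_def)
  show ?thesis
  proof (intro exI[of _ C] conjI allI impI C0)
    fix \<epsilon> :: real assume e: "\<epsilon> > 0"
    show "?I \<epsilon> \<le> ennreal (C * \<epsilon> powr - b)"
    proof (rule nn_integral_dyadic_le[where a = "\<lambda>j. (2 ^ j * \<epsilon>) powr - (?n + b)" and r = "\<lambda>j. 2 ^ Suc j * \<epsilon>"])
      fix h :: 'a
      assume "indicator {h. \<epsilon> \<le> norm h} h * ennreal (norm h powr - (?n + b)) \<noteq> 0"
      then have h: "\<epsilon> \<le> norm h" by (auto simp: indicator_def split: if_splits)
      then obtain j where j: "2 ^ j \<le> norm h / \<epsilon>" "norm h / \<epsilon> < 2 ^ Suc j"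
        using dyadic_above[of "norm h / \<epsilon>"] e by (auto simp: divide_simps)
      then have "2 ^ j * \<epsilon> \<le> norm h" "norm h < 2 ^ Suc j * \<epsilon>" using e by (simp_all add: divide_simps)
      moreover have "norm h powr - (?n + b) \<le> (2 ^ j * \<epsilon>) powr - (?n + b)"
        using calculation e b by (intro powr_mono2') auto
      ultimately show "\<exists>j. norm h < 2 ^ Suc j * \<epsilon> \<and>
          indicator {h. \<epsilon> \<le> norm h} h * ennreal (norm h powr - (?n + b)) \<le> ennreal ((2 ^ j * \<epsilon>) powr - (?n + b))"
        by (intro exI[of _ j]) (auto simp: indicator_def intro!: ennreal_leI)
    next
      have eq: "(2 ^ j * \<epsilon>) powr - (?n + b) * (unit_ball_vol ?n * (2 ^ Suc j * \<epsilon>) ^ DIM('a))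
          = unit_ball_vol ?n * 2 powr ?n * \<epsilon> powr - b * (2 powr - b) ^ j" for j
      proof -
        have p: "(2 ^ Suc j * \<epsilon>) ^ DIM('a) = 2 powr ?n * (2 ^ j * \<epsilon>) powr ?n"
          using e by (simp add: powr_mult powr_realpow power_mult_distrib mult.assoc)
        have q: "(2 ^ j * \<epsilon>) powr - (?n + b) * (2 ^ j * \<epsilon>) powr ?n = (2 ^ j * \<epsilon>) powr - b"
          by (simp add: powr_add[symmetric])
        have r: "(2 ^ j * \<epsilon>) powr - b = \<epsilon> powr - b * (2 powr - b) ^ j"
          using e by (simp add: powr_mult powr_realpow[symmetric] powr_powr mult_ac)
        have "(2 ^ j * \<epsilon>) powr - (?n + b) * (unit_ball_vol ?n * (2 powr ?n * (2 ^ j * \<epsilon>) powr ?n))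
            = unit_ball_vol ?n * 2 powr ?n * ((2 ^ j * \<epsilon>) powr - (?n + b) * (2 ^ j * \<epsilon>) powr ?n)"
          by (simp only: mult_ac)
        then show ?thesis unfolding p q r by (simp only: mult_ac)
      qed
      have "(\<lambda>j. unit_ball_vol ?n * 2 powr ?n * \<epsilon> powr - b * (2 powr - b) ^ j) sums
         (unit_ball_vol ?n * 2 powr ?n * \<epsilon> powr - b * (1 / (1 - 2 powr - b)))"
        using lt1 by (intro sums_mult geometric_sums) auto
      then show "(\<lambda>j. (2 ^ j * \<epsilon>) powr - (?n + b) * (unit_ball_vol ?n * (2 ^ Suc j * \<epsilon>) ^ DIM('a))) sums
          (C * \<epsilon> powr - b)"
        unfolding eq by (simp add: C_def mult_ac)
    qed (use e in auto)
  qed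
qed

text \<open>The same dyadic sum, now towards the origin. The volumes cancel the factor of order
  \<open>2 ^ (n * j)\<close> in the kernel, and the ratio \<open>2 powr - b\<close> remains.\<close>

lemma nn_integral_kernel_near:
  fixes b :: real assumes b: "0 < b"
  shows "(\<integral>\<^sup>+h. indicator {h. norm h < 1} h * ennreal (norm h powr (b - real DIM('a))) \<partial>(lborel :: 'a::euclidean_space measure)) < \<infinity>"
proof -
  let ?n = "real DIM('a)"
  have lt1: "2 powr - b < 1" using b by (simp add: powr_less_one)
  have "(\<integral>\<^sup>+h. indicator {h. norm h < 1} h * ennreal (norm h powr (b - ?n)) \<partial>(lborel :: 'a measure))
     \<le> ennreal (unit_ball_vol ?n * 2 powr ?n * (1 / (1 - 2 powr - b)))"
  proof (rule nn_integral_dyadic_le[where a = "\<lambda>j. 2 ^ (DIM('a) * Suc j) * (2 powr - b) ^ j" and r = "\<lambda>j. 1 / 2 ^ j"])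
    fix h :: 'a
    assume nz: "indicator {h. norm h < 1} h * ennreal (norm h powr (b - ?n)) \<noteq> 0"
    then have h: "norm h < 1" "h \<noteq> 0" by (auto simp: indicator_def split: if_splits)
    obtain j where j: "2 ^ j \<le> 1 / norm h" "1 / norm h < 2 ^ Suc j"
      using dyadic_above[of "1 / norm h"] h by (auto simp: divide_simps)
    \<comment> \<open>Inverting the dyadic bounds gives only \<open>norm h \<le> 1 / 2 ^ j\<close>.
      The covering balls are open, so in the case of equality the index moves down by one.\<close>
    obtain j where j: "norm h < 1 / 2 ^ j" "1 / 2 ^ Suc j \<le> norm h"
    proof (cases "norm h = 1 / 2 ^ j")
      case True
      have "j \<noteq> 0" using True h by (intro notI) simp
      then obtain i where "j = Suc i" by (cases j) auto
      with True show ?thesis by (intro that[of i]) (auto simp: divide_simps)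
    next
      case False
      have "norm h \<le> 1 / 2 ^ j" "1 / 2 ^ Suc j \<le> norm h" using j h by (auto simp: field_simps)
      with False show ?thesis by (intro that[of j]) auto
    qed
    \<comment> \<open>The two powers are estimated separately, the increasing one at the outer
      radius and the decreasing one at the inner radius, so that the sign of \<open>b - ?n\<close>
      does not matter.\<close>
    have "norm h powr (b - ?n) = norm h powr b * norm h powr - ?n" by (simp add: powr_add[symmetric])
    also have "\<dots> \<le> (1 / 2 ^ j) powr b * (1 / 2 ^ Suc j) powr - ?n"
      using j b h by (intro mult_mono powr_mono2 powr_mono2') auto
    also have "(1 / 2 ^ Suc j) powr - ?n = (2::real) ^ (DIM('a) * Suc j)"
    proof -
      have "(1 / 2 ^ Suc j) powr - ?n = ((2::real) ^ Suc j) powr ?n"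
        by (simp add: powr_divide powr_minus divide_simps del: power_Suc)
      also have "\<dots> = ((2::real) ^ Suc j) ^ DIM('a)" by (rule powr_realpow) simp
      finally show ?thesis by (simp add: power_mult[symmetric] mult.commute del: power_Suc)
    qed
    also have "(1 / 2 ^ j) powr b = (2 powr - b) ^ j"
      by (simp add: powr_divide powr_realpow[symmetric] powr_powr powr_minus divide_simps mult_ac)
    finally show "\<exists>j. norm h < 1 / 2 ^ j \<and> indicator {h. norm h < 1} h * ennreal (norm h powr (b - ?n))
        \<le> ennreal (2 ^ (DIM('a) * Suc j) * (2 powr - b) ^ j)"
      using h j by (intro exI[of _ j]) (auto simp: mult_ac intro!: ennreal_leI)
  next
    have eq: "2 ^ (DIM('a) * Suc j) * (2 powr - b) ^ j * (unit_ball_vol ?n * (1 / 2 ^ j) ^ DIM('a))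
       = unit_ball_vol ?n * 2 powr ?n * (2 powr - b) ^ j" for j
      by (simp add: power_add power_mult[symmetric] powr_realpow power_divide mult_ac)
    have "(\<lambda>j. unit_ball_vol ?n * 2 powr ?n * (2 powr - b) ^ j) sums (unit_ball_vol ?n * 2 powr ?n * (1 / (1 - 2 powr - b)))"
      using lt1 by (intro sums_mult geometric_sums) auto
    then show "(\<lambda>j. 2 ^ (DIM('a) * Suc j) * (2 powr - b) ^ j * (unit_ball_vol ?n * (1 / 2 ^ j) ^ DIM('a)))
       sums (unit_ball_vol ?n * 2 powr ?n * (1 / (1 - 2 powr - b)))"
      unfolding eq .
  qed auto
  also have "\<dots> < \<infinity>" by simp
  finally show ?thesis .
qed

section \<open>Positivity of the normalization constant\<close>

lemma frac_den_inverse: "1 / frac_den s x y = norm (x - y) powr - (real CARD('n) + 2 * s)"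
  for x y :: "real ^ 'n"
  by (simp only: frac_den_def powr_minus divide_inverse mult_1_left)

lemma one_minus_cos_le: "1 - cos t \<le> t\<^sup>2" for t :: real
proof -
  have "1 - cos t = 2 * (sin (t / 2))\<^sup>2"
    using cos_double_sin[of "t / 2"] by simp
  also have "(sin (t / 2))\<^sup>2 \<le> (t / 2)\<^sup>2"
    using abs_sin_x_le_abs_x[of "t / 2"] by (simp only: abs_le_square_iff)
  finally have "1 - cos t \<le> t\<^sup>2 / 2" by (simp add: power_divide)
  then show ?thesis using zero_le_power2[of t] by linarith
qed

text \<open>Integrability has to come before positivity: the integral of a nonintegrable function is
  \<open>0\<close> by convention, and then its inverse would be \<open>0\<close> as well. The
  integrand is bounded by the power \<open>(2 - 2 * s) - n\<close> near the origin and by twice the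
  power \<open>- (n + 2 * s)\<close> away from it.\<close>

lemma frac_const_pos:
  assumes s: "0 < s" "s < 1"
  shows "0 < frac_const TYPE('n::finite) s"
proof -
  define i :: 'n where "i = (SOME i. True)"
  define F where "F = (\<lambda>z :: real ^ 'n. (1 - cos (z $ i)) / frac_den s z 0)"
  have F_eq: "F z = (1 - cos (z $ i)) * norm z powr - (real CARD('n) + 2 * s)" for z
    using frac_den_inverse[of s z 0] by (simp add: F_def divide_inverse)
  have [measurable]: "F \<in> borel_measurable borel"
    unfolding F_eq[abs_def] by (auto intro!: borel_measurable_times borel_measurable_continuous_onI continuous_intros)
  have F0: "0 \<le> F z" for z by (simp add: F_eq)
  obtain C where C: "(\<integral>\<^sup>+h. indicator {h. 1 \<le> norm h} h * ennreal (norm h powr - (real CARD('n) + 2 * s))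
      \<partial>(lborel :: (real ^ 'n) measure)) \<le> ennreal C"
    using nn_integral_kernel_far[of "2 * s", where 'a = "real ^ 'n"] s by (auto dest: spec[of _ 1])
  let ?N = "\<lambda>h :: real ^ 'n. indicator {h. norm h < 1} h * ennreal (norm h powr ((2 - 2 * s) - real CARD('n)))"
  let ?W = "\<lambda>h :: real ^ 'n. indicator {h. 1 \<le> norm h} h * ennreal (norm h powr - (real CARD('n) + 2 * s))"
  have "(\<integral>\<^sup>+z. ennreal (F z) \<partial>lborel) \<le> (\<integral>\<^sup>+h. ?N h + 2 * ?W h \<partial>lborel)"
  proof (rule nn_integral_mono)
    fix h :: "real ^ 'n"
    show "ennreal (F h) \<le> ?N h + 2 * ?W h"
    proof (cases "norm h < 1")
      case True
      have "F h \<le> (norm h)\<^sup>2 * norm h powr - (real CARD('n) + 2 * s)"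
        unfolding F_eq using one_minus_cos_le[of "h $ i"] component_le_norm_cart[of h i]
          abs_le_square_iff[of "h $ i" "norm h"]
        by (intro mult_right_mono) auto
      also have "\<dots> = norm h powr ((2 - 2 * s) - real CARD('n))"
        using powr_add[of "norm h" 2 "- (real CARD('n) + 2 * s)"]
        by (cases "h = 0") (simp_all add: algebra_simps)
      finally show ?thesis using True by (simp add: ennreal_leI)
    next
      case False
      have "F h \<le> 2 * norm h powr - (real CARD('n) + 2 * s)"
        unfolding F_eq using cos_ge_minus_one[of "h $ i"] by (intro mult_right_mono) auto
      also have "ennreal \<dots> = 2 * ?W h" using False by (simp add: ennreal_mult)
      finally show ?thesis using False by (simp add: ennreal_leI)
    qed
  qed
  also have "\<dots> = (\<integral>\<^sup>+h. ?N h \<partial>lborel) + 2 * (\<integral>\<^sup>+h. ?W h \<partial>lborel)"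
    by (subst nn_integral_add) (auto simp: nn_integral_cmult)
  also have "\<dots> < \<infinity>"
    using nn_integral_kernel_near[of "2 - 2 * s", where 'a = "real ^ 'n"] s C
    by (auto simp: ennreal_mult_less_top intro: le_less_trans)
  finally have int: "integrable lborel F"
    by (intro integrableI_nonneg) (auto simp: F0)
  have "0 < integral\<^sup>L lborel F"
  proof (rule ccontr)
    assume "\<not> ?thesis"
    then have "integral\<^sup>L lborel F = 0"
      using Bochner_Integration.integral_nonneg[where M = lborel and f = F] F0 by (simp add: not_less antisym)
    then have "AE z in lborel. F z = 0"
      using integral_nonneg_eq_0_iff_AE[OF int] F0 by simp
    \<comment> \<open>This open slab avoids the origin, where the quotient is \<open>0\<close> by
      convention, and the other zeros of \<open>1 - cos\<close>. The integrand is therefore positive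
      on it.\<close>
    then have "AE z in lborel. z \<notin> {z :: real ^ 'n. 0 < z $ i \<and> z $ i < 1}"
    proof eventually_elim
      case (elim z)
      show ?case
      proof
        assume z: "z \<in> {z. 0 < z $ i \<and> z $ i < 1}"
        then have "z \<noteq> 0" by auto
        with elim have "cos (z $ i) = 1" by (auto simp: F_eq)
        moreover have "cos (z $ i) < cos 0" using z pi_gt3 by (intro cos_monotone_0_pi) auto
        ultimately show False by simp
      qed
    qed
    moreover have op: "open {z :: real ^ 'n. 0 < z $ i \<and> z $ i < 1}"
      by (intro open_Collect_conj open_Collect_less continuous_intros)
    ultimately have "{z :: real ^ 'n. 0 < z $ i \<and> z $ i < 1} \<in> null_sets lborel"
      using AE_iff_null_sets[of "{z :: real ^ 'n. 0 < z $ i \<and> z $ i < 1}" lborel] by (auto simp: borel_open)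
    then have "negligible {z :: real ^ 'n. 0 < z $ i \<and> z $ i < 1}"
      by (simp add: negligible_iff_null_sets null_sets_completionI)
    with op have "{z :: real ^ 'n. 0 < z $ i \<and> z $ i < 1} = {}"
      using open_not_negligible by blast
    moreover have "(\<chi> j. 1 / 2) \<in> {z :: real ^ 'n. 0 < z $ i \<and> z $ i < 1}" by simp
    ultimately show False by blast
  qed
  then show ?thesis
    unfolding frac_const_def i_def[symmetric] F_def[symmetric] by (simp add: integral_completion)
qed

subsection \<open>Boundary layers of Lipschitz domains\<close>

lemma emeasure_lborel_vimage_minus:
  fixes a :: "'a::euclidean_space"
  assumes "A \<in> sets borel"
  shows "emeasure lborel {x. x - a \<in> A} = emeasure lborel A"
proof -
  have "emeasure lborel A = emeasure (distr lborel borel ((+) (- a))) A"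
    by (simp add: lborel_distr_plus)
  also have "\<dots> = emeasure lborel ((+) (- a) -` A \<inter> space lborel)"
    using assms by (intro emeasure_distr) auto
  also have "(+) (- a) -` A \<inter> space lborel = {x. x - a \<in> A}" by (auto simp: algebra_simps)
  finally show ?thesis by simp
qed

text \<open>The strip has about \<open>1 / t\<close> disjoint translates in direction \<open>e\<close> inside a fixed ball.\<close>

lemma emeasure_strip_le:
  fixes e p :: "'a::euclidean_space" and \<phi> :: "'a \<Rightarrow> real"
  assumes e: "norm e = 1" and cont: "continuous_on UNIV \<phi>"
    and shift: "\<And>x \<tau>. \<phi> (x + \<tau> *\<^sub>R e) = \<phi> x - \<tau>"
    and t: "0 < t" "t \<le> 1"
  shows "emeasure lborel {x \<in> ball p R. 0 \<le> \<phi> x \<and> \<phi> x < t} \<le> ennreal (measure lborel (ball p (R + 2)) * t)"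
proof -
  have [measurable]: "\<phi> \<in> borel_measurable borel"
    using cont by (rule borel_measurable_continuous_onI)
  define A where "A = {x \<in> ball p R. 0 \<le> \<phi> x \<and> \<phi> x < t}"
  have A[measurable]: "A \<in> sets borel" unfolding A_def by measurable
  define A' where "A' j = {x. x - (real j * t) *\<^sub>R e \<in> A}" for j
  have A'[measurable]: "A' j \<in> sets borel" for j unfolding A'_def by measurable
  define N where "N = nat \<lceil>1 / t\<rceil>"
  have N: "1 / t \<le> real N" "real N \<le> 1 / t + 1"
    unfolding N_def using t of_int_ceiling_le_add_one[of "1 / t"] by (auto simp: real_nat_ceiling_ge)
  \<comment> \<open>The upper bound keeps all \<open>N\<close> translates inside the ball of radius
    \<open>R + 2\<close>; the lower bound turns \<open>N\<close> copies of the strip into the factor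
    \<open>t\<close> of the claim.\<close>
  have Nt: "real N * t \<le> 2" "1 \<le> real N * t" using N t by (simp_all add: field_simps)
  have \<phi>A': "- real j * t \<le> \<phi> x \<and> \<phi> x < t - real j * t" if "x \<in> A' j" for x j
    using that shift[of "x - (real j * t) *\<^sub>R e" "real j * t"] by (auto simp: A'_def A_def)
  have disj: "disjoint_family_on A' {..<N}"
  proof -
    have "i = j" if "x \<in> A' i" "x \<in> A' j" for i j x
    proof -
      have "(real i - real j) * t < t" "(real j - real i) * t < t"
        using \<phi>A'[OF that(1)] \<phi>A'[OF that(2)] by (simp_all add: algebra_simps)
      then have "real i - real j < 1" "real j - real i < 1" using t by auto
      then show ?thesis by linarith
    qed
    then show ?thesis by (auto simp: disjoint_family_on_def)
  qed
  have sub: "A' j \<subseteq> ball p (R + 2)" if "j < N" for j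
  proof
    fix x assume "x \<in> A' j"
    then have "dist p (x - (real j * t) *\<^sub>R e) < R" by (auto simp: A'_def A_def)
    moreover have "dist (x - (real j * t) *\<^sub>R e) x \<le> real j * t" using e t by (simp add: dist_norm)
    moreover have "real j * t \<le> real N * t" using that t by (intro mult_right_mono) auto
    ultimately show "x \<in> ball p (R + 2)"
      using dist_triangle[of p x "x - (real j * t) *\<^sub>R e"] Nt by auto
  qed
  have finA: "emeasure lborel A < \<infinity>"
    by (intro emeasure_bounded_finite bounded_subset[OF bounded_ball[of p R]]) (auto simp: A_def)
  have finB: "emeasure lborel (ball p (R + 2)) < \<infinity>" by (intro emeasure_bounded_finite) auto
  have "of_nat N * emeasure lborel A = (\<Sum>j<N. emeasure lborel (A' j))"
    by (simp add: A'_def emeasure_lborel_vimage_minus[OF A])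
  also have "\<dots> = emeasure lborel (\<Union>j<N. A' j)"
    by (intro sum_emeasure disj) auto
  also have "\<dots> \<le> emeasure lborel (ball p (R + 2))"
    using sub by (intro emeasure_mono) auto
  finally have "real N * measure lborel A \<le> measure lborel (ball p (R + 2))"
    using finA finB
    by (simp add: emeasure_eq_ennreal_measure less_top ennreal_of_nat_eq_real_of_nat flip: ennreal_mult')
  then have "measure lborel A * (real N * t) \<le> measure lborel (ball p (R + 2)) * t"
    using t mult_right_mono[of "real N * measure lborel A" "measure lborel (ball p (R + 2))" t] by (simp add: mult_ac)
  moreover have "measure lborel A * 1 \<le> measure lborel A * (real N * t)"
    using Nt by (intro mult_left_mono) auto
  ultimately have "measure lborel A \<le> measure lborel (ball p (R + 2)) * t" by simp
  then show ?thesis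
    unfolding A_def[symmetric] using finA by (simp add: emeasure_eq_ennreal_measure less_top ennreal_leI)
qed

section \<open>One-sided layers around an open set, and their measure\<close>

definition outer_layer :: "'a::metric_space set \<Rightarrow> real \<Rightarrow> 'a set" where
  "outer_layer S \<epsilon> = {x. x \<notin> S \<and> (\<exists>y\<in>S. dist x y < \<epsilon>)}"

lemma outer_layer_borel: "open S \<Longrightarrow> outer_layer S \<epsilon> \<in> sets borel"
proof -
  assume S: "open S"
  have "outer_layer S \<epsilon> = (\<Union>y\<in>S. ball y \<epsilon>) - S" by (auto simp: outer_layer_def dist_commute)
  moreover have "open (\<Union>y\<in>S. ball y \<epsilon>)" by auto
  ultimately show ?thesis using S by (auto intro: borel_open)
qed

text \<open>Near \<open>p\<close> the set is where the function \<open>\<phi>\<close>, the height of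
  the graph minus the vertical coordinate, is negative. Orthogonal projection is nonexpansive, so
  \<open>\<phi>\<close> is Lipschitz with constant \<open>L + 1\<close>. A point outside that is
  \<open>\<epsilon>\<close>-close to a point inside thus has
  \<open>0 \<le> \<phi> < (L + 1) * \<epsilon>\<close>, and \<open>\<phi>\<close> falls at unit
  speed along \<open>e\<close>, as the strip estimate requires.\<close>

lemma lipschitz_domain_layer_local:
  fixes \<Omega> :: "(real ^ 'n) set"
  assumes \<Omega>: "lipschitz_domain \<Omega>" and p: "p \<in> frontier \<Omega>"
  shows "\<exists>\<rho>>0. \<exists>C\<ge>0. \<forall>\<epsilon>. 0 < \<epsilon> \<longrightarrow> \<epsilon> \<le> \<rho> \<longrightarrow> emeasure lborel (ball p \<rho> \<inter> outer_layer \<Omega> \<epsilon>) \<le> ennreal (C * \<epsilon>)"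
proof -
  obtain e r L \<gamma> where e: "norm e = 1" and r: "r > 0" and L: "L-lipschitz_on {z. e \<bullet> z = 0} \<gamma>"
    and eq: "\<Omega> \<inter> ball p r = {x \<in> ball p r. e \<bullet> x > \<gamma> (x - (e \<bullet> x) *\<^sub>R e)}"
    using \<Omega> p unfolding lipschitz_domain_def by blast
  have L0: "0 \<le> L" using L by (rule lipschitz_on_nonneg)
  have ee: "e \<bullet> e = 1" using e by (simp add: norm_eq_1)
  define P where "P x = x - (e \<bullet> x) *\<^sub>R e" for x
  define \<phi> where "\<phi> x = \<gamma> (P x) - e \<bullet> x" for x
  have P0: "e \<bullet> P x = 0" for x by (simp add: P_def inner_diff_right ee)
  have Pnorm: "norm (P x) \<le> norm x" for x
  proof -
    have "(norm (P x))\<^sup>2 = (norm x)\<^sup>2 - (e \<bullet> x)\<^sup>2"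
      unfolding power2_norm_eq_inner P_def power2_eq_square[of "e \<bullet> x"]
      by (simp add: inner_diff_left inner_diff_right ee inner_commute[of x e])
    also have "\<dots> \<le> (norm x)\<^sup>2" by simp
    finally show ?thesis by (rule power2_le_imp_le) simp
  qed
  have Pdiff: "P x - P y = P (x - y)" for x y by (simp add: P_def inner_diff_right scaleR_diff_left)
  have \<phi>_lip: "\<bar>\<phi> x - \<phi> y\<bar> \<le> (L + 1) * dist x y" for x y
  proof -
    have "\<bar>\<gamma> (P x) - \<gamma> (P y)\<bar> \<le> L * dist (P x) (P y)"
      using lipschitz_onD[OF L, of "P x" "P y"] P0 by (simp add: dist_real_def)
    also have "\<dots> \<le> L * dist x y"
      using L0 Pnorm[of "x - y"] by (intro mult_left_mono) (simp_all add: dist_norm Pdiff)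
    finally have 1: "\<bar>\<gamma> (P x) - \<gamma> (P y)\<bar> \<le> L * dist x y" .
    have "\<bar>e \<bullet> x - e \<bullet> y\<bar> \<le> dist x y"
      using Cauchy_Schwarz_ineq2[of e "x - y"] e by (simp add: dist_norm inner_diff_right)
    with 1 show ?thesis by (simp add: \<phi>_def algebra_simps)
  qed
  have "(L + 1)-lipschitz_on UNIV \<phi>"
    using \<phi>_lip L0 by (intro lipschitz_onI) (auto simp: dist_real_def)
  then have cont: "continuous_on UNIV \<phi>" by (rule lipschitz_on_continuous_on)
  have shift: "\<phi> (x + \<tau> *\<^sub>R e) = \<phi> x - \<tau>" for x \<tau>
    by (simp add: \<phi>_def P_def inner_add_right ee algebra_simps)
  \<comment> \<open>The bound \<open>r / 2\<close> keeps the nearby point of \<open>\<Omega>\<close>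
    inside the chart; the bound \<open>1 / (L + 1)\<close> makes the width
    \<open>(L + 1) * \<epsilon>\<close> of the strip at most \<open>1\<close>.\<close>
  define \<rho> where "\<rho> = min (r / 2) (1 / (L + 1))"
  have \<rho>: "\<rho> > 0" "2 * \<rho> \<le> r" "(L + 1) * \<rho> \<le> 1"
    using r L0 by (auto simp: \<rho>_def min_def field_simps)
  define C where "C = measure lborel (ball p (\<rho> + 2)) * (L + 1)"
  show ?thesis
  proof (rule exI[of _ \<rho>], rule conjI[OF \<rho>(1)], rule exI[of _ C], intro conjI allI impI)
    show "0 \<le> C" using L0 by (simp add: C_def)
    fix \<epsilon> :: real assume eps: "0 < \<epsilon>" "\<epsilon> \<le> \<rho>"
    have "ball p \<rho> \<inter> outer_layer \<Omega> \<epsilon> \<subseteq> {x \<in> ball p \<rho>. 0 \<le> \<phi> x \<and> \<phi> x < (L + 1) * \<epsilon>}"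
    proof
      fix x assume x: "x \<in> ball p \<rho> \<inter> outer_layer \<Omega> \<epsilon>"
      then obtain y where y: "x \<notin> \<Omega>" "y \<in> \<Omega>" "dist x y < \<epsilon>" by (auto simp: outer_layer_def)
      have xb: "x \<in> ball p r" using x \<rho> by auto
      have yb: "y \<in> ball p r" using x y eps \<rho> dist_triangle[of p y x] by auto
      have "x \<notin> {x \<in> ball p r. e \<bullet> x > \<gamma> (x - (e \<bullet> x) *\<^sub>R e)}"
        unfolding eq[symmetric] using y by blast
      then have "0 \<le> \<phi> x" using xb by (simp add: \<phi>_def P_def)
      moreover have "y \<in> {x \<in> ball p r. e \<bullet> x > \<gamma> (x - (e \<bullet> x) *\<^sub>R e)}"
        unfolding eq[symmetric] using y yb by blast
      then have "\<phi> y < 0" by (simp add: \<phi>_def P_def)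
      moreover have "\<phi> x - \<phi> y \<le> (L + 1) * \<epsilon>"
        using \<phi>_lip[of x y] y L0 mult_left_mono[of "dist x y" \<epsilon> "L + 1"] by linarith
      ultimately show "x \<in> {x \<in> ball p \<rho>. 0 \<le> \<phi> x \<and> \<phi> x < (L + 1) * \<epsilon>}" using x by auto
    qed
    then have "emeasure lborel (ball p \<rho> \<inter> outer_layer \<Omega> \<epsilon>)
        \<le> emeasure lborel {x \<in> ball p \<rho>. 0 \<le> \<phi> x \<and> \<phi> x < (L + 1) * \<epsilon>}"
      using borel_measurable_continuous_onI[OF cont] by (intro emeasure_mono) auto
    also have "\<dots> \<le> ennreal (measure lborel (ball p (\<rho> + 2)) * ((L + 1) * \<epsilon>))"
    proof (intro emeasure_strip_le[OF e cont shift])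
      have "(L + 1) * \<epsilon> \<le> (L + 1) * \<rho>" using eps L0 by (intro mult_left_mono) auto
      then show "(L + 1) * \<epsilon> \<le> 1" using \<rho> by linarith
    qed (use eps L0 in auto)
    finally show "emeasure lborel (ball p \<rho> \<inter> outer_layer \<Omega> \<epsilon>) \<le> ennreal (C * \<epsilon>)"
      by (simp add: C_def mult.assoc)
  qed
qed

text \<open>The frontier is compact, hence covered by finitely many charts. The charts also cover a
  thin layer, because a segment from a point of the layer to a close point of
  \<open>\<Omega>\<close> crosses the frontier.\<close>

lemma lipschitz_domain_layer:
  fixes \<Omega> :: "(real ^ 'n) set"
  assumes \<Omega>: "lipschitz_domain \<Omega>" "bounded \<Omega>"
  shows "\<exists>\<rho>>0. \<exists>C\<ge>0. \<forall>\<epsilon>. 0 < \<epsilon> \<longrightarrow> \<epsilon> \<le> \<rho> \<longrightarrow> emeasure lborel (outer_layer \<Omega> \<epsilon>) \<le> ennreal (C * \<epsilon>)"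
proof -
  have op: "open \<Omega>" using \<Omega> by (simp add: lipschitz_domain_def)
  have "\<forall>p\<in>frontier \<Omega>. \<exists>\<rho> C. \<rho> > 0 \<and> C \<ge> 0 \<and> (\<forall>\<epsilon>. 0 < \<epsilon> \<longrightarrow> \<epsilon> \<le> \<rho> \<longrightarrow>
      emeasure lborel (ball p \<rho> \<inter> outer_layer \<Omega> \<epsilon>) \<le> ennreal (C * \<epsilon>))"
    using lipschitz_domain_layer_local[OF \<Omega>(1)] by metis
  then obtain \<rho> C where \<rho>C: "\<And>p. p \<in> frontier \<Omega> \<Longrightarrow> \<rho> p > 0" "\<And>p. p \<in> frontier \<Omega> \<Longrightarrow> C p \<ge> 0"
    "\<And>p \<epsilon>. p \<in> frontier \<Omega> \<Longrightarrow> 0 < \<epsilon> \<Longrightarrow> \<epsilon> \<le> \<rho> p \<Longrightarrow>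
      emeasure lborel (ball p (\<rho> p) \<inter> outer_layer \<Omega> \<epsilon>) \<le> ennreal (C p * \<epsilon>)"
    by metis
  have "compact (frontier \<Omega>)" using \<Omega>(2) by (simp add: compact_frontier_bounded)
  \<comment> \<open>Half the radius is kept in reserve for the step from the crossing point on the
    frontier to the point of the layer.\<close>
  moreover have "frontier \<Omega> \<subseteq> (\<Union>p\<in>frontier \<Omega>. ball p (\<rho> p / 2))"
  proof
    fix p assume p: "p \<in> frontier \<Omega>"
    then have "p \<in> ball p (\<rho> p / 2)" using \<rho>C(1) by simp
    with p show "p \<in> (\<Union>p\<in>frontier \<Omega>. ball p (\<rho> p / 2))" by (rule UN_I)
  qed
  ultimately obtain F where F: "F \<subseteq> frontier \<Omega>" "finite F" "frontier \<Omega> \<subseteq> (\<Union>p\<in>F. ball p (\<rho> p / 2))"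
    using compactE_image[of "frontier \<Omega>" "frontier \<Omega>" "\<lambda>p. ball p (\<rho> p / 2)"] by blast
  \<comment> \<open>The inserted \<open>1\<close> makes \<open>Min\<close> meaningful whatever
    \<open>F\<close> is.\<close>
  define r where "r = Min (insert 1 ((\<lambda>p. \<rho> p / 2) ` F))"
  have r: "r > 0"
    using F \<rho>C(1) by (subst r_def, subst Min_gr_iff) auto
  have r2: "r \<le> \<rho> p / 2" if "p \<in> F" for p
    unfolding r_def using F(2) that by (intro Min_le) auto
  show ?thesis
  proof (rule exI[of _ r], rule conjI[OF r], rule exI[of _ "\<Sum>p\<in>F. C p"], intro conjI allI impI)
    show "0 \<le> (\<Sum>p\<in>F. C p)" using F \<rho>C(2) by (intro sum_nonneg) auto
    fix \<epsilon> :: real assume eps: "0 < \<epsilon>" "\<epsilon> \<le> r"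
    have "outer_layer \<Omega> \<epsilon> \<subseteq> (\<Union>p\<in>F. ball p (\<rho> p) \<inter> outer_layer \<Omega> \<epsilon>)"
    proof
      fix x assume x: "x \<in> outer_layer \<Omega> \<epsilon>"
      then obtain y where y: "x \<notin> \<Omega>" "y \<in> \<Omega>" "dist x y < \<epsilon>" by (auto simp: outer_layer_def)
      have "closed_segment x y \<inter> frontier \<Omega> \<noteq> {}"
        using y by (intro connected_Int_frontier) auto
      then obtain q where q: "q \<in> closed_segment x y" "q \<in> frontier \<Omega>" by auto
      then obtain p where p: "p \<in> F" "q \<in> ball p (\<rho> p / 2)" using F by auto
      have "dist x q \<le> dist x y"
        using segment_bound1[OF q(1)] by (simp add: dist_norm norm_minus_commute)
      then have "x \<in> ball p (\<rho> p)"
        using p r2[OF p(1)] eps y dist_triangle[of p x q] by (simp add: dist_commute)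
      then show "x \<in> (\<Union>p\<in>F. ball p (\<rho> p) \<inter> outer_layer \<Omega> \<epsilon>)" using p x by auto
    qed
    then have "emeasure lborel (outer_layer \<Omega> \<epsilon>) \<le> emeasure lborel (\<Union>p\<in>F. ball p (\<rho> p) \<inter> outer_layer \<Omega> \<epsilon>)"
      using F outer_layer_borel[OF op] by (intro emeasure_mono sets.finite_UN sets.Int) (auto intro: borel_open)
    also have "\<dots> \<le> (\<Sum>p\<in>F. emeasure lborel (ball p (\<rho> p) \<inter> outer_layer \<Omega> \<epsilon>))"
      using F outer_layer_borel[OF op] by (intro emeasure_subadditive_finite) auto
    also have "\<dots> \<le> (\<Sum>p\<in>F. ennreal (C p * \<epsilon>))"
    proof (intro sum_mono \<rho>C(3))
      fix p assume "p \<in> F"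
      then show "p \<in> frontier \<Omega>" "\<epsilon> \<le> \<rho> p" using F r2[of p] \<rho>C(1)[of p] eps by auto
    qed (use eps in auto)
    also have "\<dots> = ennreal ((\<Sum>p\<in>F. C p) * \<epsilon>)"
      using F \<rho>C(2) eps by (subst sum_ennreal) (auto simp: sum_distrib_right)
    finally show "emeasure lborel (outer_layer \<Omega> \<epsilon>) \<le> ennreal ((\<Sum>p\<in>F. C p) * \<epsilon>)" .
  qed
qed

text \<open>The frontier lies in every outer layer. This is what reconciles the integrals of the
  data over the complement of \<open>\<Omega>\<close> with the equation for \<open>\<psi>\<close>,
  which holds only off the closure.\<close>

lemma null_frontier_lipschitz_domain:
  fixes \<Omega> :: "(real ^ 'n) set"
  assumes \<Omega>: "lipschitz_domain \<Omega>" "bounded \<Omega>"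
  shows "frontier \<Omega> \<in> null_sets lborel"
proof -
  obtain \<rho> C where \<rho>: "\<rho> > 0" "C \<ge> 0"
    "\<And>\<epsilon>. 0 < \<epsilon> \<Longrightarrow> \<epsilon> \<le> \<rho> \<Longrightarrow> emeasure lborel (outer_layer \<Omega> \<epsilon>) \<le> ennreal (C * \<epsilon>)"
    using lipschitz_domain_layer[OF assms] by blast
  have op: "open \<Omega>" using \<Omega> by (simp add: lipschitz_domain_def)
  have sub: "frontier \<Omega> \<subseteq> outer_layer \<Omega> \<epsilon>" if "\<epsilon> > 0" for \<epsilon>
  proof
    fix x assume "x \<in> frontier \<Omega>"
    then have x: "x \<in> closure \<Omega>" "x \<notin> \<Omega>" using op by (simp_all add: frontier_def interior_open)
    then have "\<exists>y\<in>\<Omega>. dist y x < \<epsilon>" using that unfolding closure_approachable by simp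
    then obtain y where "y \<in> \<Omega>" "dist y x < \<epsilon>" by blast
    then show "x \<in> outer_layer \<Omega> \<epsilon>" using x by (auto simp: outer_layer_def dist_commute)
  qed
  have le: "emeasure lborel (frontier \<Omega>) \<le> emeasure lborel (outer_layer \<Omega> \<epsilon>)" if "\<epsilon> > 0" for \<epsilon>
    using outer_layer_borel[OF op] by (intro emeasure_mono sub that) simp
  have *: "emeasure lborel (frontier \<Omega>) \<le> ennreal (C * \<epsilon>)" if "\<epsilon> > 0" "\<epsilon> \<le> \<rho>" for \<epsilon>
    
    by (rule order_trans[OF le[OF that(1)] \<rho>(3)[OF that]])
  have "emeasure lborel (frontier \<Omega>) \<le> 0 + ennreal \<delta>" if "\<delta> > 0" for \<delta>
  proof -
    define \<epsilon> where "\<epsilon> = min \<rho> (\<delta> / (C + 1))"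
    have \<epsilon>: "\<epsilon> > 0" "\<epsilon> \<le> \<rho>" using \<rho> that by (auto simp: \<epsilon>_def)
    have "C * \<epsilon> \<le> (C + 1) * (\<delta> / (C + 1))"
      using \<rho> \<epsilon> by (intro mult_mono) (auto simp: \<epsilon>_def)
    also have "\<dots> = \<delta>" using \<rho> by simp
    finally have "C * \<epsilon> \<le> \<delta>" .
    from order_trans[OF *[OF \<epsilon>] ennreal_leI[OF this]] show ?thesis by simp
  qed
  then have "emeasure lborel (frontier \<Omega>) \<le> 0" by (rule ennreal_le_epsilon)
  then show ?thesis by (intro null_setsI) (auto simp: borel_closed)
qed

subsection \<open>An abstract Riesz representation argument\<close>

text \<open>Evaluation at the minimizer \<open>- r / b\<close>; for \<open>b = 0\<close> an affine
  function bounded below is constant. Three arguments rest on it: Cauchy-Schwarz for the energy, the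
  first variation of the Riesz functional, and the recovery of a homogeneous bound from an
  inhomogeneous one.\<close>

lemma quadratic_nonneg_discriminant:
  fixes a b r :: real
  assumes nonneg: "\<And>t. 0 \<le> a + 2 * t * r + t\<^sup>2 * b" and b: "0 \<le> b"
  shows "r\<^sup>2 \<le> a * b"
proof (cases "b = 0")
  case True
  have "r = 0"
  proof (rule ccontr)
    assume "r \<noteq> 0"
    then show False using nonneg[of "- (a + 1) / (2 * r)"] True by (simp add: field_simps)
  qed
  then show ?thesis using True by simp
next
  case False
  then have "b > 0" using b by simp
  then show ?thesis using nonneg[of "- r / b"] by (simp add: field_simps power2_eq_square)
qed

text \<open>A minimizing sequence of \<open>B v v - 2 * F v\<close>. The first variation controls it, which gives the
  Cauchy property without the parallelogram identity.\<close>

lemma riesz_minimizing_sequence: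
  fixes B :: "('a \<Rightarrow> real) \<Rightarrow> ('a \<Rightarrow> real) \<Rightarrow> real" and F :: "('a \<Rightarrow> real) \<Rightarrow> real"
  assumes V0: "V \<noteq> {}"
    and V: "\<And>u v t. u \<in> V \<Longrightarrow> v \<in> V \<Longrightarrow> (\<lambda>x. u x + t * v x) \<in> V"
    and B_sym: "\<And>u v. u \<in> V \<Longrightarrow> v \<in> V \<Longrightarrow> B u v = B v u"
    and B_lin: "\<And>u v w t. u \<in> V \<Longrightarrow> v \<in> V \<Longrightarrow> w \<in> V \<Longrightarrow> B (\<lambda>x. u x + t * v x) w = B u w + t * B v w"
    and B_nonneg: "\<And>u. u \<in> V \<Longrightarrow> 0 \<le> B u u"
    and F_lin: "\<And>u v t. u \<in> V \<Longrightarrow> v \<in> V \<Longrightarrow> F (\<lambda>x. u x + t * v x) = F u + t * F v"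
    and C: "0 \<le> C" and F_bound: "\<And>v. v \<in> V \<Longrightarrow> (F v)\<^sup>2 \<le> C * B v v"
  obtains w :: "nat \<Rightarrow> 'a \<Rightarrow> real" where "\<And>k. w k \<in> V"
    and "\<And>k v. v \<in> V \<Longrightarrow> \<bar>B (w k) v - F v\<bar> \<le> (1 / 2) ^ k * sqrt (B v v)"
    and "\<And>k l. B (\<lambda>x. w k x - w l x) (\<lambda>x. w k x - w l x) \<le> ((1 / 2) ^ k + (1 / 2) ^ l)\<^sup>2"
proof -
  define J where "J v = B v v - 2 * F v" for v
  \<comment> \<open>By \<open>4 * C * b \<le> (b + C)\<^sup>2\<close> with \<open>b = B v v\<close>,
    the linear term is absorbed by the quadratic one up to the constant \<open>C\<close>.\<close>
  have lower: "- C \<le> J v" if "v \<in> V" for v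
  proof -
    have "(2 * F v)\<^sup>2 \<le> 4 * (C * B v v)" using F_bound[OF that] by (simp add: power2_eq_square)
    also have "\<dots> \<le> (B v v + C)\<^sup>2"
      using zero_le_power2[of "B v v - C"] by (simp add: power2_eq_square algebra_simps)
    finally have "2 * F v \<le> B v v + C"
      by (rule power2_le_imp_le) (use B_nonneg[OF that] C in simp)
    then show ?thesis by (simp add: J_def)
  qed
  define m where "m = Inf (J ` V)"
  have bdd: "bdd_below (J ` V)" using lower by (auto intro!: bdd_belowI)
  have m_le: "m \<le> J v" if "v \<in> V" for v
    unfolding m_def using bdd that by (intro cInf_lower) auto
  \<comment> \<open>The defect is \<open>(1 / 4) ^ k\<close> because its square root is the rate in
    the conclusion.\<close>
  have "\<exists>v\<in>V. J v < m + (1 / 4) ^ k" for k :: nat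
  proof -
    have "Inf (J ` V) < m + (1 / 4) ^ k" by (simp add: m_def)
    then show ?thesis using cInf_lessD[of "J ` V"] V0 by auto
  qed
  then obtain w where w: "\<And>k. w k \<in> V" "\<And>k. J (w k) < m + (1 / 4) ^ k" by metis
  have J_shift: "J (\<lambda>x. u x + t * v x) = J u + 2 * t * (B u v - F v) + t\<^sup>2 * B v v"
    if u: "u \<in> V" and v: "v \<in> V" for u v t
  proof -
    have "B (\<lambda>x. u x + t * v x) (\<lambda>x. u x + t * v x) = B u (\<lambda>x. u x + t * v x) + t * B v (\<lambda>x. u x + t * v x)"
      by (intro B_lin u v V)
    also have "B u (\<lambda>x. u x + t * v x) = B u u + t * B u v"
      using B_sym[OF u V[OF u v]] B_lin[OF u v u] B_sym[OF u v] by simp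
    also have "B v (\<lambda>x. u x + t * v x) = B u v + t * B v v"
      using B_sym[OF v V[OF u v]] B_lin[OF u v v] by simp
    finally show ?thesis by (simp add: J_def F_lin[OF u v] algebra_simps power2_eq_square)
  qed
  have approx: "\<bar>B (w k) v - F v\<bar> \<le> (1 / 2) ^ k * sqrt (B v v)" if v: "v \<in> V" for k v
  proof -
    \<comment> \<open>\<open>J\<close> at \<open>w k + t * v\<close> is at least \<open>m\<close>,
      hence exceeds \<open>J (w k) - (1 / 4) ^ k\<close> for every \<open>t\<close>. This quadratic
      polynomial in \<open>t\<close> has nonpositive discriminant.\<close>
    have "(B (w k) v - F v)\<^sup>2 \<le> (1 / 4) ^ k * B v v"
    proof (rule quadratic_nonneg_discriminant)
      fix t
      show "0 \<le> (1 / 4) ^ k + 2 * t * (B (w k) v - F v) + t\<^sup>2 * B v v"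
        using m_le[OF V[OF w(1) v, of k t]] w(2)[of k] J_shift[OF w(1) v, of k t] by linarith
    qed (use B_nonneg[OF v] in auto)
    then have "sqrt ((B (w k) v - F v)\<^sup>2) \<le> sqrt ((1 / 4) ^ k * B v v)" by (rule real_sqrt_le_mono)
    also have "\<dots> = (1 / 2) ^ k * sqrt (B v v)"
      by (simp add: real_sqrt_mult real_sqrt_power real_sqrt_divide)
    finally show ?thesis by simp
  qed
  have cauchy: "B (\<lambda>x. w k x - w l x) (\<lambda>x. w k x - w l x) \<le> ((1 / 2) ^ k + (1 / 2) ^ l)\<^sup>2" for k l
  proof -
    define d where "d = (\<lambda>x. w k x - w l x)"
    have d_eq: "d = (\<lambda>x. w k x + (- 1) * w l x)" by (simp add: d_def)
    have d: "d \<in> V" unfolding d_eq by (intro V w)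
    \<comment> \<open>The approximate equations for \<open>w k\<close> and \<open>w l\<close> are
      both tested with their difference \<open>d\<close>, and the two terms \<open>F d\<close>
      cancel.\<close>
    have "B d d = B (w k) d - B (w l) d"
      using B_lin[OF w(1)[of k] w(1)[of l] d, of "- 1"] by (simp add: d_def[symmetric])
    also have "\<dots> \<le> ((1 / 2) ^ k + (1 / 2) ^ l) * sqrt (B d d)"
      using approx[OF d, of k] approx[OF d, of l] by (simp add: algebra_simps)
    finally have le: "B d d \<le> ((1 / 2) ^ k + (1 / 2) ^ l) * sqrt (B d d)" .
    have "sqrt (B d d) \<le> (1 / 2) ^ k + (1 / 2) ^ l"
    proof (cases "B d d = 0")
      case False
      then have pos: "0 < sqrt (B d d)" using B_nonneg[OF d] by simp
      have "sqrt (B d d) * sqrt (B d d) \<le> ((1 / 2) ^ k + (1 / 2) ^ l) * sqrt (B d d)"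
        using le B_nonneg[OF d] by simp
      with pos show ?thesis by (rule mult_right_le_imp_le[rotated])
    qed simp
    then have "(sqrt (B d d))\<^sup>2 \<le> ((1 / 2) ^ k + (1 / 2) ^ l)\<^sup>2"
      using B_nonneg[OF d] by (intro power_mono) auto
    then show ?thesis using B_nonneg[OF d] by (simp add: d_def)
  qed
  show thesis by (rule that[OF w(1) approx cauchy])
qed

subsection \<open>The energy form\<close>

text \<open>The weight is kept general because three of them occur: the indicator of
  \<open>\<Omega>\<close>, the function \<open>\<bar>g\<bar>\<close>, and \<open>1\<close> on the
  energy measure.\<close>

lemma weighted_sq_integrable_mult:
  fixes u v w :: "'a \<Rightarrow> real"
  assumes [measurable]: "u \<in> borel_measurable M" "v \<in> borel_measurable M" "w \<in> borel_measurable M"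
    and w: "\<And>x. 0 \<le> w x"
    and u: "integrable M (\<lambda>x. w x * (u x)\<^sup>2)" and v: "integrable M (\<lambda>x. w x * (v x)\<^sup>2)"
  shows "integrable M (\<lambda>x. w x * (u x * v x))"
proof (rule Bochner_Integration.integrable_bound[OF Bochner_Integration.integrable_add[OF u v]])
  show "AE x in M. norm (w x * (u x * v x)) \<le> norm (w x * (u x)\<^sup>2 + w x * (v x)\<^sup>2)"
  proof (rule AE_I2)
    fix x
    have "\<bar>u x * v x\<bar> \<le> (u x)\<^sup>2 + (v x)\<^sup>2"
      using sum_squares_bound[of "\<bar>u x\<bar>" "\<bar>v x\<bar>"] mult_nonneg_nonneg[of "\<bar>u x\<bar>" "\<bar>v x\<bar>"]
      unfolding abs_mult power2_abs by linarith
    then have "w x * \<bar>u x * v x\<bar> \<le> w x * ((u x)\<^sup>2 + (v x)\<^sup>2)" using w by (rule mult_left_mono)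
    then show "norm (w x * (u x * v x)) \<le> norm (w x * (u x)\<^sup>2 + w x * (v x)\<^sup>2)"
      using w[of x] by (simp add: abs_mult algebra_simps)
  qed
qed measurable

lemma weighted_sq_integrable_add:
  fixes u v w :: "'a \<Rightarrow> real"
  assumes [measurable]: "u \<in> borel_measurable M" "v \<in> borel_measurable M" "w \<in> borel_measurable M"
    and w: "\<And>x. 0 \<le> w x"
    and u: "integrable M (\<lambda>x. w x * (u x)\<^sup>2)" and v: "integrable M (\<lambda>x. w x * (v x)\<^sup>2)"
  shows "integrable M (\<lambda>x. w x * (u x + t * v x)\<^sup>2)"
proof -
  have "integrable M (\<lambda>x. w x * (u x)\<^sup>2 + 2 * t * (w x * (u x * v x)) + t\<^sup>2 * (w x * (v x)\<^sup>2))"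
    using weighted_sq_integrable_mult[OF assms] u v by (intro Bochner_Integration.integrable_add integrable_mult_right)
  then show ?thesis
    by (rule Bochner_Integration.integrable_cong[THEN iffD1, rotated 2]) (auto simp: power2_eq_square algebra_simps)
qed

text \<open>On the diagonal the value is \<open>0\<close>, because \<open>0 powr a = 0\<close>. This
  matches the convention for division by \<open>frac_den\<close>, so the two notations agree at
  every point.\<close>

definition riesz_kernel :: "real \<Rightarrow> real ^ 'n \<Rightarrow> real ^ 'n \<Rightarrow> real" where
  "riesz_kernel s x y = norm (x - y) powr - (real CARD('n) + 2 * s)"

text \<open>With the kernel and the region absorbed into the measure, the form is the
  \<open>L\<^sup>2\<close> inner product of increments, and facts about squares in
  \<open>L\<^sup>2\<close> apply directly.\<close>

definition energy_measure :: "real \<Rightarrow> (real ^ 'n) set \<Rightarrow> ((real ^ 'n) \<times> (real ^ 'n)) measure" where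
  "energy_measure s \<Omega> =
     density lborel (\<lambda>p. ennreal (indicator (cross_region \<Omega>) p * riesz_kernel s (fst p) (snd p)))"

definition increment :: "('a \<Rightarrow> real) \<Rightarrow> 'a \<times> 'a \<Rightarrow> real" where
  "increment u p = u (fst p) - u (snd p)"

definition energy_form :: "real \<Rightarrow> (real ^ 'n) set \<Rightarrow> (real ^ 'n \<Rightarrow> real) \<Rightarrow> (real ^ 'n \<Rightarrow> real) \<Rightarrow> real" where
  "energy_form s \<Omega> u v = (\<integral>p. increment u p * increment v p \<partial>energy_measure s \<Omega>)"

text \<open>The Borel members of \<open>Hs_space\<close> for zero data. Borel rather than Lebesgue
  measurability passes to compositions with the projections of a product; arbitrary members are
  treated at the end through Borel representatives.\<close>

definition finite_energy :: "real \<Rightarrow> (real ^ 'n) set \<Rightarrow> (real ^ 'n \<Rightarrow> real) \<Rightarrow> bool" where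
  "finite_energy s \<Omega> u \<longleftrightarrow> u \<in> borel_measurable borel \<and>
     integrable lborel (\<lambda>x. indicator \<Omega> x * (u x)\<^sup>2) \<and>
     integrable (energy_measure s \<Omega>) (\<lambda>p. (increment u p)\<^sup>2)"

lemma riesz_kernel_nonneg [simp]: "0 \<le> riesz_kernel s x y" by (simp add: riesz_kernel_def)

lemma riesz_kernel_measurable [measurable]:
  "(\<lambda>p. riesz_kernel s (f p) (g p)) \<in> borel_measurable M"
  if "f \<in> borel_measurable M" "g \<in> borel_measurable M"
  unfolding riesz_kernel_def using that by measurable

lemma cross_region_alt: "cross_region \<Omega> = {p. fst p \<in> \<Omega> \<or> snd p \<in> \<Omega>}"
  by (auto simp: cross_region_def)

lemma increment_measurable [measurable]:
  fixes u :: "'a::second_countable_topology \<Rightarrow> real"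
  assumes [measurable]: "u \<in> borel_measurable borel"
  shows "increment u \<in> borel_measurable borel"
proof -
  have "(\<lambda>p::'a \<times> 'a. u (fst p) - u (snd p)) \<in> borel_measurable (borel \<Otimes>\<^sub>M borel)" by measurable
  then show ?thesis unfolding increment_def[abs_def] borel_prod .
qed

locale nonlocal_domain =
  fixes s :: real and \<Omega> :: "(real ^ 'n) set"
  assumes s: "0 < s" "s < 1" and bounded: "bounded \<Omega>" and lipschitz: "lipschitz_domain \<Omega>"
begin

lemma open_domain: "open \<Omega>" using lipschitz by (simp add: lipschitz_domain_def)

lemma domain_borel [measurable]: "\<Omega> \<in> sets borel" using open_domain by (rule borel_open)

lemma nonempty: "\<Omega> \<noteq> {}" using lipschitz by (simp add: lipschitz_domain_def)

lemma emeasure_domain_finite: "emeasure lborel \<Omega> < \<infinity>"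
  using bounded by (rule emeasure_bounded_finite)

lemma measure_domain_pos: "0 < measure lborel \<Omega>"
proof -
  have "emeasure lborel \<Omega> \<noteq> 0"
  proof
    assume "emeasure lborel \<Omega> = 0"
    then have "negligible \<Omega>"
      by (simp add: negligible_iff_null_sets null_setsI null_sets_completionI)
    then show False using open_not_negligible[OF open_domain nonempty] by simp
  qed
  then show ?thesis
    using emeasure_domain_finite by (simp add: measure_def enn2real_positive_iff less_top zero_less_iff_neq_zero)
qed

lemma integrable_domain: "integrable lborel (\<lambda>x. indicator \<Omega> x :: real)"
  using emeasure_domain_finite by simp

lemma cross_region_borel [measurable]: "cross_region \<Omega> \<in> sets borel"
proof -
  have "open (cross_region \<Omega>)"
  proof -
    have "cross_region \<Omega> = \<Omega> \<times> UNIV \<union> UNIV \<times> \<Omega>" by (auto simp: cross_region_def)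
    then show ?thesis using open_domain by (auto intro: open_Times)
  qed
  then show ?thesis by (rule borel_open)
qed

lemma weight_measurable [measurable]:
  "(\<lambda>p. indicator (cross_region \<Omega>) p * riesz_kernel s (fst p) (snd p) :: real) \<in> borel_measurable borel"
proof -
  have [measurable]: "fst \<in> borel_measurable (borel :: ((real ^ 'n) \<times> (real ^ 'n)) measure)"
      "snd \<in> borel_measurable (borel :: ((real ^ 'n) \<times> (real ^ 'n)) measure)"
    by (auto intro!: borel_measurable_continuous_onI continuous_intros)
  show ?thesis by measurable
qed

lemma sets_energy_measure [measurable_cong]: "sets (energy_measure s \<Omega>) = sets borel"
  by (simp add: energy_measure_def)

lemma nn_integral_energy_measure:
  assumes [measurable]: "F \<in> borel_measurable borel"
  shows "(\<integral>\<^sup>+p. F p \<partial>energy_measure s \<Omega>) =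
    (\<integral>\<^sup>+p. ennreal (indicator (cross_region \<Omega>) p * riesz_kernel s (fst p) (snd p)) * F p \<partial>lborel)"
  unfolding energy_measure_def by (subst nn_integral_density) simp_all

lemma integral_energy_measure:
  fixes F :: "_ \<Rightarrow> real"
  assumes [measurable]: "F \<in> borel_measurable borel"
  shows "(\<integral>p. F p \<partial>energy_measure s \<Omega>) =
      (\<integral>p. indicator (cross_region \<Omega>) p * riesz_kernel s (fst p) (snd p) * F p \<partial>lborel)"
    and "integrable (energy_measure s \<Omega>) F \<longleftrightarrow>
      integrable lborel (\<lambda>p. indicator (cross_region \<Omega>) p * riesz_kernel s (fst p) (snd p) * F p)"
  unfolding energy_measure_def by (subst integral_density integrable_density; simp)+

lemma finite_energy_measurable [measurable_dest]: "finite_energy s \<Omega> u \<Longrightarrow> u \<in> borel_measurable borel"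
  by (simp add: finite_energy_def)

lemma finite_energy_add:
  assumes u: "finite_energy s \<Omega> u" and v: "finite_energy s \<Omega> v"
  shows "finite_energy s \<Omega> (\<lambda>x. u x + t * v x)"
proof -
  note [measurable] = u[THEN finite_energy_measurable] v[THEN finite_energy_measurable]
  have inc: "increment (\<lambda>x. u x + t * v x) p = increment u p + t * increment v p" for p
    by (simp add: increment_def algebra_simps)
  have "integrable (energy_measure s \<Omega>) (\<lambda>p. 1 * (increment u p + t * increment v p)\<^sup>2)"
    using u v by (intro weighted_sq_integrable_add) (auto simp: finite_energy_def)
  moreover have "integrable lborel (\<lambda>x. indicator \<Omega> x * (u x + t * v x)\<^sup>2)"
    using u v by (intro weighted_sq_integrable_add) (auto simp: finite_energy_def)
  ultimately show ?thesis by (simp add: finite_energy_def inc)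
qed

lemma finite_energy_const: "finite_energy s \<Omega> (\<lambda>_. c)"
  using integrable_domain by (simp add: finite_energy_def increment_def)

lemma energy_integrable:
  assumes u: "finite_energy s \<Omega> u" and v: "finite_energy s \<Omega> v"
  shows "integrable (energy_measure s \<Omega>) (\<lambda>p. increment u p * increment v p)"
proof -
  note [measurable] = u[THEN finite_energy_measurable] v[THEN finite_energy_measurable]
  have "integrable (energy_measure s \<Omega>) (\<lambda>p. 1 * (increment u p * increment v p))"
    using u v by (intro weighted_sq_integrable_mult) (auto simp: finite_energy_def)
  then show ?thesis by simp
qed

lemma energy_form_commute: "energy_form s \<Omega> u v = energy_form s \<Omega> v u"
  by (simp add: energy_form_def mult.commute)

lemma energy_form_nonneg: "0 \<le> energy_form s \<Omega> u u"
  by (simp add: energy_form_def)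

lemma energy_form_add:
  assumes u: "finite_energy s \<Omega> u" and v: "finite_energy s \<Omega> v" and w: "finite_energy s \<Omega> w"
  shows "energy_form s \<Omega> (\<lambda>x. u x + t * v x) w = energy_form s \<Omega> u w + t * energy_form s \<Omega> v w"
proof -
  have "energy_form s \<Omega> (\<lambda>x. u x + t * v x) w
      = (\<integral>p. increment u p * increment w p + t * (increment v p * increment w p) \<partial>energy_measure s \<Omega>)"
    unfolding energy_form_def by (intro Bochner_Integration.integral_cong) (auto simp: increment_def algebra_simps)
  then show ?thesis
    using energy_integrable[OF u w] energy_integrable[OF v w] by (simp add: energy_form_def)
qed

lemma energy_form_Cauchy_Schwarz:
  assumes u: "finite_energy s \<Omega> u" and v: "finite_energy s \<Omega> v"
  shows "(energy_form s \<Omega> u v)\<^sup>2 \<le> energy_form s \<Omega> u u * energy_form s \<Omega> v v"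
proof -
  have expand: "energy_form s \<Omega> u u + 2 * t * energy_form s \<Omega> u v + t\<^sup>2 * energy_form s \<Omega> v v \<ge> 0" for t
  proof -
    have uv: "finite_energy s \<Omega> (\<lambda>x. u x + t * v x)" by (rule finite_energy_add[OF u v])
    have "energy_form s \<Omega> (\<lambda>x. u x + t * v x) (\<lambda>x. u x + t * v x) =
       energy_form s \<Omega> u u + 2 * t * energy_form s \<Omega> u v + t\<^sup>2 * energy_form s \<Omega> v v"
      unfolding energy_form_add[OF u v uv] energy_form_commute[of _ "\<lambda>x. u x + t * v x"]
        energy_form_add[OF u v u] energy_form_add[OF u v v]
      using energy_form_commute[of u v] by (simp add: algebra_simps power2_eq_square)
    then show ?thesis using energy_form_nonneg[of "\<lambda>x. u x + t * v x"] by simp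
  qed
  then show ?thesis using energy_form_nonneg by (intro quadratic_nonneg_discriminant)
qed

end

section \<open>Almost everywhere statements on products, and the Poincare inequality\<close>

lemma AE_lborel_prodI:
  fixes P :: "'a::euclidean_space \<Rightarrow> bool" and Q :: "'b::euclidean_space \<Rightarrow> bool"
  assumes P: "AE x in lborel. P x" and Q: "AE x in lborel. Q x"
  shows "AE p in lborel. P (fst p) \<and> Q (snd p)"
proof -
  obtain N where N: "\<And>x. x \<in> space lborel - N \<Longrightarrow> P x" "N \<in> null_sets lborel" using AE_E3[OF P] by blast
  obtain N' where N': "\<And>x. x \<in> space lborel - N' \<Longrightarrow> Q x" "N' \<in> null_sets lborel" using AE_E3[OF Q] by blast
  have "N \<times> (UNIV :: 'b set) \<in> null_sets (lborel \<Otimes>\<^sub>M lborel)"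
    using N(2) lborel.emeasure_pair_measure_Times[of N lborel "UNIV :: 'b set"] by (auto simp: null_sets_def)
  moreover have "(UNIV :: 'a set) \<times> N' \<in> null_sets (lborel \<Otimes>\<^sub>M lborel)"
    using N'(2) lborel.emeasure_pair_measure_Times[of "UNIV :: 'a set" lborel N'] by (auto simp: null_sets_def)
  ultimately have "N \<times> (UNIV :: 'b set) \<union> UNIV \<times> N' \<in> null_sets lborel"
    unfolding lborel_prod by (rule null_sets.Un)
  moreover have "{p \<in> space lborel. \<not> (P (fst p) \<and> Q (snd p))} \<subseteq> N \<times> (UNIV :: 'b set) \<union> UNIV \<times> N'"
    using N(1) N'(1) by (simp add: subset_iff mem_Times_iff) blast
  ultimately show ?thesis by (rule AE_I')
qed

context nonlocal_domain
begin

lemma nn_integral_energy: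
  assumes u: "finite_energy s \<Omega> u"
  shows "(\<integral>\<^sup>+p. ennreal ((increment u p)\<^sup>2) \<partial>energy_measure s \<Omega>) = ennreal (energy_form s \<Omega> u u)"
  using u by (subst nn_integral_eq_integral) (auto simp: finite_energy_def energy_form_def power2_eq_square)

lemma nn_integral_energy_Fubini:
  assumes [measurable]: "u \<in> borel_measurable borel"
  shows "(\<integral>\<^sup>+p. ennreal ((increment u p)\<^sup>2) \<partial>energy_measure s \<Omega>) =
    (\<integral>\<^sup>+x. \<integral>\<^sup>+y. ennreal (indicator (cross_region \<Omega>) (x, y) * riesz_kernel s x y * (u x - u y)\<^sup>2) \<partial>lborel \<partial>lborel)"
proof -
  define F where "F p = ennreal (indicator (cross_region \<Omega>) p * riesz_kernel s (fst p) (snd p) * (increment u p)\<^sup>2)" for p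
  have [measurable]: "F \<in> borel_measurable borel" unfolding F_def[abs_def] by measurable
  have "(\<integral>\<^sup>+p. ennreal ((increment u p)\<^sup>2) \<partial>energy_measure s \<Omega>) =
     (\<integral>\<^sup>+p. ennreal (indicator (cross_region \<Omega>) p * riesz_kernel s (fst p) (snd p) * (increment u p)\<^sup>2) \<partial>lborel)"
    by (subst nn_integral_energy_measure) (auto simp: ennreal_mult)
  also have "\<dots> = (\<integral>\<^sup>+p. F p \<partial>(lborel \<Otimes>\<^sub>M lborel))" by (simp add: F_def lborel_prod)
  also have "\<dots> = (\<integral>\<^sup>+x. \<integral>\<^sup>+y. F (x, y) \<partial>lborel \<partial>lborel)"
    by (rule lborel.nn_integral_fst[symmetric]) (simp add: lborel_prod)
  finally show ?thesis by (simp add: F_def increment_def)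
qed

lemma integrable_domain_mult:
  assumes "finite_energy s \<Omega> u"
  shows "integrable lborel (\<lambda>y. indicator \<Omega> y * u y)"
proof -
  note [measurable] = assms[THEN finite_energy_measurable]
  have "integrable lborel (\<lambda>y. indicator \<Omega> y * (u y * 1))"
    using assms integrable_domain by (intro weighted_sq_integrable_mult) (auto simp: finite_energy_def)
  then show ?thesis by simp
qed

text \<open>For mean zero \<open>u\<close> the cross term of \<open>(u x - u y)\<^sup>2\<close> vanishes after integrating over \<open>y\<close>.\<close>

lemma weighted_poincare:
  assumes u: "finite_energy s \<Omega> u" and mean: "(\<integral>y. indicator \<Omega> y * u y \<partial>lborel) = 0"
    and R: "0 < R" "\<Omega> \<subseteq> cball 0 R"
  shows "ennreal (measure lborel \<Omega>) * (\<integral>\<^sup>+x. ennreal ((norm x + R) powr - (real CARD('n) + 2 * s) * (u x)\<^sup>2) \<partial>lborel)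
    \<le> ennreal (energy_form s \<Omega> u u)"
proof -
  note [measurable] = u[THEN finite_energy_measurable]
  let ?\<rho> = "\<lambda>x :: real ^ 'n. (norm x + R) powr - (real CARD('n) + 2 * s)"
  have u2: "integrable lborel (\<lambda>y. indicator \<Omega> y * (u y)\<^sup>2)" using u by (simp add: finite_energy_def)
  have inner: "ennreal (measure lborel \<Omega> * (u x)\<^sup>2) \<le> (\<integral>\<^sup>+y. ennreal (indicator \<Omega> y * (u x - u y)\<^sup>2) \<partial>lborel)" for x
  proof -
    have eq: "indicator \<Omega> y * (u x - u y)\<^sup>2 =
        (u x)\<^sup>2 * indicator \<Omega> y - 2 * u x * (indicator \<Omega> y * u y) + indicator \<Omega> y * (u y)\<^sup>2" for y
      by (simp add: power2_eq_square algebra_simps)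
    have int: "integrable lborel (\<lambda>y. (u x)\<^sup>2 * indicator \<Omega> y - 2 * u x * (indicator \<Omega> y * u y) + indicator \<Omega> y * (u y)\<^sup>2)"
      using integrable_domain integrable_domain_mult[OF u] u2
      by (intro Bochner_Integration.integrable_add Bochner_Integration.integrable_diff integrable_mult_right)
    have "measure lborel \<Omega> * (u x)\<^sup>2 \<le> measure lborel \<Omega> * (u x)\<^sup>2 + (\<integral>y. indicator \<Omega> y * (u y)\<^sup>2 \<partial>lborel)"
      by simp
    also have "\<dots> = (\<integral>y. (u x)\<^sup>2 * indicator \<Omega> y - 2 * u x * (indicator \<Omega> y * u y) + indicator \<Omega> y * (u y)\<^sup>2 \<partial>lborel)"
      using integrable_domain integrable_domain_mult[OF u] u2 mean
      by (subst Bochner_Integration.integral_add | subst Bochner_Integration.integral_diff | simp)+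
    finally have "measure lborel \<Omega> * (u x)\<^sup>2 \<le> (\<integral>y. indicator \<Omega> y * (u x - u y)\<^sup>2 \<partial>lborel)" by (simp only: eq)
    moreover have "(\<integral>\<^sup>+y. ennreal (indicator \<Omega> y * (u x - u y)\<^sup>2) \<partial>lborel) = ennreal (\<integral>y. indicator \<Omega> y * (u x - u y)\<^sup>2 \<partial>lborel)"
      using int unfolding eq[symmetric] by (intro nn_integral_eq_integral) auto
    ultimately show ?thesis by (simp add: ennreal_leI)
  qed
  have "ennreal (measure lborel \<Omega>) * (\<integral>\<^sup>+x. ennreal (?\<rho> x * (u x)\<^sup>2) \<partial>lborel)
      = (\<integral>\<^sup>+x. ennreal (?\<rho> x) * ennreal (measure lborel \<Omega> * (u x)\<^sup>2) \<partial>lborel)"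
    by (subst nn_integral_cmult[symmetric]) (auto simp: ennreal_mult mult_ac)
  also have "\<dots> \<le> (\<integral>\<^sup>+x. ennreal (?\<rho> x) * (\<integral>\<^sup>+y. ennreal (indicator \<Omega> y * (u x - u y)\<^sup>2) \<partial>lborel) \<partial>lborel)"
    by (intro nn_integral_mono mult_left_mono inner) auto
  also have "\<dots> = (\<integral>\<^sup>+x. \<integral>\<^sup>+y. ennreal (?\<rho> x * (indicator \<Omega> y * (u x - u y)\<^sup>2)) \<partial>lborel \<partial>lborel)"
    by (subst nn_integral_cmult[symmetric]) (auto simp: ennreal_mult)
  also have "\<dots> \<le> (\<integral>\<^sup>+x. \<integral>\<^sup>+y. ennreal (indicator (cross_region \<Omega>) (x, y) * riesz_kernel s x y * (u x - u y)\<^sup>2) \<partial>lborel \<partial>lborel)"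
  proof (intro nn_integral_mono ennreal_leI)
    fix x y
    show "?\<rho> x * (indicator \<Omega> y * (u x - u y)\<^sup>2) \<le> indicator (cross_region \<Omega>) (x, y) * riesz_kernel s x y * (u x - u y)\<^sup>2"
    \<comment> \<open>Off the diagonal the kernel decreases in the distance, which is at most
      \<open>norm x + R\<close>. On the diagonal the kernel is \<open>0\<close>, but so is the
      increment.\<close>
    proof (cases "y \<in> \<Omega> \<and> x \<noteq> y")
      case True
      have "norm (x - y) \<le> norm x + R" using True R norm_triangle_ineq4[of x y] by force
      then have "?\<rho> x \<le> riesz_kernel s x y"
        unfolding riesz_kernel_def using True s by (intro powr_mono2') auto
      then show ?thesis using True by (auto simp: cross_region_alt intro!: mult_right_mono)
    qed auto
  qed
  also have "\<dots> = ennreal (energy_form s \<Omega> u u)"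
    by (simp only: nn_integral_energy_Fubini[symmetric] nn_integral_energy[OF u] finite_energy_measurable[OF u])
  finally show ?thesis .
qed

text \<open>On \<open>\<Omega>\<close> the weight is at least \<open>(2 * R) powr - q\<close>, so
  the weighted inequality on the whole space controls the unweighted integral over
  \<open>\<Omega>\<close>.\<close>

lemma poincare:
  obtains C where "0 \<le> C" and
    "\<And>u. finite_energy s \<Omega> u \<Longrightarrow> (\<integral>y. indicator \<Omega> y * u y \<partial>lborel) = 0 \<Longrightarrow>
       (\<integral>y. indicator \<Omega> y * (u y)\<^sup>2 \<partial>lborel) \<le> C * energy_form s \<Omega> u u"
proof -
  obtain R where R: "0 < R" "\<Omega> \<subseteq> cball 0 R"
    using bounded by (meson bounded_subset_ballD ball_subset_cball order_trans)
  define q where "q = real CARD('n) + 2 * s"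
  have q: "0 < q" using s by (simp add: q_def)
  show ?thesis
  proof (rule that[of "(2 * R) powr q / measure lborel \<Omega>"])
    fix u assume u: "finite_energy s \<Omega> u" and mean: "(\<integral>y. indicator \<Omega> y * u y \<partial>lborel) = 0"
    note [measurable] = u[THEN finite_energy_measurable]
    have u2: "integrable lborel (\<lambda>y. indicator \<Omega> y * (u y)\<^sup>2)" using u by (simp add: finite_energy_def)
    have "ennreal (measure lborel \<Omega> * ((2 * R) powr - q * (\<integral>y. indicator \<Omega> y * (u y)\<^sup>2 \<partial>lborel)))
       = ennreal (measure lborel \<Omega>) * (\<integral>\<^sup>+y. ennreal ((2 * R) powr - q * (indicator \<Omega> y * (u y)\<^sup>2)) \<partial>lborel)"
      using u2 by (subst nn_integral_eq_integral) (auto simp: ennreal_mult)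
    also have "\<dots> \<le> ennreal (measure lborel \<Omega>) * (\<integral>\<^sup>+y. ennreal ((norm y + R) powr - q * (u y)\<^sup>2) \<partial>lborel)"
    proof (intro mult_left_mono nn_integral_mono ennreal_leI)
      fix y
      show "(2 * R) powr - q * (indicator \<Omega> y * (u y)\<^sup>2) \<le> (norm y + R) powr - q * (u y)\<^sup>2"
      proof (cases "y \<in> \<Omega>")
        case True
        then have "norm y + R \<le> 2 * R" using R by auto
        then have "(2 * R) powr - q \<le> (norm y + R) powr - q"
          using q R by (intro powr_mono2') (auto simp: add_nonneg_pos)
        then show ?thesis using True by (simp add: mult_right_mono)
      qed simp
    qed simp
    also have "\<dots> \<le> ennreal (energy_form s \<Omega> u u)"
      using weighted_poincare[OF u mean R] by (simp only: q_def)
    finally have "measure lborel \<Omega> * ((2 * R) powr - q * (\<integral>y. indicator \<Omega> y * (u y)\<^sup>2 \<partial>lborel)) \<le> energy_form s \<Omega> u u"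
      by (simp add: energy_form_nonneg)
    then show "(\<integral>y. indicator \<Omega> y * (u y)\<^sup>2 \<partial>lborel) \<le> (2 * R) powr q / measure lborel \<Omega> * energy_form s \<Omega> u u"
      using R measure_domain_pos by (simp add: powr_minus field_simps)
  qed simp
qed

end

subsection \<open>Completeness\<close>

lemma abs_summable_geometric_bound:
  fixes d :: "nat \<Rightarrow> real"
  assumes "\<And>k. 2 ^ k * (d k)\<^sup>2 \<le> M"
  shows "summable d"
proof (rule summable_comparison_test')
  have "sqrt (1 / 2) < (1::real)" by (simp add: real_sqrt_lt_1_iff)
  then show "summable (\<lambda>k. sqrt M * sqrt (1 / 2) ^ k)" by (intro summable_mult summable_geometric) simp
  fix k
  have "(d k)\<^sup>2 \<le> M * (1 / 2) ^ k" using assms[of k] by (simp add: field_simps)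
  then have "sqrt ((d k)\<^sup>2) \<le> sqrt (M * (1 / 2) ^ k)" by (rule real_sqrt_le_mono)
  then show "norm (d k) \<le> sqrt M * sqrt (1 / 2) ^ k"
    unfolding real_sqrt_abs by (simp add: real_sqrt_mult real_sqrt_power)
qed

context nonlocal_domain
begin

text \<open>The Riesz-Fischer argument in the weighted space of the Poincare inequality. The decay
  \<open>(1 / 4) ^ k\<close> leaves room for a factor \<open>2 ^ k\<close>, so the sum of
  \<open>2 ^ k * (\<rho> x * (d k x)\<^sup>2)\<close> is finite almost everywhere, which makes the
  differences \<open>d k x\<close> geometrically small. As the weight is positive everywhere, the
  convergence is not confined to \<open>\<Omega>\<close>.\<close>

lemma fast_Cauchy_AE_convergent:
  fixes w :: "nat \<Rightarrow> real ^ 'n \<Rightarrow> real"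
  assumes w: "\<And>k. finite_energy s \<Omega> (w k)"
    and mean: "\<And>k. (\<integral>y. indicator \<Omega> y * w k y \<partial>lborel) = 0"
    and Cauchy: "\<And>k. energy_form s \<Omega> (\<lambda>x. w (Suc k) x - w k x) (\<lambda>x. w (Suc k) x - w k x) \<le> A * (1 / 4) ^ k"
  shows "AE x in lborel. convergent (\<lambda>k. w k x)"
proof -
  note [measurable] = w[THEN finite_energy_measurable]
  obtain R where R: "0 < R" "\<Omega> \<subseteq> cball 0 R"
    using bounded by (meson bounded_subset_ballD ball_subset_cball order_trans)
  define \<rho> where "\<rho> x = (norm x + R) powr - (real CARD('n) + 2 * s)" for x :: "real ^ 'n"
  have [measurable]: "\<rho> \<in> borel_measurable borel" unfolding \<rho>_def[abs_def] by measurable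
  have \<rho>: "0 < \<rho> x" for x using R by (simp add: \<rho>_def add_nonneg_pos less_imp_neq[THEN not_sym])
  define d where "d k x = w (Suc k) x - w k x" for k x
  have d: "finite_energy s \<Omega> (d k)" for k
    using finite_energy_add[OF w w, of "Suc k" "- 1" k] by (simp add: d_def[abs_def])
  note [measurable] = d[THEN finite_energy_measurable]
  have d_mean: "(\<integral>y. indicator \<Omega> y * d k y \<partial>lborel) = 0" for k
    using mean integrable_domain_mult[OF w] by (simp add: d_def right_diff_distrib)
  have A: "0 \<le> A"
    using order_trans[OF energy_form_nonneg Cauchy[of 0]] by simp
  define m where "m = measure lborel \<Omega>"
  have m: "0 < m" unfolding m_def by (rule measure_domain_pos)
  have bound: "(\<integral>\<^sup>+x. ennreal (2 ^ k * (\<rho> x * (d k x)\<^sup>2)) \<partial>lborel) \<le> ennreal (A / m * (1 / 2) ^ k)" for k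
  proof -
    have "ennreal m * (\<integral>\<^sup>+x. ennreal (\<rho> x * (d k x)\<^sup>2) \<partial>lborel) \<le> ennreal (A * (1 / 4) ^ k)"
      unfolding \<rho>_def m_def
      using weighted_poincare[OF d d_mean R, of k] Cauchy[of k]
      by (auto simp: d_def[abs_def] intro: order_trans ennreal_leI)
    then have "ennreal (2 ^ k / m) * (ennreal m * (\<integral>\<^sup>+x. ennreal (\<rho> x * (d k x)\<^sup>2) \<partial>lborel))
        \<le> ennreal (2 ^ k / m) * ennreal (A * (1 / 4) ^ k)"
      by (rule mult_left_mono) simp
    also have "\<dots> = ennreal (A / m * (1 / 2) ^ k)"
      using m A by (subst ennreal_mult[symmetric]) (auto simp: power_divide field_simps simp flip: power_mult_distrib)
    also have "ennreal (2 ^ k / m) * (ennreal m * (\<integral>\<^sup>+x. ennreal (\<rho> x * (d k x)\<^sup>2) \<partial>lborel))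
       = ennreal (2 ^ k) * (\<integral>\<^sup>+x. ennreal (\<rho> x * (d k x)\<^sup>2) \<partial>lborel)"
      using m by (simp add: mult.assoc[symmetric] ennreal_mult[symmetric])
    also have "\<dots> = (\<integral>\<^sup>+x. ennreal (2 ^ k * (\<rho> x * (d k x)\<^sup>2)) \<partial>lborel)"
      using \<rho> by (subst nn_integral_cmult[symmetric]) (auto simp: ennreal_mult less_imp_le)
    finally show ?thesis .
  qed
  have "(\<integral>\<^sup>+x. (\<Sum>k. ennreal (2 ^ k * (\<rho> x * (d k x)\<^sup>2))) \<partial>lborel)
      = (\<Sum>k. \<integral>\<^sup>+x. ennreal (2 ^ k * (\<rho> x * (d k x)\<^sup>2)) \<partial>lborel)"
    by (rule nn_integral_suminf) measurable
  also have "\<dots> \<le> (\<Sum>k. ennreal (A / m * (1 / 2) ^ k))"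
    by (intro suminf_le bound) auto
  also have "\<dots> < \<infinity>"
    using A m by (subst suminf_ennreal2) (auto intro!: summable_mult summable_geometric)
  finally have "AE x in lborel. (\<Sum>k. ennreal (2 ^ k * (\<rho> x * (d k x)\<^sup>2))) \<noteq> \<infinity>"
    by (intro nn_integral_PInf_AE) auto
  then show ?thesis
  proof eventually_elim
    case (elim x)
    define S where "S = enn2real (\<Sum>k. ennreal (2 ^ k * (\<rho> x * (d k x)\<^sup>2)))"
    have S: "(\<Sum>k. ennreal (2 ^ k * (\<rho> x * (d k x)\<^sup>2))) = ennreal S"
      using elim by (simp add: S_def less_top[symmetric])
    have "2 ^ k * (d k x)\<^sup>2 \<le> S / \<rho> x" for k
    proof -
      have "ennreal (2 ^ k * (\<rho> x * (d k x)\<^sup>2)) \<le> (\<Sum>k. ennreal (2 ^ k * (\<rho> x * (d k x)\<^sup>2)))"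
        using sum_le_suminf[of "\<lambda>k. ennreal (2 ^ k * (\<rho> x * (d k x)\<^sup>2))" "{k}"] by simp
      then have "2 ^ k * (\<rho> x * (d k x)\<^sup>2) \<le> S"
        unfolding S using \<rho>[of x] by (simp add: S_def ennreal_le_iff)
      then show ?thesis using \<rho>[of x] by (simp add: field_simps)
    qed
    then have "summable (\<lambda>k. d k x)" by (rule abs_summable_geometric_bound)
    then have "convergent (\<lambda>n. w n x - w 0 x)"
      unfolding summable_iff_convergent d_def sum_lessThan_telescope[of "\<lambda>i. w i x"] .
    then have "convergent (\<lambda>n. (w n x - w 0 x) + w 0 x)" by (intro convergent_add convergent_const)
    then show "convergent (\<lambda>k. w k x)" by simp
  qed
qed

text \<open>Fatou's lemma for \<open>l\<close> tending to infinity in the Cauchy estimate bounds the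
  distance from \<open>w k\<close> to the pointwise limit. The norm over \<open>\<Omega>\<close> is
  handled in the same way, after the Poincare inequality has bounded it by the energy of the
  differences.\<close>

lemma energy_complete:
  fixes w :: "nat \<Rightarrow> real ^ 'n \<Rightarrow> real"
  assumes w: "\<And>k. finite_energy s \<Omega> (w k)"
    and mean: "\<And>k. (\<integral>y. indicator \<Omega> y * w k y \<partial>lborel) = 0"
    and Cauchy: "\<And>k l. energy_form s \<Omega> (\<lambda>x. w k x - w l x) (\<lambda>x. w k x - w l x) \<le> A * ((1 / 2) ^ k + (1 / 2) ^ l)\<^sup>2"
  obtains u where "finite_energy s \<Omega> u"
    and "\<And>k. energy_form s \<Omega> (\<lambda>x. w k x - u x) (\<lambda>x. w k x - u x) \<le> 4 * A * (1 / 4) ^ k"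
proof -
  note [measurable] = w[THEN finite_energy_measurable]
  have A: "0 \<le> A"
    using order_trans[OF energy_form_nonneg Cauchy[of 0 0]] by simp
  have diff: "finite_energy s \<Omega> (\<lambda>x. w k x - w l x)" for k l
    using finite_energy_add[OF w w, of k "- 1" l] by simp
  have diff_mean: "(\<integral>y. indicator \<Omega> y * (w k y - w l y) \<partial>lborel) = 0" for k l
    using mean integrable_domain_mult[OF w] by (simp add: right_diff_distrib)
  have Cauchy': "energy_form s \<Omega> (\<lambda>x. w k x - w l x) (\<lambda>x. w k x - w l x) \<le> 4 * A * (1 / 4) ^ k" if "k \<le> l" for k l
  proof -
    have "(1 / 2 :: real) ^ l \<le> (1 / 2) ^ k" using that by (intro power_decreasing) auto
    then have "((1 / 2 :: real) ^ k + (1 / 2) ^ l)\<^sup>2 \<le> ((1 / 2) ^ k + (1 / 2) ^ k)\<^sup>2"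
      by (intro power_mono) auto
    also have "\<dots> = 4 * (1 / 4) ^ k" by (simp add: power2_eq_square algebra_simps flip: power_mult_distrib)
    finally have "A * ((1 / 2) ^ k + (1 / 2) ^ l)\<^sup>2 \<le> A * (4 * (1 / 4) ^ k)" using A by (rule mult_left_mono)
    with Cauchy[of k l] show ?thesis by simp
  qed
  define u where "u x = lim (\<lambda>k. w k x)" for x
  have [measurable]: "u \<in> borel_measurable borel" unfolding u_def[abs_def] by measurable
  have "AE x in lborel. convergent (\<lambda>k. w k x)"
  proof (rule fast_Cauchy_AE_convergent[OF w mean])
    fix k
    have "increment (\<lambda>x. w (Suc k) x - w k x) p * increment (\<lambda>x. w (Suc k) x - w k x) p
       = increment (\<lambda>x. w k x - w (Suc k) x) p * increment (\<lambda>x. w k x - w (Suc k) x) p" for p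
      by (simp add: increment_def algebra_simps)
    then have "energy_form s \<Omega> (\<lambda>x. w (Suc k) x - w k x) (\<lambda>x. w (Suc k) x - w k x)
       = energy_form s \<Omega> (\<lambda>x. w k x - w (Suc k) x) (\<lambda>x. w k x - w (Suc k) x)"
      by (simp add: energy_form_def)
    then show "energy_form s \<Omega> (\<lambda>x. w (Suc k) x - w k x) (\<lambda>x. w (Suc k) x - w k x) \<le> (4 * A) * (1 / 4) ^ k"
      using Cauchy'[of k "Suc k"] by simp
  qed
  then have conv: "AE x in lborel. (\<lambda>k. w k x) \<longlonglongrightarrow> u x"
    by eventually_elim (simp add: u_def convergent_LIMSEQ_iff)
  have "AE p in lborel. (\<lambda>l. w l (fst p)) \<longlonglongrightarrow> u (fst p) \<and> (\<lambda>l. w l (snd p)) \<longlonglongrightarrow> u (snd p)"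
    by (rule AE_lborel_prodI[OF conv conv])
  then have conv2: "AE p in energy_measure s \<Omega>. (\<lambda>l. w l (fst p)) \<longlonglongrightarrow> u (fst p) \<and> (\<lambda>l. w l (snd p)) \<longlonglongrightarrow> u (snd p)"
    unfolding energy_measure_def by (subst AE_density) (auto elim: eventually_mono)
  obtain C where C: "0 \<le> C" "\<And>u. finite_energy s \<Omega> u \<Longrightarrow> (\<integral>y. indicator \<Omega> y * u y \<partial>lborel) = 0 \<Longrightarrow>
       (\<integral>y. indicator \<Omega> y * (u y)\<^sup>2 \<partial>lborel) \<le> C * energy_form s \<Omega> u u" using poincare by blast
  have energy_le: "(\<integral>\<^sup>+p. ennreal ((increment (\<lambda>x. w k x - u x) p)\<^sup>2) \<partial>energy_measure s \<Omega>) \<le> ennreal (4 * A * (1 / 4) ^ k)" for k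
  proof -
    have "(\<integral>\<^sup>+p. ennreal ((increment (\<lambda>x. w k x - u x) p)\<^sup>2) \<partial>energy_measure s \<Omega>)
       = (\<integral>\<^sup>+p. liminf (\<lambda>l. ennreal ((increment (\<lambda>x. w k x - w l x) p)\<^sup>2)) \<partial>energy_measure s \<Omega>)"
    proof (rule nn_integral_cong_AE)
      show "AE p in energy_measure s \<Omega>. ennreal ((increment (\<lambda>x. w k x - u x) p)\<^sup>2) =
          liminf (\<lambda>l. ennreal ((increment (\<lambda>x. w k x - w l x) p)\<^sup>2))"
        using conv2
      proof eventually_elim
        case (elim p)
        then have "(\<lambda>l. ennreal ((increment (\<lambda>x. w k x - w l x) p)\<^sup>2)) \<longlonglongrightarrow> ennreal ((increment (\<lambda>x. w k x - u x) p)\<^sup>2)"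
          unfolding increment_def by (intro tendsto_intros) auto
        then show ?case by (rule lim_imp_Liminf[symmetric, rotated]) simp
      qed
    qed
    also have "\<dots> \<le> liminf (\<lambda>l. \<integral>\<^sup>+p. ennreal ((increment (\<lambda>x. w k x - w l x) p)\<^sup>2) \<partial>energy_measure s \<Omega>)"
      by (rule nn_integral_liminf) measurable
    also have "\<dots> \<le> liminf (\<lambda>l. ennreal (4 * A * (1 / 4) ^ k))"
    proof (rule Liminf_mono)
      show "\<forall>\<^sub>F l in sequentially. (\<integral>\<^sup>+p. ennreal ((increment (\<lambda>x. w k x - w l x) p)\<^sup>2) \<partial>energy_measure s \<Omega>) \<le> ennreal (4 * A * (1 / 4) ^ k)"
        using eventually_ge_at_top[of k]
        by eventually_elim (simp only: nn_integral_energy[OF diff], intro ennreal_leI Cauchy')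
    qed
    also have "\<dots> = ennreal (4 * A * (1 / 4) ^ k)" by (simp add: Liminf_const)
    finally show ?thesis .
  qed
  have L2_le: "(\<integral>\<^sup>+x. ennreal (indicator \<Omega> x * (w k x - u x)\<^sup>2) \<partial>lborel) \<le> ennreal (C * (4 * A * (1 / 4) ^ k))" for k
  proof -
    have "(\<integral>\<^sup>+x. ennreal (indicator \<Omega> x * (w k x - u x)\<^sup>2) \<partial>lborel)
       = (\<integral>\<^sup>+x. liminf (\<lambda>l. ennreal (indicator \<Omega> x * (w k x - w l x)\<^sup>2)) \<partial>lborel)"
    proof (rule nn_integral_cong_AE)
      show "AE x in lborel. ennreal (indicator \<Omega> x * (w k x - u x)\<^sup>2) = liminf (\<lambda>l. ennreal (indicator \<Omega> x * (w k x - w l x)\<^sup>2))"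
        using conv
      proof eventually_elim
        case (elim x)
        then have "(\<lambda>l. ennreal (indicator \<Omega> x * (w k x - w l x)\<^sup>2)) \<longlonglongrightarrow> ennreal (indicator \<Omega> x * (w k x - u x)\<^sup>2)"
          by (intro tendsto_intros)
        then show ?case by (rule lim_imp_Liminf[symmetric, rotated]) simp
      qed
    qed
    also have "\<dots> \<le> liminf (\<lambda>l. \<integral>\<^sup>+x. ennreal (indicator \<Omega> x * (w k x - w l x)\<^sup>2) \<partial>lborel)"
      by (rule nn_integral_liminf) measurable
    also have "\<dots> \<le> liminf (\<lambda>l. ennreal (C * (4 * A * (1 / 4) ^ k)))"
    proof (rule Liminf_mono)
      have "(\<integral>\<^sup>+x. ennreal (indicator \<Omega> x * (w k x - w l x)\<^sup>2) \<partial>lborel) \<le> ennreal (C * (4 * A * (1 / 4) ^ k))" if "k \<le> l" for l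
      proof -
        have "(\<integral>\<^sup>+x. ennreal (indicator \<Omega> x * (w k x - w l x)\<^sup>2) \<partial>lborel) = ennreal (\<integral>x. indicator \<Omega> x * (w k x - w l x)\<^sup>2 \<partial>lborel)"
          using diff[of k l] by (intro nn_integral_eq_integral) (auto simp: finite_energy_def)
        also have "\<dots> \<le> ennreal (C * (4 * A * (1 / 4) ^ k))"
          using C(2)[OF diff[of k l] diff_mean] mult_left_mono[OF Cauchy'[OF that] C(1)] by (intro ennreal_leI) linarith
        finally show ?thesis .
      qed
      then show "\<forall>\<^sub>F l in sequentially. (\<integral>\<^sup>+x. ennreal (indicator \<Omega> x * (w k x - w l x)\<^sup>2) \<partial>lborel) \<le> ennreal (C * (4 * A * (1 / 4) ^ k))"
        by (rule eventually_sequentiallyI)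
    qed
    also have "\<dots> = ennreal (C * (4 * A * (1 / 4) ^ k))" by (simp add: Liminf_const)
    finally show ?thesis .
  qed
  have wu: "finite_energy s \<Omega> (\<lambda>x. w k x - u x)" for k
    unfolding finite_energy_def
  proof (intro conjI integrableI_nonneg)
    show "(\<integral>\<^sup>+p. ennreal ((increment (\<lambda>x. w k x - u x) p)\<^sup>2) \<partial>energy_measure s \<Omega>) < \<infinity>"
      using energy_le[of k] by (rule le_less_trans) simp
    show "(\<integral>\<^sup>+x. ennreal (indicator \<Omega> x * (w k x - u x)\<^sup>2) \<partial>lborel) < \<infinity>"
      using L2_le[of k] by (rule le_less_trans) simp
  qed auto
  show thesis
  proof (rule that[of u])
    show "finite_energy s \<Omega> u" using finite_energy_add[OF w wu, of 0 "- 1" 0] by simp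
    show "energy_form s \<Omega> (\<lambda>x. w k x - u x) (\<lambda>x. w k x - u x) \<le> 4 * A * (1 / 4) ^ k" for k
      using energy_le[of k] A unfolding nn_integral_energy[OF wu] by (subst (asm) ennreal_le_iff) auto
  qed
qed

end

subsection \<open>The nonlocal normal derivative as a functional\<close>

text \<open>Both are mean value estimates on compact balls. The second applies the mean value
  theorem to the symmetric sum \<open>\<psi> (y + t h) + \<psi> (y - t h)\<close>, whose derivative
  is a difference of gradients and so contributes another factor \<open>norm h\<close>. The gradient
  is needed on the larger ball of radius \<open>R + 1\<close>, as
  \<open>norm h \<le> 1\<close>.\<close>

lemma C2_function_bounds:
  fixes \<psi> :: "real ^ 'n \<Rightarrow> real"
  assumes "C2_function \<psi>"
  shows "\<exists>K\<ge>0. \<forall>x\<in>cball 0 R. \<forall>y\<in>cball 0 R. \<bar>\<psi> x - \<psi> y\<bar> \<le> K * norm (x - y)" (is ?lip)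
    and "\<exists>K\<ge>0. \<forall>y\<in>cball 0 R. \<forall>h. norm h \<le> 1 \<longrightarrow> \<bar>\<psi> (y + h) + \<psi> (y - h) - 2 * \<psi> y\<bar> \<le> K * (norm h)\<^sup>2" (is ?second)
proof -
  obtain G :: "real ^ 'n \<Rightarrow> real ^ 'n" and H :: "real ^ 'n \<Rightarrow> real ^ 'n ^ 'n" where
    G: "\<And>x. (\<psi> has_derivative (\<lambda>h. G x \<bullet> h)) (at x)" and
    H: "\<And>x. (G has_derivative (\<lambda>h. H x *v h)) (at x)" and cont: "continuous_on UNIV H"
    using assms unfolding C2_function_def by blast
  have contG: "continuous_on UNIV G"
    using H by (meson continuous_at_imp_continuous_on has_derivative_continuous)
  have "bounded (G ` cball 0 R)"
    by (intro compact_imp_bounded compact_continuous_image continuous_on_subset[OF contG]) auto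
  then obtain B1 where B1: "\<And>x. x \<in> cball 0 R \<Longrightarrow> norm (G x) \<le> B1" unfolding bounded_iff by blast
  have "norm (\<psi> x - \<psi> y) \<le> max B1 0 * norm (x - y)" if "x \<in> cball 0 R" "y \<in> cball 0 R" for x y
  proof (rule differentiable_bound[where S = "cball 0 R" and f' = "\<lambda>x h. G x \<bullet> h"])
    show "(\<psi> has_derivative (\<bullet>) (G x)) (at x within cball 0 R)" for x
      using G[of x] by (rule has_derivative_at_withinI)
    show "onorm ((\<bullet>) (G x)) \<le> max B1 0" if "x \<in> cball 0 R" for x
    proof (rule onorm_le)
      fix h
      have "norm (G x \<bullet> h) \<le> norm (G x) * norm h" by (simp add: Cauchy_Schwarz_ineq2)
      also have "\<dots> \<le> max B1 0 * norm h" using B1[OF that] by (intro mult_right_mono) auto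
      finally show "norm (G x \<bullet> h) \<le> max B1 0 * norm h" .
    qed
  qed (use that in auto)
  then show ?lip by (intro exI[of _ "max B1 0"]) (auto simp: real_norm_def)
  have "bounded (H ` cball 0 (R + 1))"
    by (intro compact_imp_bounded compact_continuous_image continuous_on_subset[OF cont]) auto
  then obtain B2 where B2: "\<And>x. x \<in> cball 0 (R + 1) \<Longrightarrow> norm (H x) \<le> B2" unfolding bounded_iff by blast
  \<comment> \<open>The squared dimension comes from bounding the operator norm of a matrix by its
    largest entry.\<close>
  define B where "B = real CARD('n) * real CARD('n) * max B2 0"
  have B0: "0 \<le> B" by (simp add: B_def)
  have lipG: "norm (G x - G y) \<le> B * norm (x - y)" if "x \<in> cball 0 (R + 1)" "y \<in> cball 0 (R + 1)" for x y
  proof (rule differentiable_bound[where S = "cball 0 (R + 1)" and f' = "\<lambda>x h. H x *v h"])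
    show "(G has_derivative (*v) (H x)) (at x within cball 0 (R + 1))" for x
      using H[of x] by (rule has_derivative_at_withinI)
    show "onorm ((*v) (H x)) \<le> B" if "x \<in> cball 0 (R + 1)" for x
      unfolding B_def
    proof (rule onorm_le_matrix_component)
      fix i j
      have "\<bar>H x $ i $ j\<bar> \<le> norm (H x $ i)" by (rule component_le_norm_cart)
      also have "\<dots> \<le> norm (H x)" by (rule Finite_Cartesian_Product.norm_nth_le)
      also have "\<dots> \<le> max B2 0" using B2[OF that] by simp
      finally show "\<bar>H x $ i $ j\<bar> \<le> max B2 0" .
    qed
  qed (use that in auto)
  show ?second
  proof (intro exI[of _ "2 * B"] conjI ballI allI impI)
    fix y h :: "real ^ 'n" assume y: "y \<in> cball 0 R" and h: "norm h \<le> 1"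
    define \<phi> where "\<phi> t = \<psi> (y + t *\<^sub>R h) + \<psi> (y - t *\<^sub>R h)" for t
    define \<phi>' where "\<phi>' t = G (y + t *\<^sub>R h) \<bullet> h - G (y - t *\<^sub>R h) \<bullet> h" for t
    have "(\<phi> has_real_derivative \<phi>' t) (at t)" for t
    proof -
      have "(\<phi> has_derivative (\<lambda>\<tau>. G (y + t *\<^sub>R h) \<bullet> (\<tau> *\<^sub>R h) + G (y - t *\<^sub>R h) \<bullet> (- (\<tau> *\<^sub>R h)))) (at t)"
        unfolding \<phi>_def
        by (intro has_derivative_add has_derivative_compose[of "\<lambda>t. y + t *\<^sub>R h", OF _ G]
            has_derivative_compose[of "\<lambda>t. y - t *\<^sub>R h", OF _ G]) (auto intro!: derivative_eq_intros)
      then show ?thesis unfolding has_field_derivative_def \<phi>'_def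
        by (rule has_derivative_eq_rhs) (auto simp: algebra_simps)
    qed
    then obtain z where z: "0 < z" "z < 1" "\<phi> 1 - \<phi> 0 = (1 - 0) * \<phi>' z"
      using MVT2[of 0 1 \<phi> \<phi>'] by auto
    have zh: "norm (z *\<^sub>R h) \<le> 1" using z h mult_le_one[of z "norm h"] by simp
    have "\<bar>\<phi>' z\<bar> \<le> norm (G (y + z *\<^sub>R h) - G (y - z *\<^sub>R h)) * norm h"
      unfolding \<phi>'_def inner_diff_left[symmetric] by (rule Cauchy_Schwarz_ineq2)
    also have "\<dots> \<le> (B * norm ((y + z *\<^sub>R h) - (y - z *\<^sub>R h))) * norm h"
      using y zh norm_triangle_ineq[of y "z *\<^sub>R h"] norm_triangle_ineq4[of y "z *\<^sub>R h"]
      by (intro mult_right_mono lipG) auto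
    also have "(y + z *\<^sub>R h) - (y - z *\<^sub>R h) = (2 * z) *\<^sub>R h"
      by (simp add: scaleR_add_left[symmetric])
    also have "B * norm ((2 * z) *\<^sub>R h) * norm h = (2 * B * (norm h)\<^sup>2) * z"
      using z by (simp add: power2_eq_square)
    also have "\<dots> \<le> (2 * B * (norm h)\<^sup>2) * 1" using z B0 by (intro mult_left_mono) auto
    finally have "\<bar>\<phi> 1 - \<phi> 0\<bar> \<le> 2 * B * (norm h)\<^sup>2" using z by simp
    then show "\<bar>\<psi> (y + h) + \<psi> (y - h) - 2 * \<psi> y\<bar> \<le> 2 * B * (norm h)\<^sup>2" by (simp add: \<phi>_def)
  qed (use B0 in auto)
qed

lemma C2_function_borel_measurable: "C2_function \<psi> \<Longrightarrow> \<psi> \<in> borel_measurable borel"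
  unfolding C2_function_def
  by (meson borel_measurable_continuous_onI continuous_at_imp_continuous_on has_derivative_continuous)

text \<open>The map \<open>y \<mapsto> x - y\<close> serves both as the substitution
  \<open>h = x - y\<close> and, for \<open>x = 0\<close>, as the reflection used for
  symmetrization.\<close>

lemma lborel_distr_reflect: "distr lborel borel (\<lambda>y. x - y) = (lborel :: 'a::euclidean_space measure)"
proof -
  have "(lborel :: 'a measure) = density (distr lborel borel (\<lambda>y. x - y)) (\<lambda>_. 1)"
    using lborel_affine[of "- 1" x] by (simp add: one_ennreal_def)
  then show ?thesis by (simp add: density_1)
qed

lemma nn_integral_lborel_reflect:
  fixes f :: "'a::euclidean_space \<Rightarrow> ennreal"
  assumes [measurable]: "f \<in> borel_measurable borel"
  shows "(\<integral>\<^sup>+y. f (x - y) \<partial>lborel) = (\<integral>\<^sup>+h. f h \<partial>lborel)"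
  by (subst (2) lborel_distr_reflect[of x, symmetric]) (simp add: nn_integral_distr)

lemma integral_lborel_reflect:
  fixes f :: "'a::euclidean_space \<Rightarrow> real"
  assumes [measurable]: "f \<in> borel_measurable borel"
  shows "(\<integral>y. f (x - y) \<partial>lborel) = (\<integral>h. f h \<partial>lborel)"
  by (subst (2) lborel_distr_reflect[of x, symmetric]) (simp add: integral_distr)

lemma integrable_lborel_reflect:
  fixes f :: "'a::euclidean_space \<Rightarrow> real"
  assumes [measurable]: "f \<in> borel_measurable borel"
  shows "integrable lborel (\<lambda>y. f (x - y)) \<longleftrightarrow> integrable lborel f"
  by (subst (2) lborel_distr_reflect[of x, symmetric]) (simp add: integrable_distr_eq)

lemma abs_integral_le_dominating:
  fixes f h :: "'a \<Rightarrow> real"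
  assumes "integrable M h" "f \<in> borel_measurable M" "\<And>x. \<bar>f x\<bar> \<le> h x"
  shows "integrable M f" and "\<bar>\<integral>x. f x \<partial>M\<bar> \<le> (\<integral>x. h x \<partial>M)"
proof -
  show f: "integrable M f"
  proof (rule Bochner_Integration.integrable_bound[OF assms(1,2)])
    show "AE x in M. norm (f x) \<le> norm (h x)"
      using order_trans[OF assms(3) abs_ge_self] by simp
  qed
  have "\<bar>\<integral>x. f x \<partial>M\<bar> \<le> (\<integral>x. \<bar>f x\<bar> \<partial>M)" by (rule integral_abs_bound)
  also have "\<dots> \<le> (\<integral>x. h x \<partial>M)" using assms f by (intro integral_mono) auto
  finally show "\<bar>\<integral>x. f x \<partial>M\<bar> \<le> (\<integral>x. h x \<partial>M)" .
qed

section \<open>The kernel cut off near the diagonal, and cancellation by symmetry\<close>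

definition truncated_kernel :: "real \<Rightarrow> real \<Rightarrow> real ^ 'n \<Rightarrow> real" where
  "truncated_kernel s \<epsilon> h = indicator {h. \<epsilon> \<le> norm h} h * norm h powr - (real CARD('n) + 2 * s)"

lemma truncated_kernel_nonneg [simp]: "0 \<le> truncated_kernel s \<epsilon> h" by (simp add: truncated_kernel_def)

lemma truncated_kernel_minus [simp]: "truncated_kernel s \<epsilon> (- h) = truncated_kernel s \<epsilon> h"
  by (simp add: truncated_kernel_def indicator_def)

lemma truncated_kernel_commute: "truncated_kernel s \<epsilon> (x - y) = truncated_kernel s \<epsilon> (y - x)"
  using truncated_kernel_minus[of s \<epsilon> "x - y"] by simp

lemma truncated_kernel_le: "truncated_kernel s \<epsilon> (x - y) \<le> riesz_kernel s x y"
  by (simp add: truncated_kernel_def riesz_kernel_def indicator_def)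

lemma truncated_kernel_measurable [measurable]: "truncated_kernel s \<epsilon> \<in> borel_measurable borel"
  unfolding truncated_kernel_def[abs_def] by measurable

lemma borel_measurable_fst_snd [measurable]:
  "fst \<in> borel_measurable (borel :: ('a::second_countable_topology \<times> 'b::second_countable_topology) measure)"
  "snd \<in> borel_measurable (borel :: ('a \<times> 'b) measure)"
  by (auto intro!: borel_measurable_continuous_onI continuous_intros)

lemma truncated_kernel_integrable:
  assumes "0 < s" "0 < \<epsilon>"
  shows "integrable lborel (truncated_kernel s \<epsilon> :: real ^ 'n \<Rightarrow> real)"
proof (intro integrableI_nonneg)
  obtain C where "(\<integral>\<^sup>+h. indicator {h. \<epsilon> \<le> norm h} h * ennreal (norm h powr - (real CARD('n) + 2 * s))
      \<partial>(lborel :: (real ^ 'n) measure)) \<le> ennreal (C * \<epsilon> powr - (2 * s))"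
    using nn_integral_kernel_far[of "2 * s", where 'a = "real ^ 'n"] assms by auto
  then show "(\<integral>\<^sup>+h. ennreal (truncated_kernel s \<epsilon> (h :: real ^ 'n)) \<partial>lborel) < \<infinity>"
    unfolding truncated_kernel_def by (simp add: ennreal_mult' ennreal_indicator le_less_trans)
qed auto

text \<open>Averaging over \<open>h\<close> and \<open>- h\<close> replaces
  \<open>\<psi> (y + h) - \<psi> y\<close> by a second difference. This is
  \<open>O((norm h)\<^sup>2)\<close> and leaves the power \<open>(2 - 2 * s) - n\<close>, integrable
  at the origin because \<open>s < 1\<close>. The dominating function \<open>J\<close> involves
  neither \<open>\<epsilon>\<close> nor \<open>y\<close>.\<close>

lemma second_difference_integral_bound:
  fixes \<psi> :: "real ^ 'n \<Rightarrow> real"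
  assumes s: "0 < s" "s < 1" and \<psi>: "C2_function \<psi>"
  shows "\<exists>K\<ge>0. \<forall>y\<in>cball 0 R. \<forall>\<epsilon>>0.
    \<bar>\<integral>x. indicator {h. norm h < 1} (x - y) * (truncated_kernel s \<epsilon> (x - y) * (\<psi> x - \<psi> y)) \<partial>lborel\<bar> \<le> K"
proof -
  obtain K where K: "0 \<le> K" "\<And>y h. y \<in> cball 0 R \<Longrightarrow> norm h \<le> 1 \<Longrightarrow> \<bar>\<psi> (y + h) + \<psi> (y - h) - 2 * \<psi> y\<bar> \<le> K * (norm h)\<^sup>2"
    using C2_function_bounds(2)[OF \<psi>] by blast
  obtain L where L: "0 \<le> L" "\<And>x y. x \<in> cball 0 (R + 1) \<Longrightarrow> y \<in> cball 0 (R + 1) \<Longrightarrow> \<bar>\<psi> x - \<psi> y\<bar> \<le> L * norm (x - y)"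
    using C2_function_bounds(1)[OF \<psi>] by blast
  have [measurable]: "\<psi> \<in> borel_measurable borel" by (rule C2_function_borel_measurable[OF \<psi>])
  define J where "J h = K * (indicator {h. norm h < 1} h * norm h powr ((2 - 2 * s) - real CARD('n)))" for h :: "real ^ 'n"
  have J: "integrable lborel J"
    unfolding J_def
  proof (intro integrable_mult_right integrableI_nonneg)
    show "(\<integral>\<^sup>+h. ennreal (indicator {h. norm h < 1} h * norm h powr ((2 - 2 * s) - real CARD('n))) \<partial>(lborel :: (real ^ 'n) measure)) < \<infinity>"
      using nn_integral_kernel_near[of "2 - 2 * s", where 'a = "real ^ 'n"] s
      by (simp add: ennreal_mult' ennreal_indicator)
  qed auto
  have "\<bar>\<integral>x. indicator {h. norm h < 1} (x - y) * (truncated_kernel s \<epsilon> (x - y) * (\<psi> x - \<psi> y)) \<partial>lborel\<bar> \<le> (\<integral>h. J h \<partial>lborel)"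
    if y: "y \<in> cball 0 R" and \<epsilon>: "0 < \<epsilon>" for y \<epsilon>
  proof -
    define f where "f h = indicator {h. norm h < 1} h * (truncated_kernel s \<epsilon> h * (\<psi> (y + h) - \<psi> y))" for h
    have [measurable]: "f \<in> borel_measurable borel" unfolding f_def[abs_def] by measurable
    \<comment> \<open>The size of this dominating function depends on \<open>\<epsilon>\<close>,
      which is harmless: it only permits adding the integrals of \<open>f h\<close> and
      \<open>f (- h)\<close>.\<close>
    have f: "integrable lborel f"
    proof (rule abs_integral_le_dominating(1))
      show "integrable lborel (\<lambda>h :: real ^ 'n. L * truncated_kernel s \<epsilon> h)"
        using truncated_kernel_integrable[OF s(1) \<epsilon>] by (intro integrable_mult_right)
      fix h :: "real ^ 'n"
      show "\<bar>f h\<bar> \<le> L * truncated_kernel s \<epsilon> h"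
      proof (cases "norm h < 1")
        case True
        have "\<bar>\<psi> (y + h) - \<psi> y\<bar> \<le> L * norm (y + h - y)"
          using y True norm_triangle_ineq[of y h] by (intro L) auto
        also have "\<dots> \<le> L" using True L(1) mult_left_mono[of "norm h" 1 L] by simp
        finally have "truncated_kernel s \<epsilon> h * \<bar>\<psi> (y + h) - \<psi> y\<bar> \<le> truncated_kernel s \<epsilon> h * L"
          by (rule mult_left_mono) simp
        then show ?thesis using True by (simp add: f_def abs_mult mult.commute)
      qed (use L in \<open>simp add: f_def\<close>)
    qed measurable
    have f': "integrable lborel (\<lambda>h. f (- h))" "(\<integral>h. f (- h) \<partial>lborel) = (\<integral>h. f h \<partial>lborel)"
      using integrable_lborel_reflect[of f 0] integral_lborel_reflect[of f 0] f by simp_all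
    have shift: "(\<integral>x. indicator {h. norm h < 1} (x - y) * (truncated_kernel s \<epsilon> (x - y) * (\<psi> x - \<psi> y)) \<partial>lborel) = (\<integral>h. f h \<partial>lborel)"
      using integral_lborel_reflect[of "\<lambda>h. f (- h)" y] f'(2) by (simp add: f_def)
    have "2 * (\<integral>h. f h \<partial>lborel) = (\<integral>h. f h + f (- h) \<partial>lborel)"
      using f f' by simp
    moreover have "\<bar>\<integral>h. f h + f (- h) \<partial>lborel\<bar> \<le> (\<integral>h. J h \<partial>lborel)"
    proof (rule abs_integral_le_dominating(2)[OF J])
      fix h :: "real ^ 'n"
      have sum: "f h + f (- h) = indicator {h. norm h < 1} h * (truncated_kernel s \<epsilon> h * (\<psi> (y + h) + \<psi> (y - h) - 2 * \<psi> y))"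
        by (simp add: f_def indicator_def algebra_simps)
      show "\<bar>f h + f (- h)\<bar> \<le> J h"
      proof (cases "norm h < 1 \<and> h \<noteq> 0")
        case True
        have "truncated_kernel s \<epsilon> h * \<bar>\<psi> (y + h) + \<psi> (y - h) - 2 * \<psi> y\<bar> \<le>
            norm h powr - (real CARD('n) + 2 * s) * (K * (norm h)\<^sup>2)"
          using K(2)[OF y, of h] True by (intro mult_mono) (auto simp: truncated_kernel_def indicator_def)
        also have "\<dots> = K * norm h powr ((2 - 2 * s) - real CARD('n))"
          using True powr_add[of "norm h" 2 "- (real CARD('n) + 2 * s)"] by (simp add: algebra_simps)
        finally show ?thesis unfolding sum using True by (simp add: J_def abs_mult)
      next
        case False
        then show ?thesis unfolding sum using K(1) by (auto simp: J_def indicator_def)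
      qed
    qed measurable
    moreover have "0 \<le> (\<integral>h. J h \<partial>lborel)" using K(1) by (simp add: J_def)
    ultimately show ?thesis unfolding shift by linarith
  qed
  then show ?thesis using K(1) by (intro exI[of _ "\<integral>h. J h \<partial>lborel"]) (auto simp: J_def)
qed

context nonlocal_domain
begin

definition energy_density :: "(real ^ 'n \<Rightarrow> real) \<Rightarrow> (real ^ 'n) \<times> (real ^ 'n) \<Rightarrow> real" where
  "energy_density u p = indicator (cross_region \<Omega>) p * riesz_kernel s (fst p) (snd p) * (increment u p)\<^sup>2"

lemma energy_density_nonneg [simp]: "0 \<le> energy_density u p"
  by (simp add: energy_density_def)

lemma energy_density_integral:
  assumes u: "finite_energy s \<Omega> u"
  shows "integrable lborel (energy_density u)" "(\<integral>p. energy_density u p \<partial>lborel) = energy_form s \<Omega> u u"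
proof -
  note [measurable] = u[THEN finite_energy_measurable]
  have [measurable]: "(\<lambda>p. (increment u p)\<^sup>2) \<in> borel_measurable borel" by measurable
  show "integrable lborel (energy_density u)"
    using u integral_energy_measure(2)[of "\<lambda>p. (increment u p)\<^sup>2"]
    by (simp add: finite_energy_def energy_density_def[abs_def])
  show "(\<integral>p. energy_density u p \<partial>lborel) = energy_form s \<Omega> u u"
    using integral_energy_measure(1)[of "\<lambda>p. (increment u p)\<^sup>2"]
    by (simp add: energy_form_def energy_density_def power2_eq_square)
qed

lemma truncated_mult_increments_le:
  assumes "fst p \<in> \<Omega> \<or> snd p \<in> \<Omega>"
  shows "truncated_kernel s \<epsilon> (fst p - snd p) * \<bar>increment u p * increment v p\<bar> \<le> (energy_density u p + energy_density v p) / 2"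
proof -
  have "\<bar>increment u p * increment v p\<bar> \<le> ((increment u p)\<^sup>2 + (increment v p)\<^sup>2) / 2"
    using sum_squares_bound[of "\<bar>increment u p\<bar>" "\<bar>increment v p\<bar>"] by (simp add: abs_mult)
  then have "truncated_kernel s \<epsilon> (fst p - snd p) * \<bar>increment u p * increment v p\<bar>
      \<le> riesz_kernel s (fst p) (snd p) * (((increment u p)\<^sup>2 + (increment v p)\<^sup>2) / 2)"
    by (intro mult_mono truncated_kernel_le) auto
  then show ?thesis using assms by (simp add: energy_density_def cross_region_alt algebra_simps)
qed

text \<open>Tonelli with \<open>x\<close> integrated first: the integral of the translated kernel
  does not depend on \<open>y\<close>. Used at \<open>\<epsilon>\<close> for bare integrability, and
  at \<open>1\<close> for a bound free of \<open>\<epsilon>\<close>.\<close>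

lemma L2_truncated_integrable:
  assumes v: "finite_energy s \<Omega> v" and \<epsilon>: "0 < \<epsilon>"
  shows "integrable lborel (\<lambda>p. indicator \<Omega> (snd p) * (v (snd p))\<^sup>2 * truncated_kernel s \<epsilon> (fst p - snd p))" (is "integrable _ ?f")
    and "(\<integral>p. indicator \<Omega> (snd p) * (v (snd p))\<^sup>2 * truncated_kernel s \<epsilon> (fst p - snd p) \<partial>lborel) =
      (\<integral>h. truncated_kernel s \<epsilon> (h :: real ^ 'n) \<partial>lborel) * (\<integral>y. indicator \<Omega> y * (v y)\<^sup>2 \<partial>lborel)"
proof -
  note [measurable] = v[THEN finite_energy_measurable]
  let ?\<kappa> = "\<integral>h. truncated_kernel s \<epsilon> (h :: real ^ 'n) \<partial>lborel"
  have k: "integrable lborel (truncated_kernel s \<epsilon> :: real ^ 'n \<Rightarrow> real)"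
    by (rule truncated_kernel_integrable[OF s(1) \<epsilon>])
  have v2: "integrable lborel (\<lambda>y. indicator \<Omega> y * (v y)\<^sup>2)" using v by (simp add: finite_energy_def)
  have kx: "(\<integral>\<^sup>+x. ennreal (truncated_kernel s \<epsilon> (x - y)) \<partial>lborel) = ennreal ?\<kappa>" for y :: "real ^ 'n"
  proof -
    have "(\<integral>\<^sup>+x. ennreal (truncated_kernel s \<epsilon> (x - y)) \<partial>lborel) = (\<integral>\<^sup>+x. ennreal (truncated_kernel s \<epsilon> (y - x)) \<partial>lborel)"
      by (simp add: truncated_kernel_commute[of s \<epsilon> y])
    also have "\<dots> = (\<integral>\<^sup>+h. ennreal (truncated_kernel s \<epsilon> h) \<partial>(lborel :: (real ^ 'n) measure))"
      using nn_integral_lborel_reflect[of "\<lambda>h. ennreal (truncated_kernel s \<epsilon> h)" y] by simp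
    also have "\<dots> = ennreal ?\<kappa>" using k by (intro nn_integral_eq_integral) auto
    finally show ?thesis .
  qed
  have nn: "(\<integral>\<^sup>+p. ennreal (?f p) \<partial>lborel) = ennreal (?\<kappa> * (\<integral>y. indicator \<Omega> y * (v y)\<^sup>2 \<partial>lborel))"
  proof -
    have "(\<integral>\<^sup>+p. ennreal (?f p) \<partial>lborel) = (\<integral>\<^sup>+y. \<integral>\<^sup>+x. ennreal (?f (x, y)) \<partial>lborel \<partial>lborel)"
      unfolding lborel_prod[symmetric]
      by (rule lborel_pair.nn_integral_snd[symmetric]) (simp add: lborel_prod)
    also have "\<dots> = (\<integral>\<^sup>+y. ennreal (indicator \<Omega> y * (v y)\<^sup>2) * ennreal ?\<kappa> \<partial>lborel)"
      by (intro nn_integral_cong) (simp add: ennreal_mult nn_integral_cmult kx)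
    also have "\<dots> = ennreal (\<integral>y. indicator \<Omega> y * (v y)\<^sup>2 \<partial>lborel) * ennreal ?\<kappa>"
      using v2 by (subst nn_integral_multc) (auto simp: nn_integral_eq_integral)
    finally show ?thesis by (simp add: ennreal_mult mult.commute)
  qed
  show int: "integrable lborel ?f"
    by (intro integrableI_nonneg) (auto simp: nn)
  have "ennreal (\<integral>p. ?f p \<partial>lborel) = ennreal (?\<kappa> * (\<integral>y. indicator \<Omega> y * (v y)\<^sup>2 \<partial>lborel))"
    using nn nn_integral_eq_integral[OF int] by simp
  then show "(\<integral>p. ?f p \<partial>lborel) = ?\<kappa> * (\<integral>y. indicator \<Omega> y * (v y)\<^sup>2 \<partial>lborel)"
    by simp
qed

text \<open>The part of the double integral with \<open>x\<close> in \<open>\<Omega>\<close> is antisymmetrized. The part near the diagonal is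
  integrated first in \<open>x\<close>, where the first-order term of \<open>\<psi>\<close> cancels by symmetry.\<close>

lemma truncated_normal_deriv_bound:
  assumes \<psi>: "C2_function \<psi>" "finite_energy s \<Omega> \<psi>"
  shows "\<exists>K\<ge>0. \<forall>v \<epsilon>. finite_energy s \<Omega> v \<longrightarrow> 0 < \<epsilon> \<longrightarrow> \<epsilon> \<le> 1 \<longrightarrow>
    integrable lborel (\<lambda>p. indicator (- \<Omega>) (fst p) * indicator \<Omega> (snd p) * v (fst p) *
        (truncated_kernel s \<epsilon> (fst p - snd p) * increment \<psi> p)) \<and>
    \<bar>\<integral>p. indicator (- \<Omega>) (fst p) * indicator \<Omega> (snd p) * v (fst p) *
        (truncated_kernel s \<epsilon> (fst p - snd p) * increment \<psi> p) \<partial>lborel\<bar>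
      \<le> K * (1 + energy_form s \<Omega> v v + (\<integral>y. indicator \<Omega> y * (v y)\<^sup>2 \<partial>lborel))"
proof -
  note [measurable] = \<psi>(2)[THEN finite_energy_measurable]
  obtain R where R: "\<Omega> \<subseteq> cball 0 R"
    using bounded by (meson bounded_subset_ballD ball_subset_cball order_trans)
  obtain K0 where K0: "0 \<le> K0" "\<And>y \<epsilon>. y \<in> cball 0 R \<Longrightarrow> 0 < \<epsilon> \<Longrightarrow>
     \<bar>\<integral>x. indicator {h. norm h < 1} (x - y) * (truncated_kernel s \<epsilon> (x - y) * (\<psi> x - \<psi> y)) \<partial>lborel\<bar> \<le> K0"
    using second_difference_integral_bound[OF s \<psi>(1), of R] by blast
  define \<kappa> where "\<kappa> = (\<integral>h. truncated_kernel s 1 (h :: real ^ 'n) \<partial>lborel)"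
  have \<kappa>: "0 \<le> \<kappa>" by (simp add: \<kappa>_def)
  define E where "E = energy_form s \<Omega> \<psi> \<psi>"
  have E: "0 \<le> E" unfolding E_def by (rule energy_form_nonneg)
  \<comment> \<open>Collects the bounds of the pieces: \<open>E\<close> from the products with
    increments of \<open>\<psi>\<close>, \<open>\<kappa>\<close> from the far part,
    \<open>K0\<close> and the volume of \<open>\<Omega>\<close> from the near part.\<close>
  define K where "K = 2 * E + 2 + \<kappa> + K0 * (measure lborel \<Omega> + 1)"
  have bound: "integrable lborel (\<lambda>p. indicator (- \<Omega>) (fst p) * indicator \<Omega> (snd p) * v (fst p) *
        (truncated_kernel s \<epsilon> (fst p - snd p) * increment \<psi> p)) \<and>
    \<bar>\<integral>p. indicator (- \<Omega>) (fst p) * indicator \<Omega> (snd p) * v (fst p) *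
        (truncated_kernel s \<epsilon> (fst p - snd p) * increment \<psi> p) \<partial>lborel\<bar>
      \<le> K * (1 + energy_form s \<Omega> v v + (\<integral>y. indicator \<Omega> y * (v y)\<^sup>2 \<partial>lborel))"
    if v: "finite_energy s \<Omega> v" and \<epsilon>: "0 < \<epsilon>" "\<epsilon> \<le> 1" for v \<epsilon>
  proof -
    note [measurable] = v[THEN finite_energy_measurable]
    define L2 where "L2 = (\<integral>y. indicator \<Omega> y * (v y)\<^sup>2 \<partial>lborel)"
    have L2: "0 \<le> L2" by (simp add: L2_def)
    have v2: "integrable lborel (\<lambda>y. indicator \<Omega> y * (v y)\<^sup>2)" using v by (simp add: finite_energy_def)
    define Ev where "Ev = energy_form s \<Omega> v v"
    have Ev: "0 \<le> Ev" unfolding Ev_def by (rule energy_form_nonneg)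
    define k where "k p = truncated_kernel s \<epsilon> (fst p - snd p)" for p :: "(real ^ 'n) \<times> (real ^ 'n)"
    have [measurable]: "k \<in> borel_measurable borel" unfolding k_def[abs_def] by measurable
    have k0: "0 \<le> k p" for p by (simp add: k_def)
    \<comment> \<open>\<open>T1\<close> carries the increment \<open>v x - v y\<close>, and
      \<open>T\<close> the remaining \<open>v y\<close> with \<open>x\<close> ranging over the whole
      space, as the symmetry argument needs. \<open>T3\<close> is the surplus with \<open>x\<close>
      in \<open>\<Omega>\<close>; \<open>Tn\<close> and \<open>Tf\<close> divide \<open>T\<close> at
      distance \<open>1\<close>.\<close>
    define T1 where "T1 p = indicator (- \<Omega>) (fst p) * indicator \<Omega> (snd p) * (k p * (increment v p * increment \<psi> p))" for p
    define T where "T p = indicator \<Omega> (snd p) * v (snd p) * (k p * increment \<psi> p)" for p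
    define T3 where "T3 p = indicator \<Omega> (fst p) * T p" for p
    define Tn where "Tn p = indicator {h. norm h < 1} (fst p - snd p) * T p" for p
    define Tf where "Tf p = indicator {h. 1 \<le> norm h} (fst p - snd p) * T p" for p
    have [measurable]: "T \<in> borel_measurable borel" unfolding T_def[abs_def] by measurable
    have [measurable]: "T1 \<in> borel_measurable borel" "T3 \<in> borel_measurable borel"
      "Tn \<in> borel_measurable borel" "Tf \<in> borel_measurable borel"
      unfolding T1_def[abs_def] T3_def[abs_def] Tn_def[abs_def] Tf_def[abs_def] by measurable
    define D where "D p = (energy_density v p + energy_density \<psi> p) / 2" for p
    have D: "integrable lborel D" "(\<integral>p. D p \<partial>lborel) = (Ev + E) / 2"
      using energy_density_integral[OF v] energy_density_integral[OF \<psi>(2)]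
      by (simp_all add: D_def[abs_def] Ev_def E_def)
    have D_ge: "k p * \<bar>increment v p * increment \<psi> p\<bar> \<le> D p" if "fst p \<in> \<Omega> \<or> snd p \<in> \<Omega>" for p
      unfolding D_def k_def by (rule truncated_mult_increments_le[OF that])
    have D0: "0 \<le> D p" for p by (simp add: D_def)
    have T1: "integrable lborel T1" "\<bar>\<integral>p. T1 p \<partial>lborel\<bar> \<le> (Ev + E) / 2"
    proof -
      have "\<bar>T1 p\<bar> \<le> D p" for p
        using D_ge[of p] D0[of p] k0[of p] by (auto simp: T1_def abs_mult indicator_def)
      then show "integrable lborel T1" "\<bar>\<integral>p. T1 p \<partial>lborel\<bar> \<le> (Ev + E) / 2"
        using abs_integral_le_dominating[OF D(1), of T1] D(2) by auto
    qed
    have T_le: "\<bar>T p\<bar> \<le> indicator \<Omega> (snd p) * (v (snd p))\<^sup>2 * k p + energy_density \<psi> p" for p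
    proof (cases "snd p \<in> \<Omega>")
      case True
      have "\<bar>v (snd p) * increment \<psi> p\<bar> \<le> (v (snd p))\<^sup>2 + (increment \<psi> p)\<^sup>2"
        using sum_squares_bound[of "\<bar>v (snd p)\<bar>" "\<bar>increment \<psi> p\<bar>"]
          mult_nonneg_nonneg[of "\<bar>v (snd p)\<bar>" "\<bar>increment \<psi> p\<bar>"]
        unfolding abs_mult power2_abs by linarith
      then have "k p * \<bar>v (snd p) * increment \<psi> p\<bar> \<le> k p * ((v (snd p))\<^sup>2 + (increment \<psi> p)\<^sup>2)"
        by (rule mult_left_mono) (rule k0)
      also have "\<dots> = (v (snd p))\<^sup>2 * k p + k p * (increment \<psi> p)\<^sup>2" by (simp add: algebra_simps)
      also have "\<dots> \<le> (v (snd p))\<^sup>2 * k p + riesz_kernel s (fst p) (snd p) * (increment \<psi> p)\<^sup>2"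
        unfolding k_def by (intro add_left_mono mult_right_mono truncated_kernel_le) simp
      finally show ?thesis
        using True k0[of p] by (simp add: T_def abs_mult energy_density_def cross_region_alt mult_ac)
    qed (simp add: T_def k0)
    \<comment> \<open>The integral of this bound may blow up as \<open>\<epsilon>\<close> tends to
      \<open>0\<close>. It is used only to justify splitting and swapping; uniform estimates follow
      for each piece.\<close>
    have T: "integrable lborel T"
      using abs_integral_le_dominating(1)[OF Bochner_Integration.integrable_add[OF L2_truncated_integrable(1)[OF v \<epsilon>(1)]
          energy_density_integral(1)[OF \<psi>(2)]], of T] T_le by (simp add: k_def)
    have T3: "integrable lborel T3" and Tn: "integrable lborel Tn" and Tf: "integrable lborel Tf"
      by (auto intro!: Bochner_Integration.integrable_bound[OF T] simp: T3_def Tn_def Tf_def indicator_def)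
    have T3_bound: "\<bar>\<integral>p. T3 p \<partial>lborel\<bar> \<le> (Ev + E) / 2"
    proof -
      define T3' where "T3' p = T3 (snd p, fst p)" for p
      have swap: "(\<integral>p. T3' p \<partial>lborel) = (\<integral>p. T3 p \<partial>lborel)" "integrable lborel T3'"
      proof -
        have T3m: "T3 \<in> borel_measurable (lborel \<Otimes>\<^sub>M lborel)" by (simp add: lborel_prod)
        show "(\<integral>p. T3' p \<partial>lborel) = (\<integral>p. T3 p \<partial>lborel)"
          using lborel_pair.integral_product_swap[OF T3m] by (simp add: lborel_prod T3'_def case_prod_unfold)
        show "integrable lborel T3'"
          using lborel_pair.integrable_product_swap[of T3] T3 by (simp add: lborel_prod T3'_def[abs_def] case_prod_unfold)
      qed
      have "2 * (\<integral>p. T3 p \<partial>lborel) = (\<integral>p. T3 p + T3' p \<partial>lborel)"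
        using swap T3 by simp
      moreover have "\<bar>\<integral>p. T3 p + T3' p \<partial>lborel\<bar> \<le> (\<integral>p. D p \<partial>lborel)"
      proof (rule abs_integral_le_dominating(2)[OF D(1)])
        show "(\<lambda>p. T3 p + T3' p) \<in> borel_measurable lborel" using swap(2) T3 by simp
        fix p
        have "k (snd p, fst p) = k p" unfolding k_def by (simp add: truncated_kernel_commute)
        \<comment> \<open>The kernel is symmetric, and \<open>v y - v x\<close> is left over as the
          factor of the increment of \<open>\<psi>\<close>. So the undifferenced \<open>v\<close>
          disappears.\<close>
        then have "T3 p + T3' p = - (indicator \<Omega> (fst p) * indicator \<Omega> (snd p) * (k p * (increment v p * increment \<psi> p)))"
          by (simp add: T3_def T3'_def T_def increment_def algebra_simps)
        then show "\<bar>T3 p + T3' p\<bar> \<le> D p"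
          using D_ge[of p] D0[of p] k0[of p] by (auto simp: abs_mult indicator_def)
      qed
      ultimately show ?thesis using D(2) Ev E by simp
    qed
    have Tf_bound: "\<bar>\<integral>p. Tf p \<partial>lborel\<bar> \<le> \<kappa> * L2 + E"
    proof -
      let ?h = "\<lambda>p. indicator \<Omega> (snd p) * (v (snd p))\<^sup>2 * truncated_kernel s 1 (fst p - snd p) + energy_density \<psi> p"
      have h: "integrable lborel ?h" "(\<integral>p. ?h p \<partial>lborel) = \<kappa> * L2 + E"
        using L2_truncated_integrable[OF v, of 1] energy_density_integral[OF \<psi>(2)]
        by (simp_all add: \<kappa>_def L2_def E_def)
      have "\<bar>Tf p\<bar> \<le> ?h p" for p
      proof (cases "1 \<le> norm (fst p - snd p)")
        case True
        \<comment> \<open>As \<open>\<epsilon> \<le> 1\<close>, both cutoffs are inactive at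
          distance at least \<open>1\<close>; this is where \<open>\<kappa>\<close> replaces a
          quantity depending on \<open>\<epsilon>\<close>.\<close>
        then have "k p = truncated_kernel s 1 (fst p - snd p)"
          using \<epsilon> by (simp add: k_def truncated_kernel_def indicator_def)
        then show ?thesis using T_le[of p] True by (simp add: Tf_def)
      qed (simp add: Tf_def)
      then show ?thesis using abs_integral_le_dominating(2)[OF h(1), of Tf] h(2) by simp
    qed
    have Tn_bound: "\<bar>\<integral>p. Tn p \<partial>lborel\<bar> \<le> K0 * (measure lborel \<Omega> + L2)"
    proof -
      have "(\<integral>p. Tn p \<partial>lborel) = (\<integral>y. \<integral>x. Tn (x, y) \<partial>lborel \<partial>lborel)"
        using lborel_pair.integral_snd[of "\<lambda>x y. Tn (x, y)"] Tn by (simp add: lborel_prod)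
      moreover have "\<bar>\<integral>y. \<integral>x. Tn (x, y) \<partial>lborel \<partial>lborel\<bar> \<le> (\<integral>y. K0 * (indicator \<Omega> y + indicator \<Omega> y * (v y)\<^sup>2) \<partial>lborel)"
      proof (rule abs_integral_le_dominating(2))
        show "integrable lborel (\<lambda>y. K0 * (indicator \<Omega> y + indicator \<Omega> y * (v y)\<^sup>2))"
          using integrable_domain v2 by (intro integrable_mult_right Bochner_Integration.integrable_add)
        have "(\<lambda>(y, x). Tn (x, y)) \<in> borel_measurable (lborel \<Otimes>\<^sub>M lborel)"
          by (simp add: lborel_prod case_prod_unfold)
        then show "(\<lambda>y. \<integral>x. Tn (x, y) \<partial>lborel) \<in> borel_measurable lborel"
          using lborel.borel_measurable_lebesgue_integral[of "\<lambda>y x. Tn (x, y)" lborel] by simp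
        fix y
        show "\<bar>\<integral>x. Tn (x, y) \<partial>lborel\<bar> \<le> K0 * (indicator \<Omega> y + indicator \<Omega> y * (v y)\<^sup>2)"
        proof (cases "y \<in> \<Omega>")
          case True
          have "(\<integral>x. Tn (x, y) \<partial>lborel) = (\<integral>x. v y * (indicator {h. norm h < 1} (x - y) * (truncated_kernel s \<epsilon> (x - y) * (\<psi> x - \<psi> y))) \<partial>lborel)"
            using True by (simp add: Tn_def T_def k_def increment_def mult_ac)
          also have "\<dots> = v y * (\<integral>x. indicator {h. norm h < 1} (x - y) * (truncated_kernel s \<epsilon> (x - y) * (\<psi> x - \<psi> y)) \<partial>lborel)"
            by simp
          finally have "\<bar>\<integral>x. Tn (x, y) \<partial>lborel\<bar> \<le> \<bar>v y\<bar> * K0"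
            using K0(2)[of y \<epsilon>] True R \<epsilon> by (auto simp: abs_mult intro!: mult_left_mono)
          \<comment> \<open>The linear bound in \<open>\<bar>v y\<bar>\<close> is traded for a
            quadratic one. The summand \<open>1\<close>, integrated over \<open>\<Omega>\<close>,
            produces the volume in the bound.\<close>
          also have "\<dots> \<le> (1 + (v y)\<^sup>2) * K0"
          proof (rule mult_right_mono)
            show "\<bar>v y\<bar> \<le> 1 + (v y)\<^sup>2"
              using sum_squares_bound[of "\<bar>v y\<bar>" 1] unfolding power2_abs power_one by linarith
          qed (rule K0(1))
          finally show ?thesis using True by (simp add: mult.commute)
        qed (simp add: Tn_def T_def)
      qed
      moreover have "(\<integral>y. K0 * (indicator \<Omega> y + indicator \<Omega> y * (v y)\<^sup>2) \<partial>lborel) = K0 * (measure lborel \<Omega> + L2)"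
        using integrable_domain v2 by (simp add: L2_def)
      ultimately show ?thesis by linarith
    qed
    have split: "indicator (- \<Omega>) (fst p) * indicator \<Omega> (snd p) * v (fst p) * (truncated_kernel s \<epsilon> (fst p - snd p) * increment \<psi> p)
        = T1 p + Tn p + Tf p - T3 p" for p
      by (auto simp: T1_def Tn_def Tf_def T3_def T_def k_def increment_def indicator_def algebra_simps)
    have "\<bar>\<integral>p. T1 p + Tn p + Tf p - T3 p \<partial>lborel\<bar> \<le> (Ev + E) / 2 + K0 * (measure lborel \<Omega> + L2) + (\<kappa> * L2 + E) + (Ev + E) / 2"
      using T1 Tn Tf T3 T3_bound Tn_bound Tf_bound by simp
    also have "\<dots> \<le> K * (1 + Ev + L2)"
    proof -
      have "0 \<le> E * Ev" "0 \<le> E * L2" "0 \<le> K0 * measure lborel \<Omega> * Ev" "0 \<le> K0 * measure lborel \<Omega> * L2"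
        "0 \<le> K0 * Ev" "0 \<le> \<kappa> * Ev"
        using E Ev L2 K0(1) \<kappa> by simp_all
      then show ?thesis using E Ev L2 K0(1) \<kappa> by (simp add: K_def algebra_simps)
    qed
    finally show ?thesis
      using T1 Tn Tf T3 unfolding split Ev_def[symmetric] L2_def[symmetric] by simp
  qed
  have "0 \<le> K" using E \<kappa> K0(1) by (simp add: K_def)
  with bound show ?thesis by blast
qed

end

section \<open>Clamped test functions and removal of the cutoff\<close>

lemma abs_integral_le_AE:
  fixes f h :: "'a \<Rightarrow> real"
  assumes h: "integrable M h" and f: "integrable M f" and le: "AE x in M. \<bar>f x\<bar> \<le> h x"
  shows "\<bar>\<integral>x. f x \<partial>M\<bar> \<le> (\<integral>x. h x \<partial>M)"
proof -
  have "\<bar>\<integral>x. f x \<partial>M\<bar> \<le> (\<integral>x. \<bar>f x\<bar> \<partial>M)" by (rule integral_abs_bound)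
  also have "\<dots> \<le> (\<integral>x. h x \<partial>M)" using h f le by (intro integral_mono_AE) auto
  finally show ?thesis .
qed

definition clamp_at :: "real \<Rightarrow> ('a \<Rightarrow> real) \<Rightarrow> 'a \<Rightarrow> real" where
  "clamp_at m v x = max (- m) (min m (v x))"

lemma clamp_at_bounded: "0 \<le> m \<Longrightarrow> \<bar>clamp_at m v x\<bar> \<le> m"
  by (auto simp: clamp_at_def)

lemma clamp_at_abs_le: "0 \<le> m \<Longrightarrow> \<bar>clamp_at m v x\<bar> \<le> \<bar>v x\<bar>"
  by (auto simp: clamp_at_def)

lemma clamp_at_eq: "\<bar>v x\<bar> \<le> m \<Longrightarrow> clamp_at m v x = v x"
  by (auto simp: clamp_at_def)

text \<open>Clamping is monotone and 1-Lipschitz, so the clamped increment lies between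
  \<open>0\<close> and the original one. The first inequality makes the clamped function a useful
  test function for uniqueness; the second keeps the energy from growing.\<close>

lemma clamp_at_increment_sq_le:
  assumes "0 \<le> m"
  shows "(increment (clamp_at m v) p)\<^sup>2 \<le> increment v p * increment (clamp_at m v) p"
    and "(increment (clamp_at m v) p)\<^sup>2 \<le> (increment v p)\<^sup>2"
proof -
  define a b where "a = v (fst p)" and "b = v (snd p)"
  define a' b' where "a' = max (- m) (min m a)" and "b' = max (- m) (min m b)"
  have eq: "increment (clamp_at m v) p = a' - b'" "increment v p = a - b"
    by (simp_all add: increment_def clamp_at_def a_def b_def a'_def b'_def)
  have cases: "0 \<le> a' - b' \<and> a' - b' \<le> a - b \<or> a - b \<le> a' - b' \<and> a' - b' \<le> 0"
    using assms by (auto simp: a'_def b'_def max_def min_def)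
  show "(increment (clamp_at m v) p)\<^sup>2 \<le> increment v p * increment (clamp_at m v) p"
    unfolding eq power2_eq_square using cases by (auto intro: mult_right_mono mult_right_mono_neg)
  show "(increment (clamp_at m v) p)\<^sup>2 \<le> (increment v p)\<^sup>2"
    unfolding eq abs_le_square_iff[symmetric] using cases by auto
qed

lemma clamp_at_measurable [measurable]:
  "v \<in> borel_measurable M \<Longrightarrow> clamp_at m v \<in> borel_measurable M"
  unfolding clamp_at_def[abs_def] by (intro borel_measurable_max borel_measurable_min borel_measurable_const)

context nonlocal_domain
begin

lemma clamp_at_finite_energy:
  assumes v: "finite_energy s \<Omega> v" and m: "0 \<le> m"
  shows "finite_energy s \<Omega> (clamp_at m v)"
    and "energy_form s \<Omega> (clamp_at m v) (clamp_at m v) \<le> energy_form s \<Omega> v v"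
    and "(\<integral>y. indicator \<Omega> y * (clamp_at m v y)\<^sup>2 \<partial>lborel) \<le> (\<integral>y. indicator \<Omega> y * (v y)\<^sup>2 \<partial>lborel)"
proof -
  note [measurable] = v[THEN finite_energy_measurable]
  have v2: "integrable lborel (\<lambda>y. indicator \<Omega> y * (v y)\<^sup>2)" "integrable (energy_measure s \<Omega>) (\<lambda>p. (increment v p)\<^sup>2)"
    using v by (simp_all add: finite_energy_def)
  have sq: "(clamp_at m v x)\<^sup>2 \<le> (v x)\<^sup>2" for x
    using clamp_at_abs_le[OF m, of v x] by (simp add: abs_le_square_iff)
  have c1: "integrable lborel (\<lambda>y. indicator \<Omega> y * (clamp_at m v y)\<^sup>2)"
    using sq by (intro abs_integral_le_dominating(1)[OF v2(1)]) (auto simp: abs_mult intro!: mult_left_mono)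
  have c2: "integrable (energy_measure s \<Omega>) (\<lambda>p. (increment (clamp_at m v) p)\<^sup>2)"
    using clamp_at_increment_sq_le(2)[OF m] by (intro abs_integral_le_dominating(1)[OF v2(2)]) auto
  show "finite_energy s \<Omega> (clamp_at m v)" using c1 c2 by (simp add: finite_energy_def)
  show "energy_form s \<Omega> (clamp_at m v) (clamp_at m v) \<le> energy_form s \<Omega> v v"
    unfolding energy_form_def power2_eq_square[symmetric]
    using c2 v2(2) clamp_at_increment_sq_le(2)[OF m] by (intro integral_mono) auto
  show "(\<integral>y. indicator \<Omega> y * (clamp_at m v y)\<^sup>2 \<partial>lborel) \<le> (\<integral>y. indicator \<Omega> y * (v y)\<^sup>2 \<partial>lborel)"
    using c1 v2(1) sq by (intro integral_mono) (auto intro: mult_left_mono)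
qed

text \<open>The normalization constant stays outside as a separate factor \<open>c\<close>. The
  value on \<open>\<Omega>\<close> is \<open>0\<close> to match data extended by
  \<open>0\<close>.\<close>

definition truncated_normal_deriv :: "(real ^ 'n \<Rightarrow> real) \<Rightarrow> real \<Rightarrow> real ^ 'n \<Rightarrow> real" where
  "truncated_normal_deriv \<psi> \<epsilon> x =
     indicator (- \<Omega>) x * (\<integral>y. indicator \<Omega> y * (truncated_kernel s \<epsilon> (x - y) * (\<psi> x - \<psi> y)) \<partial>lborel)"

text \<open>The Lipschitz bound for \<open>\<psi>\<close> lowers the singularity to the power
  \<open>1 - n - 2 * s\<close>, written as \<open>(1 - s) - (n + s)\<close>. All distances are at
  most \<open>2 * R + 1\<close>, so the first factor is bounded and the second integrates to order
  \<open>\<epsilon> powr - s\<close>. Sharper rates would depend on whether \<open>s\<close> lies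
  above or below \<open>1 / 2\<close>; this one covers all \<open>s\<close>, and
  \<open>\<epsilon> * \<epsilon> powr - s\<close> still tends to \<open>0\<close>.\<close>

lemma truncated_normal_deriv_layer_bound:
  assumes \<psi>: "C2_function \<psi>"
  shows "\<exists>C\<ge>0. \<forall>\<epsilon> x. 0 < \<epsilon> \<longrightarrow> \<epsilon> \<le> 1 \<longrightarrow> x \<in> outer_layer \<Omega> \<epsilon> \<longrightarrow> \<bar>truncated_normal_deriv \<psi> \<epsilon> x\<bar> \<le> C * \<epsilon> powr - s"
proof -
  have [measurable]: "\<psi> \<in> borel_measurable borel" by (rule C2_function_borel_measurable[OF \<psi>])
  obtain R where R: "0 < R" "\<Omega> \<subseteq> cball 0 R"
    using bounded by (meson bounded_subset_ballD ball_subset_cball order_trans)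
  obtain L where L: "0 \<le> L" "\<And>x y. x \<in> cball 0 (R + 1) \<Longrightarrow> y \<in> cball 0 (R + 1) \<Longrightarrow> \<bar>\<psi> x - \<psi> y\<bar> \<le> L * norm (x - y)"
    using C2_function_bounds(1)[OF \<psi>] by blast
  obtain C0 where C0: "0 \<le> C0" "\<And>\<epsilon>. 0 < \<epsilon> \<Longrightarrow> (\<integral>\<^sup>+h. indicator {h. \<epsilon> \<le> norm h} h * ennreal (norm h powr - (real CARD('n) + s))
      \<partial>(lborel :: (real ^ 'n) measure)) \<le> ennreal (C0 * \<epsilon> powr - s)"
    using nn_integral_kernel_far[OF s(1), where 'a = "real ^ 'n"] by auto
  define A where "A = L * (2 * R + 1) powr (1 - s)"
  have A: "0 \<le> A" using L by (simp add: A_def)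
  have "\<bar>truncated_normal_deriv \<psi> \<epsilon> x\<bar> \<le> A * C0 * \<epsilon> powr - s"
    if \<epsilon>: "0 < \<epsilon>" "\<epsilon> \<le> 1" and x: "x \<in> outer_layer \<Omega> \<epsilon>" for \<epsilon> x
  proof -
    define q where "q h = indicator {h. \<epsilon> \<le> norm h} h * norm h powr - (real CARD('n) + s)" for h :: "real ^ 'n"
    have [measurable]: "q \<in> borel_measurable borel" unfolding q_def[abs_def] by measurable
    have q0: "0 \<le> q h" for h by (simp add: q_def)
    have q_nn: "(\<integral>\<^sup>+h. ennreal (q h) \<partial>lborel) \<le> ennreal (C0 * \<epsilon> powr - s)"
      using C0(2)[OF \<epsilon>(1)] by (simp add: q_def ennreal_mult' ennreal_indicator)
    have q: "integrable lborel q"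
      using q_nn q0 by (intro integrableI_nonneg) (auto intro: le_less_trans)
    have q_int: "(\<integral>h. q h \<partial>lborel) \<le> C0 * \<epsilon> powr - s"
      using q_nn nn_integral_eq_integral[OF q] q0 C0(1) by (simp add: ennreal_le_iff)
    have xR: "norm x \<le> R + 1" "x \<notin> \<Omega>"
    proof -
      obtain y where y: "x \<notin> \<Omega>" "y \<in> \<Omega>" "dist x y < \<epsilon>" using x by (auto simp: outer_layer_def)
      then show "norm x \<le> R + 1" "x \<notin> \<Omega>"
        using R(2) \<epsilon> norm_triangle_sub[of x y] by (force simp: dist_norm)+
    qed
    have "\<bar>\<integral>y. indicator \<Omega> y * (truncated_kernel s \<epsilon> (x - y) * (\<psi> x - \<psi> y)) \<partial>lborel\<bar> \<le> (\<integral>y. A * q (x - y) \<partial>lborel)"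
    proof (rule abs_integral_le_dominating(2))
      show "integrable lborel (\<lambda>y. A * q (x - y))"
        using q integrable_lborel_reflect[of q x] by (intro integrable_mult_right) simp
      fix y
      show "\<bar>indicator \<Omega> y * (truncated_kernel s \<epsilon> (x - y) * (\<psi> x - \<psi> y))\<bar> \<le> A * q (x - y)"
      proof (cases "y \<in> \<Omega> \<and> \<epsilon> \<le> norm (x - y)")
        case True
        define h where "h = norm (x - y)"
        have yR: "norm y \<le> R" using True R by auto
        have h: "0 < h" "h \<le> 2 * R + 1" using True \<epsilon> xR yR norm_triangle_ineq4[of x y] by (auto simp: h_def)
        have "\<bar>\<psi> x - \<psi> y\<bar> \<le> L * h" unfolding h_def using xR yR by (intro L) auto
        then have "h powr - (real CARD('n) + 2 * s) * \<bar>\<psi> x - \<psi> y\<bar> \<le> h powr - (real CARD('n) + 2 * s) * (L * h)"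
          by (rule mult_left_mono) simp
        also have "\<dots> = L * (h powr (1 - s) * h powr - (real CARD('n) + s))"
          using h powr_add[of h 1 "- (real CARD('n) + 2 * s)"] powr_add[of h "1 - s" "- (real CARD('n) + s)"]
          by (simp add: algebra_simps)
        also have "\<dots> \<le> L * ((2 * R + 1) powr (1 - s) * h powr - (real CARD('n) + s))"
          using h s L(1) by (intro mult_left_mono mult_right_mono powr_mono2) auto
        finally show ?thesis using True by (simp add: truncated_kernel_def q_def A_def h_def abs_mult mult_ac)
      qed (use A q0 in \<open>auto simp: truncated_kernel_def indicator_def\<close>)
    qed measurable
    also have "\<dots> = A * (\<integral>h. q h \<partial>lborel)"
      using integral_lborel_reflect[of q x] by simp
    also have "\<dots> \<le> A * (C0 * \<epsilon> powr - s)" using q_int A by (rule mult_left_mono)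
    finally show ?thesis using xR by (simp add: truncated_normal_deriv_def mult.assoc)
  qed
  then show ?thesis using A C0(1) by (intro exI[of _ "A * C0"]) auto
qed

text \<open>Outside the layer every point of \<open>\<Omega>\<close> has distance at least
  \<open>\<epsilon>\<close> from \<open>x\<close>, so the cutoff changes nothing.\<close>

lemma truncated_normal_deriv_eq:
  assumes x: "x \<notin> \<Omega>" "x \<notin> outer_layer \<Omega> \<epsilon>"
  shows "truncated_normal_deriv \<psi> \<epsilon> x = (\<integral>y. indicator \<Omega> y * (riesz_kernel s x y * (\<psi> x - \<psi> y)) \<partial>lborel)"
proof -
  have "indicator \<Omega> y * (truncated_kernel s \<epsilon> (x - y) * (\<psi> x - \<psi> y)) = indicator \<Omega> y * (riesz_kernel s x y * (\<psi> x - \<psi> y))" for y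
    using x by (cases "y \<in> \<Omega>") (auto simp: truncated_kernel_def riesz_kernel_def outer_layer_def dist_norm not_less)
  then show ?thesis unfolding truncated_normal_deriv_def by (simp only: indicator_simps Compl_iff x(1) mult_1_left simp_thms)
qed

lemma outer_layer_tendsto:
  fixes \<epsilon> :: "nat \<Rightarrow> real"
  assumes "\<epsilon> \<longlonglongrightarrow> 0" and x: "x \<notin> frontier \<Omega>"
  shows "(\<lambda>j. indicator (outer_layer \<Omega> (\<epsilon> j)) x :: real) \<longlonglongrightarrow> 0"
proof -
  have "eventually (\<lambda>j. x \<notin> outer_layer \<Omega> (\<epsilon> j)) sequentially"
  proof (cases "x \<in> \<Omega>")
    case False
    then have "x \<notin> closure \<Omega>" using x open_domain by (simp add: frontier_def interior_open)
    then obtain e where e: "0 < e" "\<And>y. y \<in> \<Omega> \<Longrightarrow> \<not> dist y x < e" by (auto simp: closure_approachable)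
    have "eventually (\<lambda>j. \<epsilon> j < e) sequentially" using assms(1) e(1) by (rule order_tendstoD)
    then show ?thesis
    proof eventually_elim
      case (elim j)
      show ?case
      proof
        assume "x \<in> outer_layer \<Omega> (\<epsilon> j)"
        then obtain y where "y \<in> \<Omega>" "dist x y < \<epsilon> j" by (auto simp: outer_layer_def)
        then show False using e(2)[of y] elim by (simp add: dist_commute)
      qed
    qed
  qed (simp add: outer_layer_def)
  then show ?thesis by (intro tendsto_eventually) (auto elim: eventually_mono)
qed

text \<open>The two functionals differ by integrals over the layer only. With \<open>v\<close>
  bounded by \<open>m\<close>, the part from \<open>g\<close> vanishes by dominated convergence, as
  the layers shrink to a null set, and the other part is of order
  \<open>\<epsilon> powr (1 - s)\<close>.\<close>

lemma bounded_functional_limit: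
  assumes \<psi>: "C2_function \<psi>" and c: "0 \<le> c"
    and g: "integrable lborel g" "\<And>x. x \<in> \<Omega> \<Longrightarrow> g x = 0"
    and \<psi>_g: "AE x in lborel. x \<notin> closure \<Omega> \<longrightarrow> g x = c * (\<integral>y. indicator \<Omega> y * (riesz_kernel s x y * (\<psi> x - \<psi> y)) \<partial>lborel)"
    and v: "v \<in> borel_measurable borel" "\<And>x. \<bar>v x\<bar> \<le> m"
    and int: "\<And>\<epsilon>. 0 < \<epsilon> \<Longrightarrow> \<epsilon> \<le> 1 \<Longrightarrow> integrable lborel (\<lambda>x. v x * truncated_normal_deriv \<psi> \<epsilon> x)"
    and B: "\<And>\<epsilon>. 0 < \<epsilon> \<Longrightarrow> \<epsilon> \<le> 1 \<Longrightarrow> \<bar>c * (\<integral>x. v x * truncated_normal_deriv \<psi> \<epsilon> x \<partial>lborel)\<bar> \<le> B"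
  shows "\<bar>\<integral>x. g x * v x \<partial>lborel\<bar> \<le> B"
proof -
  note [measurable] = v(1) borel_measurable_integrable[OF g(1)]
  have layer [measurable]: "outer_layer \<Omega> \<epsilon> \<in> sets borel" for \<epsilon> by (rule outer_layer_borel[OF open_domain])
  have m: "0 \<le> m" using v(2)[of 0] by linarith
  obtain \<rho> C1 where C1: "0 < \<rho>" "0 \<le> C1" "\<And>\<epsilon>. 0 < \<epsilon> \<Longrightarrow> \<epsilon> \<le> \<rho> \<Longrightarrow> emeasure lborel (outer_layer \<Omega> \<epsilon>) \<le> ennreal (C1 * \<epsilon>)"
    using lipschitz_domain_layer[OF lipschitz bounded] by blast
  obtain C2 where C2: "0 \<le> C2" "\<And>\<epsilon> x. 0 < \<epsilon> \<Longrightarrow> \<epsilon> \<le> 1 \<Longrightarrow> x \<in> outer_layer \<Omega> \<epsilon> \<Longrightarrow> \<bar>truncated_normal_deriv \<psi> \<epsilon> x\<bar> \<le> C2 * \<epsilon> powr - s"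
    using truncated_normal_deriv_layer_bound[OF \<psi>] by blast
  \<comment> \<open>A sequence, as dominated convergence asks for; the minimum keeps it within the
    ranges of both layer estimates.\<close>
  define \<epsilon> where "\<epsilon> j = min 1 \<rho> / real (Suc j)" for j
  have \<epsilon>: "0 < \<epsilon> j" "\<epsilon> j \<le> 1" "\<epsilon> j \<le> \<rho>" for j
  proof -
    have "\<epsilon> j \<le> min 1 \<rho> / 1" unfolding \<epsilon>_def using C1(1) by (intro divide_left_mono) auto
    then show "0 < \<epsilon> j" "\<epsilon> j \<le> 1" "\<epsilon> j \<le> \<rho>" using C1(1) by (auto simp: \<epsilon>_def)
  qed
  have \<epsilon>_lim: "\<epsilon> \<longlonglongrightarrow> 0"
    unfolding \<epsilon>_def by (rule LIMSEQ_Suc[OF lim_const_over_n])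
  have gv: "integrable lborel (\<lambda>x. g x * v x)"
  proof (rule Bochner_Integration.integrable_bound[where f = "\<lambda>x. m * g x"])
    show "AE x in lborel. norm (g x * v x) \<le> norm (m * g x)"
      using mult_left_mono[OF v(2) abs_ge_zero] m by (simp add: abs_mult mult.commute[of m])
  qed (use g in auto)
  define a where "a j = (\<integral>x. g x * v x \<partial>lborel) - c * (\<integral>x. v x * truncated_normal_deriv \<psi> (\<epsilon> j) x \<partial>lborel)" for j
  define b where "b j = m * ((\<integral>x. indicator (outer_layer \<Omega> (\<epsilon> j)) x * \<bar>g x\<bar> \<partial>lborel) + c * C2 * C1 * \<epsilon> j powr (1 - s))" for j
  have ab: "\<bar>a j\<bar> \<le> b j" for j
  proof -
    let ?S = "outer_layer \<Omega> (\<epsilon> j)"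
    have fin: "emeasure lborel ?S < \<infinity>" using C1(3)[OF \<epsilon>(1,3)] by (rule le_less_trans) simp
    have iS: "integrable lborel (\<lambda>x. indicator ?S x :: real)" using fin by simp
    have ig: "integrable lborel (\<lambda>x. indicator ?S x * \<bar>g x\<bar>)"
      using g(1) by (intro Bochner_Integration.integrable_bound[OF g(1)]) (auto simp: abs_mult indicator_def)
    have "a j = (\<integral>x. g x * v x - c * (v x * truncated_normal_deriv \<psi> (\<epsilon> j) x) \<partial>lborel)"
      using gv int[OF \<epsilon>(1,2)] by (simp add: a_def)
    also have "\<bar>\<dots>\<bar> \<le> (\<integral>x. m * (indicator ?S x * \<bar>g x\<bar> + c * (C2 * \<epsilon> j powr - s) * indicator ?S x) \<partial>lborel)"
    proof (rule abs_integral_le_AE)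
      show "integrable lborel (\<lambda>x. m * (indicator ?S x * \<bar>g x\<bar> + c * (C2 * \<epsilon> j powr - s) * indicator ?S x))"
        using ig iS by (intro integrable_mult_right Bochner_Integration.integrable_add)
      show "integrable lborel (\<lambda>x. g x * v x - c * (v x * truncated_normal_deriv \<psi> (\<epsilon> j) x))"
        using gv int[OF \<epsilon>(1,2)] by (intro Bochner_Integration.integrable_diff integrable_mult_right)
      have "AE x in lborel. x \<notin> frontier \<Omega>"
        using null_frontier_lipschitz_domain[OF lipschitz bounded] by (rule AE_not_in)
      with \<psi>_g show "AE x in lborel. \<bar>g x * v x - c * (v x * truncated_normal_deriv \<psi> (\<epsilon> j) x)\<bar> \<le>
          m * (indicator ?S x * \<bar>g x\<bar> + c * (C2 * \<epsilon> j powr - s) * indicator ?S x)"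
      proof eventually_elim
        case (elim x)
        let ?N = "truncated_normal_deriv \<psi> (\<epsilon> j) x"
        have *: "g x * v x - c * (v x * ?N) = v x * (g x - c * ?N)" by (simp add: algebra_simps)
        show ?case
        proof (cases "x \<in> ?S")
          case True
          have "\<bar>g x - c * ?N\<bar> \<le> \<bar>g x\<bar> + c * \<bar>?N\<bar>"
            using abs_triangle_ineq4[of "g x" "c * ?N"] c by (simp add: abs_mult)
          also have "\<dots> \<le> \<bar>g x\<bar> + c * (C2 * \<epsilon> j powr - s)"
            using C2(2)[OF \<epsilon>(1,2) True] c by (intro add_left_mono mult_left_mono)
          finally show ?thesis unfolding * abs_mult using True v(2)[of x] m by (simp add: mult_mono)
        next
          case False
          \<comment> \<open>Off the layer the integrand vanishes: in \<open>\<Omega>\<close> both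
            terms are \<open>0\<close> by convention, and off the closure the cutoff is inactive and
            the equation for \<open>\<psi>\<close> applies.\<close>
          have "g x = c * ?N"
          proof (cases "x \<in> \<Omega>")
            case True
            then show ?thesis using g(2) by (simp add: truncated_normal_deriv_def)
          next
            case x: False
            then have "x \<notin> closure \<Omega>" using elim open_domain by (simp add: frontier_def interior_open)
            then show ?thesis using elim truncated_normal_deriv_eq[OF x False] by simp
          qed
          then show ?thesis unfolding * using False by simp
        qed
      qed
    qed
    also have "\<dots> = m * ((\<integral>x. indicator ?S x * \<bar>g x\<bar> \<partial>lborel) + c * (C2 * \<epsilon> j powr - s) * measure lborel ?S)"
      using ig iS fin by simp
    also have "\<dots> \<le> b j"
    proof -
      have "emeasure lborel ?S = ennreal (measure lborel ?S)"
        using fin by (intro emeasure_eq_ennreal_measure) (simp add: less_top)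
      then have "measure lborel ?S \<le> C1 * \<epsilon> j"
        using C1(3)[OF \<epsilon>(1,3), of j] C1(2) \<epsilon>(1)[of j] by (simp add: ennreal_le_iff)
      then have "c * (C2 * \<epsilon> j powr - s) * measure lborel ?S \<le> c * (C2 * \<epsilon> j powr - s) * (C1 * \<epsilon> j)"
        using c C2(1) by (intro mult_left_mono) auto
      also have "\<dots> = c * C2 * C1 * \<epsilon> j powr (1 - s)"
        using \<epsilon>(1)[of j] powr_add[of "\<epsilon> j" 1 "- s"] by (simp add: algebra_simps)
      finally show ?thesis unfolding b_def using m by (intro mult_left_mono add_left_mono)
    qed
    finally show ?thesis .
  qed
  have "b \<longlonglongrightarrow> m * (0 + c * C2 * C1 * 0)"
    unfolding b_def
  proof (intro tendsto_intros)
    show "(\<lambda>j. \<epsilon> j powr (1 - s)) \<longlonglongrightarrow> 0"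
      using \<epsilon>_lim s less_imp_le[OF \<epsilon>(1)] by (intro tendsto_zero_powrI[where b = "1 - s"]) auto
    have "(\<lambda>j. \<integral>x. indicator (outer_layer \<Omega> (\<epsilon> j)) x * \<bar>g x\<bar> \<partial>lborel) \<longlonglongrightarrow> (\<integral>x. 0 \<partial>(lborel :: (real ^ 'n) measure))"
    proof (rule integral_dominated_convergence[where w = "\<lambda>x. \<bar>g x\<bar>"])
      have "AE x in lborel. x \<notin> frontier \<Omega>"
        using null_frontier_lipschitz_domain[OF lipschitz bounded] by (rule AE_not_in)
      then show "AE x in lborel. (\<lambda>j. indicator (outer_layer \<Omega> (\<epsilon> j)) x * \<bar>g x\<bar>) \<longlonglongrightarrow> 0"
        by eventually_elim (intro tendsto_mult_left_zero outer_layer_tendsto \<epsilon>_lim)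
    qed (use g in \<open>auto simp: indicator_def\<close>)
    then show "(\<lambda>j. \<integral>x. indicator (outer_layer \<Omega> (\<epsilon> j)) x * \<bar>g x\<bar> \<partial>lborel) \<longlonglongrightarrow> 0" by simp
  qed
  then have "b \<longlonglongrightarrow> 0" by simp
  then have "(\<lambda>j. B + b j) \<longlonglongrightarrow> B + 0" by (intro tendsto_intros)
  moreover have "\<bar>\<integral>x. g x * v x \<partial>lborel\<bar> \<le> B + b j" for j
    using ab[of j] B[OF \<epsilon>(1,2), of j] unfolding a_def by linarith
  ultimately show ?thesis by (intro LIMSEQ_le_const) auto
qed

text \<open>For bounded \<open>v\<close>, Fubini identifies the pairing with the truncated
  derivative with the double integral already bounded uniformly in \<open>\<epsilon>\<close>. For
  general \<open>v\<close> the clamped functions obey the bound of \<open>v\<close> itself, and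
  their pairings with \<open>g\<close> converge.\<close>

lemma neumann_data_functional_bound:
  assumes \<psi>: "C2_function \<psi>" "finite_energy s \<Omega> \<psi>" and c: "0 \<le> c"
    and g: "integrable lborel g" "\<And>x. x \<in> \<Omega> \<Longrightarrow> g x = 0"
    and \<psi>_g: "AE x in lborel. x \<notin> closure \<Omega> \<longrightarrow> g x = c * (\<integral>y. indicator \<Omega> y * (riesz_kernel s x y * (\<psi> x - \<psi> y)) \<partial>lborel)"
  shows "\<exists>K\<ge>0. \<forall>v. finite_energy s \<Omega> v \<longrightarrow> integrable lborel (\<lambda>x. \<bar>g x\<bar> * (v x)\<^sup>2) \<longrightarrow>
     \<bar>\<integral>x. g x * v x \<partial>lborel\<bar> \<le> K * (1 + energy_form s \<Omega> v v + (\<integral>y. indicator \<Omega> y * (v y)\<^sup>2 \<partial>lborel))"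
proof -
  note [measurable] = \<psi>(2)[THEN finite_energy_measurable] borel_measurable_integrable[OF g(1)]
  define I where "I v \<epsilon> p = indicator (- \<Omega>) (fst p) * indicator \<Omega> (snd p) * v (fst p) *
        (truncated_kernel s \<epsilon> (fst p - snd p) * increment \<psi> p)" for v \<epsilon> p
  obtain K where K: "0 \<le> K" "\<And>v \<epsilon>. finite_energy s \<Omega> v \<Longrightarrow> 0 < \<epsilon> \<Longrightarrow> \<epsilon> \<le> 1 \<Longrightarrow> integrable lborel (I v \<epsilon>)"
    "\<And>v \<epsilon>. finite_energy s \<Omega> v \<Longrightarrow> 0 < \<epsilon> \<Longrightarrow> \<epsilon> \<le> 1 \<Longrightarrow>
       \<bar>\<integral>p. I v \<epsilon> p \<partial>lborel\<bar> \<le> K * (1 + energy_form s \<Omega> v v + (\<integral>y. indicator \<Omega> y * (v y)\<^sup>2 \<partial>lborel))"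
    using truncated_normal_deriv_bound[OF \<psi>] unfolding I_def[abs_def] by blast
  define bd where "bd v = (c * K) * (1 + energy_form s \<Omega> v v + (\<integral>y. indicator \<Omega> y * (v y)\<^sup>2 \<partial>lborel))" for v
  have bounded_case: "\<bar>\<integral>x. g x * v x \<partial>lborel\<bar> \<le> bd v"
    if v: "finite_energy s \<Omega> v" and m: "\<And>x. \<bar>v x\<bar> \<le> m" for v m
  proof (rule bounded_functional_limit[OF \<psi>(1) c g \<psi>_g finite_energy_measurable[OF v] m])
    fix \<epsilon> :: real assume \<epsilon>: "0 < \<epsilon>" "\<epsilon> \<le> 1"
    have eq: "v x * truncated_normal_deriv \<psi> \<epsilon> x = (\<integral>y. I v \<epsilon> (x, y) \<partial>lborel)" for x
    proof -
      have "(\<integral>y. I v \<epsilon> (x, y) \<partial>lborel) = (\<integral>y. (indicator (- \<Omega>) x * v x) * (indicator \<Omega> y * (truncated_kernel s \<epsilon> (x - y) * (\<psi> x - \<psi> y))) \<partial>lborel)"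
        by (simp add: I_def increment_def mult_ac)
      also have "\<dots> = v x * truncated_normal_deriv \<psi> \<epsilon> x"
        by (simp add: truncated_normal_deriv_def)
      finally show ?thesis by simp
    qed
    have int: "integrable (lborel \<Otimes>\<^sub>M lborel) (case_prod (\<lambda>x y. I v \<epsilon> (x, y)))"
      using K(2)[OF v \<epsilon>] by (simp add: lborel_prod)
    show "integrable lborel (\<lambda>x. v x * truncated_normal_deriv \<psi> \<epsilon> x)"
      unfolding eq by (rule lborel_pair.integrable_fst[OF int])
    have "(\<integral>x. v x * truncated_normal_deriv \<psi> \<epsilon> x \<partial>lborel) = (\<integral>p. I v \<epsilon> p \<partial>lborel)"
      unfolding eq using lborel_pair.integral_fst[OF int] by (simp add: lborel_prod)
    then show "\<bar>c * (\<integral>x. v x * truncated_normal_deriv \<psi> \<epsilon> x \<partial>lborel)\<bar> \<le> bd v"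
      using mult_left_mono[OF K(3)[OF v \<epsilon>] c] c by (simp add: abs_mult bd_def mult.assoc)
  qed
  have "\<bar>\<integral>x. g x * v x \<partial>lborel\<bar> \<le> bd v"
    if v: "finite_energy s \<Omega> v" and gv2: "integrable lborel (\<lambda>x. \<bar>g x\<bar> * (v x)\<^sup>2)" for v
  proof -
    note [measurable] = v[THEN finite_energy_measurable]
    \<comment> \<open>The product \<open>\<bar>g\<bar> * \<bar>v\<bar>\<close> dominates all clamped
      pairings. It is integrable because \<open>v\<close> and the constant \<open>1\<close> are both
      square integrable with weight \<open>\<bar>g\<bar>\<close>.\<close>
    have abs_gv: "integrable lborel (\<lambda>x. \<bar>g x\<bar> * \<bar>v x\<bar>)"
    proof -
      have "integrable lborel (\<lambda>x. \<bar>g x\<bar> * (\<bar>v x\<bar> * 1))"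
        using gv2 g(1) by (intro weighted_sq_integrable_mult) auto
      then show ?thesis by simp
    qed
    have lim: "(\<lambda>j. \<integral>x. g x * clamp_at (real j) v x \<partial>lborel) \<longlonglongrightarrow> (\<integral>x. g x * v x \<partial>lborel)"
    proof (rule integral_dominated_convergence[where w = "\<lambda>x. \<bar>g x\<bar> * \<bar>v x\<bar>"])
      show "AE x in lborel. (\<lambda>j. g x * clamp_at (real j) v x) \<longlonglongrightarrow> g x * v x"
      proof (rule AE_I2)
        fix x
        obtain j0 where "\<bar>v x\<bar> \<le> real j0" using real_arch_simple by blast
        then have "eventually (\<lambda>j. g x * clamp_at (real j) v x = g x * v x) sequentially"
          by (intro eventually_sequentiallyI[of j0]) (auto simp: clamp_at_eq)
        then show "(\<lambda>j. g x * clamp_at (real j) v x) \<longlonglongrightarrow> g x * v x" by (rule tendsto_eventually)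
      qed
      show "AE x in lborel. norm (g x * clamp_at (real j) v x) \<le> \<bar>g x\<bar> * \<bar>v x\<bar>" for j
        using clamp_at_abs_le[of "real j" v] by (auto simp: abs_mult intro!: mult_left_mono)
    qed (use abs_gv in auto)
    have "\<bar>\<integral>x. g x * clamp_at (real j) v x \<partial>lborel\<bar> \<le> bd v" for j
    proof -
      have j: "0 \<le> real j" by simp
      have "\<bar>\<integral>x. g x * clamp_at (real j) v x \<partial>lborel\<bar> \<le> bd (clamp_at (real j) v)"
        by (rule bounded_case[OF clamp_at_finite_energy(1)[OF v j] clamp_at_bounded[OF j]])
      also have "\<dots> \<le> bd v"
        unfolding bd_def using clamp_at_finite_energy(2,3)[OF v j] c K(1) by (intro mult_left_mono) auto
      finally show ?thesis .
    qed
    then show ?thesis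
      by (intro LIMSEQ_le_const2[OF tendsto_rabs[OF lim]]) auto
  qed
  moreover have "0 \<le> c * K" using c K(1) by simp
  ultimately show ?thesis unfolding bd_def by blast
qed

subsection \<open>Existence and uniqueness for Borel data\<close>

text \<open>Borel counterpart of \<open>Hs_space\<close> with data \<open>g\<close>, for
  \<open>g\<close> extended by \<open>0\<close> to \<open>\<Omega>\<close>; hence the weighted
  integral runs over the whole space.\<close>

definition test_space :: "(real ^ 'n \<Rightarrow> real) \<Rightarrow> (real ^ 'n \<Rightarrow> real) set" where
  "test_space g = {v. finite_energy s \<Omega> v \<and> integrable lborel (\<lambda>x. \<bar>g x\<bar> * (v x)\<^sup>2)}"

lemma test_space_add:
  assumes g: "integrable lborel g" and u: "u \<in> test_space g" and v: "v \<in> test_space g"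
  shows "(\<lambda>x. u x + t * v x) \<in> test_space g"
proof -
  have fe: "finite_energy s \<Omega> u" "finite_energy s \<Omega> v" using u v by (simp_all add: test_space_def)
  note [measurable] = fe[THEN finite_energy_measurable] borel_measurable_integrable[OF g]
  have "integrable lborel (\<lambda>x. \<bar>g x\<bar> * (u x + t * v x)\<^sup>2)"
    using u v by (intro weighted_sq_integrable_add) (auto simp: test_space_def)
  with finite_energy_add[OF fe] show ?thesis by (simp add: test_space_def)
qed

lemma test_space_const: "integrable lborel g \<Longrightarrow> (\<lambda>_. a) \<in> test_space g"
  by (simp add: test_space_def finite_energy_const)

text \<open>A bounded function is square integrable with the integrable weight
  \<open>\<bar>g\<bar>\<close>. So clamping turns a difference of solutions, which need not be a
  test function, into one.\<close>

lemma test_space_clamp_at: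
  assumes g: "integrable lborel g" and v: "finite_energy s \<Omega> v" and m: "0 \<le> m"
  shows "clamp_at m v \<in> test_space g"
proof -
  note [measurable] = v[THEN finite_energy_measurable] borel_measurable_integrable[OF g]
  have "integrable lborel (\<lambda>x. \<bar>g x\<bar> * (clamp_at m v x)\<^sup>2)"
  proof (rule abs_integral_le_dominating(1)[where h = "\<lambda>x. \<bar>g x\<bar> * m\<^sup>2"])
    fix x
    have "(clamp_at m v x)\<^sup>2 \<le> m\<^sup>2"
      using clamp_at_bounded[OF m, of v x] m by (simp add: abs_le_square_iff[symmetric])
    then show "\<bar>\<bar>g x\<bar> * (clamp_at m v x)\<^sup>2\<bar> \<le> \<bar>g x\<bar> * m\<^sup>2"
      by (simp add: abs_mult mult_left_mono)
  qed (use g in auto)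
  then show ?thesis using clamp_at_finite_energy(1)[OF v m] by (simp add: test_space_def)
qed

lemma test_space_mult_integrable:
  assumes g: "integrable lborel g" and v: "v \<in> test_space g"
  shows "integrable lborel (\<lambda>x. g x * v x)"
proof -
  have fe: "finite_energy s \<Omega> v" using v by (simp add: test_space_def)
  note [measurable] = fe[THEN finite_energy_measurable] borel_measurable_integrable[OF g]
  have "integrable lborel (\<lambda>x. \<bar>g x\<bar> * (v x * 1))"
    using v g by (intro weighted_sq_integrable_mult) (auto simp: test_space_def)
  then show ?thesis
    by (rule Bochner_Integration.integrable_bound) (auto simp: abs_mult)
qed

lemma energy_form_diff_const:
  "energy_form s \<Omega> (\<lambda>x. u x - a) (\<lambda>x. v x - b) = energy_form s \<Omega> u v"
  by (simp add: energy_form_def increment_def)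

lemma energy_form_const_left: "energy_form s \<Omega> (\<lambda>_. a) v = 0"
  by (simp add: energy_form_def increment_def)

text \<open>The Riesz argument runs in the test space, where \<open>F\<close> is defined, but its
  minimizing sequence converges only in energy. That is enough, since for a fixed test function the
  equation is continuous in the energy of \<open>u\<close>.\<close>

lemma neumann_existence:
  assumes c: "0 < c"
    and f: "f \<in> borel_measurable borel" "integrable lborel (\<lambda>x. indicator \<Omega> x * (f x)\<^sup>2)"
    and \<psi>: "C2_function \<psi>" "finite_energy s \<Omega> \<psi>"
    and g: "integrable lborel g" "\<And>x. x \<in> \<Omega> \<Longrightarrow> g x = 0"
    and \<psi>_g: "AE x in lborel. x \<notin> closure \<Omega> \<longrightarrow> g x = c * (\<integral>y. indicator \<Omega> y * (riesz_kernel s x y * (\<psi> x - \<psi> y)) \<partial>lborel)"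
    and compat: "(\<integral>x. indicator \<Omega> x * f x \<partial>lborel) + (\<integral>x. g x \<partial>lborel) = 0"
  obtains u where "finite_energy s \<Omega> u"
    and "\<And>v. v \<in> test_space g \<Longrightarrow> c / 2 * energy_form s \<Omega> u v = (\<integral>x. indicator \<Omega> x * (f x * v x) \<partial>lborel) + (\<integral>x. g x * v x \<partial>lborel)"
proof -
  note [measurable] = f(1) borel_measurable_integrable[OF g(1)]
  define V where "V = test_space g"
  define B where "B u v = c / 2 * energy_form s \<Omega> u v" for u v
  define F where "F v = (\<integral>x. indicator \<Omega> x * (f x * v x) \<partial>lborel) + (\<integral>x. g x * v x \<partial>lborel)" for v
  define L2 where "L2 v = (\<integral>y. indicator \<Omega> y * (v y)\<^sup>2 \<partial>lborel)" for v :: "real ^ 'n \<Rightarrow> real"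
  define E where "E v = energy_form s \<Omega> v v" for v
  have E0: "0 \<le> E v" for v unfolding E_def by (rule energy_form_nonneg)
  have V_fe: "finite_energy s \<Omega> v" if "v \<in> V" for v using that by (simp add: V_def test_space_def)
  have V_add: "(\<lambda>x. u x + t * v x) \<in> V" if "u \<in> V" "v \<in> V" for u v t
    using that unfolding V_def by (rule test_space_add[OF g(1)])
  have V_const: "(\<lambda>_. a) \<in> V" for a unfolding V_def by (rule test_space_const[OF g(1)])
  have V_v2: "integrable lborel (\<lambda>x. indicator \<Omega> x * (v x)\<^sup>2)" if "v \<in> V" for v
    using V_fe[OF that] by (simp add: finite_energy_def)
  have fv: "integrable lborel (\<lambda>x. indicator \<Omega> x * (f x * v x))" if v: "v \<in> V" for v
    using finite_energy_measurable[OF V_fe[OF v]] V_v2[OF v] f(2) by (intro weighted_sq_integrable_mult) auto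
  have gv: "integrable lborel (\<lambda>x. g x * v x)" if v: "v \<in> V" for v
    using test_space_mult_integrable[OF g(1)] v by (simp add: V_def)
  have F_add: "F (\<lambda>x. u x + t * v x) = F u + t * F v" if u: "u \<in> V" and v: "v \<in> V" for u v t
  proof -
    have "(\<integral>x. indicator \<Omega> x * (f x * (u x + t * v x)) \<partial>lborel) = (\<integral>x. indicator \<Omega> x * (f x * u x) + t * (indicator \<Omega> x * (f x * v x)) \<partial>lborel)"
      by (simp add: algebra_simps)
    also have "\<dots> = (\<integral>x. indicator \<Omega> x * (f x * u x) \<partial>lborel) + t * (\<integral>x. indicator \<Omega> x * (f x * v x) \<partial>lborel)"
      using fv[OF u] fv[OF v] by simp
    finally have 1: "(\<integral>x. indicator \<Omega> x * (f x * (u x + t * v x)) \<partial>lborel) = \<dots>" .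
    have "(\<integral>x. g x * (u x + t * v x) \<partial>lborel) = (\<integral>x. g x * u x + t * (g x * v x) \<partial>lborel)"
      by (simp add: algebra_simps)
    also have "\<dots> = (\<integral>x. g x * u x \<partial>lborel) + t * (\<integral>x. g x * v x \<partial>lborel)"
      using gv[OF u] gv[OF v] by simp
    finally show ?thesis unfolding F_def 1 by (simp add: algebra_simps)
  qed
  have F_const: "F (\<lambda>_. a) = 0" for a
  proof -
    have "F (\<lambda>_. a) = a * ((\<integral>x. indicator \<Omega> x * f x \<partial>lborel) + (\<integral>x. g x \<partial>lborel))"
    proof -
      have "(\<integral>x. indicator \<Omega> x * (f x * a) \<partial>lborel) = (\<integral>x. a * (indicator \<Omega> x * f x) \<partial>lborel)"
        by (simp only: mult_ac)
      then show ?thesis by (simp add: F_def distrib_left)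
    qed
    then show ?thesis using compat by simp
  qed
  obtain Kg where Kg: "0 \<le> Kg" "\<And>v. v \<in> V \<Longrightarrow> \<bar>\<integral>x. g x * v x \<partial>lborel\<bar> \<le> Kg * (1 + E v + L2 v)"
    using neumann_data_functional_bound[OF \<psi> less_imp_le[OF c] g \<psi>_g]
    unfolding V_def test_space_def E_def L2_def by blast
  define Kf where "Kf = (\<integral>x. indicator \<Omega> x * (f x)\<^sup>2 \<partial>lborel)"
  have Kf: "0 \<le> Kf" by (simp add: Kf_def)
  define K where "K = Kf + 1 + Kg"
  have K: "0 \<le> K" using Kf Kg(1) by (simp add: K_def)
  have F_le: "\<bar>F v\<bar> \<le> K * (1 + E v + L2 v)" if v: "v \<in> V" for v
  proof -
    have [measurable]: "v \<in> borel_measurable borel" by (rule finite_energy_measurable[OF V_fe[OF v]])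
    have "\<bar>\<integral>x. indicator \<Omega> x * (f x * v x) \<partial>lborel\<bar> \<le> (\<integral>x. indicator \<Omega> x * (f x)\<^sup>2 + indicator \<Omega> x * (v x)\<^sup>2 \<partial>lborel)"
    proof (rule abs_integral_le_dominating(2))
      show "integrable lborel (\<lambda>x. indicator \<Omega> x * (f x)\<^sup>2 + indicator \<Omega> x * (v x)\<^sup>2)"
        using f(2) V_v2[OF v] by simp
      fix x
      have "\<bar>f x * v x\<bar> \<le> (f x)\<^sup>2 + (v x)\<^sup>2"
        using sum_squares_bound[of "\<bar>f x\<bar>" "\<bar>v x\<bar>"] mult_nonneg_nonneg[of "\<bar>f x\<bar>" "\<bar>v x\<bar>"]
        unfolding abs_mult power2_abs by linarith
      then show "\<bar>indicator \<Omega> x * (f x * v x)\<bar> \<le> indicator \<Omega> x * (f x)\<^sup>2 + indicator \<Omega> x * (v x)\<^sup>2"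
        by (simp add: indicator_def)
    qed measurable
    also have "\<dots> = Kf + L2 v" using f(2) V_v2[OF v] by (simp add: Kf_def L2_def)
    finally have "\<bar>F v\<bar> \<le> (Kf + L2 v) + Kg * (1 + E v + L2 v)"
      using Kg(2)[OF v] unfolding F_def by linarith
    also have "\<dots> \<le> K * (1 + E v + L2 v)"
    proof -
      have L: "0 \<le> L2 v" by (simp add: L2_def)
      have "0 \<le> Kf * E v" "0 \<le> Kf * L2 v" using Kf E0[of v] L by simp_all
      then show ?thesis using E0[of v] L by (simp add: K_def algebra_simps)
    qed
    finally show ?thesis .
  qed
  obtain Cp where Cp: "0 \<le> Cp" "\<And>u. finite_energy s \<Omega> u \<Longrightarrow> (\<integral>y. indicator \<Omega> y * u y \<partial>lborel) = 0 \<Longrightarrow> L2 u \<le> Cp * E u"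
    unfolding L2_def E_def using poincare by blast
  define mean where "mean v = (\<integral>y. indicator \<Omega> y * v y \<partial>lborel) / measure lborel \<Omega>" for v :: "real ^ 'n \<Rightarrow> real"
  have mean_zero: "(\<integral>y. indicator \<Omega> y * (v y - mean v) \<partial>lborel) = 0" if v: "finite_energy s \<Omega> v" for v
  proof -
    have "(\<integral>y. indicator \<Omega> y * (v y - mean v) \<partial>lborel) = (\<integral>y. indicator \<Omega> y * v y - mean v * indicator \<Omega> y \<partial>lborel)"
      by (simp add: algebra_simps)
    also have "\<dots> = (\<integral>y. indicator \<Omega> y * v y \<partial>lborel) - mean v * measure lborel \<Omega>"
      using integrable_domain_mult[OF v] integrable_domain by simp
    finally show ?thesis using measure_domain_pos by (simp add: mean_def)
  qed
  \<comment> \<open>Compatibility makes \<open>F\<close> blind to constants, as the energy is.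
    Subtracting the mean therefore changes only the norm over \<open>\<Omega>\<close>, which the
    Poincare inequality then absorbs.\<close>
  have F_le2: "\<bar>F v\<bar> \<le> K * (1 + (1 + Cp) * E v)" if v: "v \<in> V" for v
  proof -
    have eq: "(\<lambda>x. v x - mean v) = (\<lambda>x. v x + (- mean v) * 1)" by simp
    have v0: "(\<lambda>x. v x - mean v) \<in> V" unfolding eq by (rule V_add[OF v V_const])
    have "F (\<lambda>x. v x - mean v) = F v" unfolding eq using F_add[OF v V_const[of 1], of "- mean v"] F_const by simp
    moreover have "E (\<lambda>x. v x - mean v) = E v" unfolding E_def by (rule energy_form_diff_const)
    ultimately have "\<bar>F v\<bar> \<le> K * (1 + E v + L2 (\<lambda>x. v x - mean v))" using F_le[OF v0] by simp
    also have "\<dots> \<le> K * (1 + (1 + Cp) * E v)"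
    proof (rule mult_left_mono[OF _ K])
      have "L2 (\<lambda>x. v x - mean v) \<le> Cp * E v"
        using Cp(2)[OF V_fe[OF v0] mean_zero[OF V_fe[OF v]]] by (simp add: E_def energy_form_diff_const)
      then show "1 + E v + L2 (\<lambda>x. v x - mean v) \<le> 1 + (1 + Cp) * E v" by (simp add: algebra_simps)
    qed
    finally show ?thesis .
  qed
  have B_add: "B (\<lambda>x. u x + t * v x) w = B u w + t * B v w" if "u \<in> V" "v \<in> V" "w \<in> V" for u v w t
    using energy_form_add[OF V_fe V_fe V_fe] that by (simp add: B_def algebra_simps)
  have F_sq: "(F v)\<^sup>2 \<le> 8 * K\<^sup>2 * (1 + Cp) / c * B v v" if v: "v \<in> V" for v
  proof -
    \<comment> \<open>The bound for \<open>t * v\<close> reads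
      \<open>t * F v \<le> K + t\<^sup>2 * (K * (1 + Cp) * E v)\<close> for all real
      \<open>t\<close>, and its discriminant gives an estimate without the additive
      constant.\<close>
    have "(- F v / 2)\<^sup>2 \<le> K * (K * (1 + Cp) * E v)"
    proof (rule quadratic_nonneg_discriminant)
      fix t
      have tv: "(\<lambda>x. 0 + t * v x) \<in> V" by (rule V_add[OF V_const v])
      have "F (\<lambda>x. 0 + t * v x) = t * F v" using F_add[OF V_const v, of 0 t] F_const[of 0] by simp
      moreover have "E (\<lambda>x. 0 + t * v x) = t\<^sup>2 * E v"
      proof -
        have "increment (\<lambda>x. 0 + t * v x) p * increment (\<lambda>x. 0 + t * v x) p = t\<^sup>2 * (increment v p * increment v p)" for p
          by (simp add: increment_def power2_eq_square algebra_simps)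
        then show ?thesis unfolding E_def energy_form_def by simp
      qed
      ultimately have "t * F v \<le> K * (1 + (1 + Cp) * (t\<^sup>2 * E v))" using F_le2[OF tv] by simp
      then show "0 \<le> K + 2 * t * (- F v / 2) + t\<^sup>2 * (K * (1 + Cp) * E v)" by (simp add: algebra_simps)
    qed (use K Cp(1) E0[of v] in simp)
    then have "(F v)\<^sup>2 \<le> 4 * (K * (K * (1 + Cp) * E v))" by (simp add: power_divide)
    also have "\<dots> = 8 * K\<^sup>2 * (1 + Cp) / c * B v v"
      using c by (simp add: B_def E_def power2_eq_square)
    finally show ?thesis .
  qed
  obtain w where w: "\<And>k. w k \<in> V"
    and w_F: "\<And>k v. v \<in> V \<Longrightarrow> \<bar>B (w k) v - F v\<bar> \<le> (1 / 2) ^ k * sqrt (B v v)"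
    and w_Cauchy: "\<And>k l. B (\<lambda>x. w k x - w l x) (\<lambda>x. w k x - w l x) \<le> ((1 / 2) ^ k + (1 / 2) ^ l)\<^sup>2"
  proof (rule riesz_minimizing_sequence[where V = V and B = B and F = F and C = "8 * K\<^sup>2 * (1 + Cp) / c"])
    show "V \<noteq> {}" using V_const by blast
    show "B u v = B v u" for u v unfolding B_def using energy_form_commute[of u v] by simp
    show "0 \<le> B u u" for u using c energy_form_nonneg[of u] by (simp add: B_def)
    show "0 \<le> 8 * K\<^sup>2 * (1 + Cp) / c" using c Cp(1) by simp
  qed (use V_add B_add F_add F_sq in auto)
  \<comment> \<open>The Riesz sequence is determined only up to constants, while completeness relies
    on the Poincare inequality. Normalizing the means leaves all increments unchanged.\<close>
  define w0 where "w0 k x = w k x - mean (w k)" for k x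
  have w0: "finite_energy s \<Omega> (w0 k)" for k
    using V_fe[OF V_add[OF w V_const[of 1]], of k "- mean (w k)"] by (simp add: w0_def[abs_def])
  have w0_mean: "(\<integral>y. indicator \<Omega> y * w0 k y \<partial>lborel) = 0" for k
    unfolding w0_def by (rule mean_zero[OF V_fe[OF w]])
  have w0_Cauchy: "energy_form s \<Omega> (\<lambda>x. w0 k x - w0 l x) (\<lambda>x. w0 k x - w0 l x) \<le> 2 / c * ((1 / 2) ^ k + (1 / 2) ^ l)\<^sup>2" for k l
  proof -
    have "increment (\<lambda>x. w0 k x - w0 l x) p = increment (\<lambda>x. w k x - w l x) p" for p
      by (simp add: increment_def w0_def)
    then have "energy_form s \<Omega> (\<lambda>x. w0 k x - w0 l x) (\<lambda>x. w0 k x - w0 l x) = 2 / c * B (\<lambda>x. w k x - w l x) (\<lambda>x. w k x - w l x)"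
      using c by (simp add: B_def energy_form_def)
    then show ?thesis using mult_left_mono[OF w_Cauchy[of k l], of "2 / c"] c by simp
  qed
  obtain u where u: "finite_energy s \<Omega> u"
    and wu: "\<And>k. energy_form s \<Omega> (\<lambda>x. w0 k x - u x) (\<lambda>x. w0 k x - u x) \<le> 4 * (2 / c) * (1 / 4) ^ k"
    using energy_complete[OF w0 w0_mean w0_Cauchy] by blast
  have solves: "B u v = F v" if v: "v \<in> V" for v
  proof -
    have v': "finite_energy s \<Omega> v" by (rule V_fe[OF v])
    \<comment> \<open>The first summand bounds the passage from \<open>w k\<close> to
      \<open>u\<close> by Cauchy-Schwarz, the second the error of \<open>w k\<close> in the
      equation. Both carry the factor \<open>(1 / 2) ^ k\<close>.\<close>
    define D where "D = c / 2 * sqrt (8 / c * E v) + sqrt (B v v)"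
    have "\<bar>B u v - F v\<bar> \<le> D * (1 / 2) ^ k" for k
    proof -
      have d: "finite_energy s \<Omega> (\<lambda>x. w0 k x - u x)"
        using finite_energy_add[OF w0 u, of k "- 1"] by simp
      have "energy_form s \<Omega> (\<lambda>x. w0 k x - u x) v = energy_form s \<Omega> (w0 k) v - energy_form s \<Omega> u v"
        using energy_form_add[OF w0 u v', of k "- 1"] by simp
      moreover have "energy_form s \<Omega> (w0 k) v = energy_form s \<Omega> (w k) v"
        by (simp add: energy_form_def increment_def w0_def)
      ultimately have "energy_form s \<Omega> (\<lambda>x. w0 k x - u x) v = energy_form s \<Omega> (w k) v - energy_form s \<Omega> u v"
        by simp
      then have diff: "B (w k) v - B u v = c / 2 * energy_form s \<Omega> (\<lambda>x. w0 k x - u x) v"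
        by (simp only: B_def right_diff_distrib)
      have "(energy_form s \<Omega> (\<lambda>x. w0 k x - u x) v)\<^sup>2 \<le> energy_form s \<Omega> (\<lambda>x. w0 k x - u x) (\<lambda>x. w0 k x - u x) * E v"
        unfolding E_def by (rule energy_form_Cauchy_Schwarz[OF d v'])
      also have "\<dots> \<le> 4 * (2 / c) * (1 / 4) ^ k * E v" by (intro mult_right_mono wu E0)
      finally have "sqrt ((energy_form s \<Omega> (\<lambda>x. w0 k x - u x) v)\<^sup>2) \<le> sqrt (4 * (2 / c) * (1 / 4) ^ k * E v)"
        by (rule real_sqrt_le_mono)
      also have "\<dots> = sqrt (8 / c * E v) * sqrt ((1 / 4) ^ k)" by (simp flip: real_sqrt_mult)
      also have "sqrt ((1 / 4 :: real) ^ k) = (1 / 2) ^ k" by (simp add: real_sqrt_power real_sqrt_divide)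
      finally have "\<bar>energy_form s \<Omega> (\<lambda>x. w0 k x - u x) v\<bar> \<le> sqrt (8 / c * E v) * (1 / 2) ^ k"
        unfolding real_sqrt_abs .
      then have "\<bar>B (w k) v - B u v\<bar> \<le> c / 2 * (sqrt (8 / c * E v) * (1 / 2) ^ k)"
        unfolding diff abs_mult using c by (intro mult_mono) auto
      then show ?thesis using w_F[OF v, of k] unfolding D_def by (simp only: algebra_simps)
    qed
    moreover have "(\<lambda>k. D * (1 / 2) ^ k) \<longlonglongrightarrow> D * 0"
      by (intro tendsto_mult tendsto_const LIMSEQ_power_zero) simp
    ultimately have "\<bar>B u v - F v\<bar> \<le> D * 0" by (intro LIMSEQ_le_const) auto
    then show ?thesis by simp
  qed
  show thesis
    by (rule that[OF u]) (use solves in \<open>simp add: B_def F_def V_def\<close>)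
qed

text \<open>Tested with the clamped \<open>z\<close>, the integrand is nonnegative and dominates the
  square of the clamped increment, so \<open>z\<close> has zero increment almost everywhere on the
  cross region. A single good point of \<open>\<Omega>\<close> is paired there with every point of
  the space, which makes \<open>z\<close> constant at once.\<close>

lemma neumann_uniqueness:
  assumes g: "integrable lborel g" and z: "finite_energy s \<Omega> z"
    and zero: "\<And>v. v \<in> test_space g \<Longrightarrow> energy_form s \<Omega> z v = 0"
  shows "\<exists>a. AE x in lborel. z x = a"
proof -
  note [measurable] = z[THEN finite_energy_measurable]
  have "AE p in energy_measure s \<Omega>. increment (clamp_at (real m) z) p = 0" for m
  proof -
    have m: "0 \<le> real m" by simp
    have cl: "finite_energy s \<Omega> (clamp_at (real m) z)" by (rule clamp_at_finite_energy(1)[OF z m])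
    have nonneg: "0 \<le> increment z p * increment (clamp_at (real m) z) p" for p
      using clamp_at_increment_sq_le(1)[OF m, of z p] zero_le_power2 order_trans by blast
    have "(\<integral>p. increment z p * increment (clamp_at (real m) z) p \<partial>energy_measure s \<Omega>) = 0"
      using zero[OF test_space_clamp_at[OF g z m]] by (simp add: energy_form_def)
    then have "AE p in energy_measure s \<Omega>. increment z p * increment (clamp_at (real m) z) p = 0"
      using integral_nonneg_eq_0_iff_AE[OF energy_integrable[OF z cl]] nonneg by simp
    then show ?thesis
    proof eventually_elim
      case (elim p)
      then have "(increment (clamp_at (real m) z) p)\<^sup>2 \<le> 0"
        using clamp_at_increment_sq_le(1)[OF m, of z p] by (simp only:)
      then show ?case by simp
    qed
  qed
  \<comment> \<open>Natural levels form a countable family, so one null set serves them all; at each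
    pair a large level leaves both values unclamped.\<close>
  then have "AE p in energy_measure s \<Omega>. \<forall>m. increment (clamp_at (real m) z) p = 0"
    by (simp add: AE_all_countable)
  then have "AE p in energy_measure s \<Omega>. increment z p = 0"
  proof eventually_elim
    case (elim p)
    obtain m where m: "max \<bar>z (fst p)\<bar> \<bar>z (snd p)\<bar> \<le> real m" using real_arch_simple by blast
    then have "increment (clamp_at (real m) z) p = increment z p"
      by (simp add: increment_def clamp_at_eq)
    then show ?case using elim by simp
  qed
  then have "AE p in lborel. 0 < ennreal (indicator (cross_region \<Omega>) p * riesz_kernel s (fst p) (snd p)) \<longrightarrow> increment z p = 0"
    unfolding energy_measure_def by (subst (asm) AE_density) auto
  then have "AE p in lborel. p \<in> cross_region \<Omega> \<longrightarrow> z (fst p) = z (snd p)"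
  proof eventually_elim
    case (elim p)
    \<comment> \<open>The density is positive off the diagonal; on the diagonal the two values
      coincide trivially.\<close>
    then show ?case by (cases "fst p = snd p") (auto simp: riesz_kernel_def increment_def)
  qed
  then have "AE p in (lborel \<Otimes>\<^sub>M lborel). p \<in> cross_region \<Omega> \<longrightarrow> z (fst p) = z (snd p)"
    unfolding lborel_prod .
  then have ae: "AE x in lborel. AE y in lborel. (x, y) \<in> cross_region \<Omega> \<longrightarrow> z x = z y"
    using lborel_pair.AE_pair by fastforce
  \<comment> \<open>\<open>\<Omega>\<close> has positive measure, so it cannot consist of
    exceptional points only.\<close>
  have "\<exists>x\<in>\<Omega>. AE y in lborel. (x, y) \<in> cross_region \<Omega> \<longrightarrow> z x = z y"
  proof (rule ccontr)
    assume none: "\<not> ?thesis"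
    from ae have "AE x in lborel. x \<notin> \<Omega>" by eventually_elim (use none in blast)
    then have "\<Omega> \<in> null_sets lborel" using AE_iff_null_sets[of \<Omega> lborel] by simp
    then have "measure lborel \<Omega> = 0" by (simp add: measure_eq_0_null_sets)
    then show False using measure_domain_pos by simp
  qed
  then obtain x where "x \<in> \<Omega>" "AE y in lborel. (x, y) \<in> cross_region \<Omega> \<longrightarrow> z x = z y" by blast
  then have "AE y in lborel. z y = z x"
    by (auto simp: cross_region_alt elim: eventually_mono)
  then show ?thesis by blast
qed

end

subsection \<open>Transfer to Lebesgue measurable functions\<close>

lemma nn_integral_lebesgue_on_eq_lborel:
  fixes h h0 :: "'a::euclidean_space \<Rightarrow> ennreal"
  assumes S: "S \<in> sets borel" and eq: "AE x in lebesgue. x \<in> S \<longrightarrow> h x = h0 x"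
  shows "(\<integral>\<^sup>+x. h x \<partial>lebesgue_on S) = (\<integral>\<^sup>+x. h0 x * indicator S x \<partial>lborel)"
proof -
  have "(\<integral>\<^sup>+x. h x \<partial>lebesgue_on S) = (\<integral>\<^sup>+x. h x * indicator S x \<partial>lebesgue)"
    using S by (intro nn_integral_restrict_space) (auto simp: sets_completionI_sets)
  also have "\<dots> = (\<integral>\<^sup>+x. h0 x * indicator S x \<partial>lebesgue)"
    using eq by (intro nn_integral_cong_AE) (auto elim!: eventually_mono simp: indicator_def)
  finally show ?thesis by (simp add: nn_integral_completion)
qed

text \<open>Lebesgue measure is complete, so agreement almost everywhere on \<open>S\<close> with a
  Borel function supplies the measurability of \<open>h\<close> on \<open>S\<close>.\<close>

lemma integral_lebesgue_on_eq_lborel: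
  fixes h h0 :: "'a::euclidean_space \<Rightarrow> real"
  assumes S: "S \<in> sets borel" and h0: "h0 \<in> borel_measurable borel"
    and eq: "AE x in lebesgue. x \<in> S \<longrightarrow> h x = h0 x"
  shows "(\<integral>x. h x \<partial>lebesgue_on S) = (\<integral>x. indicator S x * h0 x \<partial>lborel)"
    and "integrable (lebesgue_on S) h \<longleftrightarrow> integrable lborel (\<lambda>x. indicator S x * h0 x)"
proof -
  have S': "S \<inter> space lebesgue \<in> sets lebesgue" using S by (auto simp: sets_completionI_sets)
  have m0: "(\<lambda>x. indicator S x * h0 x) \<in> borel_measurable lborel" using S h0 by simp
  then have m1: "(\<lambda>x. indicator S x * h0 x) \<in> borel_measurable lebesgue" by (rule measurable_completion)
  have ae: "AE x in lebesgue. indicator S x * h0 x = indicator S x *\<^sub>R h x"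
    using eq by (auto elim!: eventually_mono simp: indicator_def)
  have m2: "(\<lambda>x. indicator S x *\<^sub>R h x) \<in> borel_measurable lebesgue"
    using m1 ae by (rule borel_measurable_AE)
  have "(\<integral>x. h x \<partial>lebesgue_on S) = (\<integral>x. indicator S x *\<^sub>R h x \<partial>lebesgue)"
    by (rule integral_restrict_space[OF S'])
  also have "\<dots> = (\<integral>x. indicator S x * h0 x \<partial>lebesgue)"
    using ae by (intro integral_cong_AE m1 m2) (auto elim: eventually_mono)
  also have "\<dots> = (\<integral>x. indicator S x * h0 x \<partial>lborel)" by (rule integral_completion[OF m0])
  finally show "(\<integral>x. h x \<partial>lebesgue_on S) = (\<integral>x. indicator S x * h0 x \<partial>lborel)" .
  have "integrable (lebesgue_on S) h \<longleftrightarrow> integrable lebesgue (\<lambda>x. indicator S x *\<^sub>R h x)"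
    by (rule integrable_restrict_space[OF S'])
  also have "\<dots> \<longleftrightarrow> integrable lebesgue (\<lambda>x. indicator S x * h0 x)"
    using ae by (intro integrable_cong_AE m1 m2) (auto elim: eventually_mono)
  also have "\<dots> \<longleftrightarrow> integrable lborel (\<lambda>x. indicator S x * h0 x)" by (rule integrable_completion[OF m0])
  finally show "integrable (lebesgue_on S) h \<longleftrightarrow> integrable lborel (\<lambda>x. indicator S x * h0 x)" .
qed

lemma lebesgue_borel_representative:
  fixes u :: "'a::euclidean_space \<Rightarrow> real"
  assumes "u \<in> borel_measurable lebesgue"
  obtains u0 where "u0 \<in> borel_measurable borel" "AE x in lebesgue. u x = u0 x"
  using completion_ex_borel_measurable_real[OF assms] AE_completion by (metis measurable_lborel2)

text \<open>The representative is set to \<open>0\<close> outside \<open>S\<close>, so that data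
  given on a part of the space become functions on all of it without changing integrals.\<close>

lemma lebesgue_on_borel_representative:
  fixes u :: "'a::euclidean_space \<Rightarrow> real"
  assumes S: "S \<in> sets borel" and u: "u \<in> borel_measurable (lebesgue_on S)"
  obtains u0 where "u0 \<in> borel_measurable borel" "AE x in lebesgue. x \<in> S \<longrightarrow> u x = u0 x" "\<And>x. x \<notin> S \<Longrightarrow> u0 x = 0"
proof -
  have "(\<lambda>x. indicator S x *\<^sub>R u x) \<in> borel_measurable lebesgue"
    using u S by (subst (asm) borel_measurable_restrict_space_iff) (auto simp: sets_completionI_sets)
  then obtain u0 where u0: "u0 \<in> borel_measurable borel" "AE x in lebesgue. indicator S x *\<^sub>R u x = u0 x"
    using lebesgue_borel_representative by blast
  show thesis
  proof (rule that[of "\<lambda>x. indicator S x * u0 x"])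
    show "(\<lambda>x. indicator S x * u0 x) \<in> borel_measurable borel" using u0(1) S by simp
    show "AE x in lebesgue. x \<in> S \<longrightarrow> u x = indicator S x * u0 x"
      using u0(2) by (rule eventually_mono) auto
  qed auto
qed

lemma divide_frac_den: "a / frac_den s x y = riesz_kernel s x y * a"
  by (simp only: frac_den_def riesz_kernel_def powr_minus divide_inverse mult.commute)

lemma AE_lebesgue_increment:
  fixes u u0 :: "real ^ 'n \<Rightarrow> real"
  assumes "AE x in lebesgue. u x = u0 x"
  shows "AE p in lebesgue. increment u p = increment u0 p"
proof -
  have "AE x in lborel. u x = u0 x" using assms by (simp add: AE_completion_iff)
  from AE_lborel_prodI[OF this this] have "AE p in lborel. increment u p = increment u0 p"
    by (auto simp: increment_def elim: eventually_mono)
  then show ?thesis by (rule AE_completion)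
qed

context nonlocal_domain
begin

lemma cross_integral_eq_energy_form:
  assumes u: "AE x in lebesgue. u x = u0 x" "u0 \<in> borel_measurable borel"
    and v: "AE x in lebesgue. v x = v0 x" "v0 \<in> borel_measurable borel"
  shows "(LINT (x, y) | lebesgue_on (cross_region \<Omega>). (u x - u y) * (v x - v y) / frac_den s x y) = energy_form s \<Omega> u0 v0"
proof -
  note [measurable] = u(2) v(2)
  have F: "(\<lambda>p. increment u0 p * increment v0 p) \<in> borel_measurable borel" by measurable
  let ?h0 = "\<lambda>p. riesz_kernel s (fst p) (snd p) * (increment u0 p * increment v0 p)"
  have "(LINT (x, y) | lebesgue_on (cross_region \<Omega>). (u x - u y) * (v x - v y) / frac_den s x y)
      = (\<integral>p. indicator (cross_region \<Omega>) p * ?h0 p \<partial>lborel)"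
  proof (rule integral_lebesgue_on_eq_lborel(1))
    show "AE p in lebesgue. p \<in> cross_region \<Omega> \<longrightarrow> (case p of (x, y) \<Rightarrow> (u x - u y) * (v x - v y) / frac_den s x y) = ?h0 p"
      using AE_lebesgue_increment[OF u(1)] AE_lebesgue_increment[OF v(1)]
    proof eventually_elim
      case (elim p)
      have "(case p of (x, y) \<Rightarrow> (u x - u y) * (v x - v y) / frac_den s x y)
          = riesz_kernel s (fst p) (snd p) * (increment u p * increment v p)"
        by (simp add: case_prod_unfold increment_def divide_frac_den)
      then show ?case using elim by simp
    qed
  qed measurable
  also have "\<dots> = energy_form s \<Omega> u0 v0"
    unfolding energy_form_def integral_energy_measure(1)[OF F] by (simp add: mult.assoc)
  finally show ?thesis .
qed

text \<open>All three terms of the norm depend only on values almost everywhere, the double integral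
  because increments of equivalent functions agree almost everywhere on the product. Since
  \<open>g0\<close> vanishes in \<open>\<Omega>\<close>, the weighted term extends to the whole
  space.\<close>

lemma Hs_space_iff:
  assumes u: "AE x in lebesgue. u x = u0 x" "u0 \<in> borel_measurable borel"
    and g: "AE x in lebesgue. x \<notin> \<Omega> \<longrightarrow> g x = g0 x" "g0 \<in> borel_measurable borel" "\<And>x. x \<in> \<Omega> \<Longrightarrow> g0 x = 0"
  shows "u \<in> Hs_space s \<Omega> g \<longleftrightarrow> u0 \<in> test_space g0"
proof -
  note [measurable] = u(2) g(2)
  have meas: "u \<in> borel_measurable lebesgue"
  proof (rule borel_measurable_AE)
    show "u0 \<in> borel_measurable lebesgue" using u(2) by (simp add: measurable_completion)
    show "AE x in lebesgue. u0 x = u x" using u(1) by (auto elim: eventually_mono)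
  qed
  have 1: "(\<integral>\<^sup>+ x. ennreal ((u x)\<^sup>2) \<partial>lebesgue_on \<Omega>) = (\<integral>\<^sup>+x. ennreal (indicator \<Omega> x * (u0 x)\<^sup>2) \<partial>lborel)"
  proof -
    have "(\<integral>\<^sup>+ x. ennreal ((u x)\<^sup>2) \<partial>lebesgue_on \<Omega>) = (\<integral>\<^sup>+x. ennreal ((u0 x)\<^sup>2) * indicator \<Omega> x \<partial>lborel)"
      by (rule nn_integral_lebesgue_on_eq_lborel) (use u(1) in \<open>auto elim: eventually_mono\<close>)
    then show ?thesis by (simp add: ennreal_mult' ennreal_indicator mult.commute)
  qed
  have 2: "(\<integral>\<^sup>+ x. ennreal ((sqrt \<bar>g x\<bar> * u x)\<^sup>2) \<partial>lebesgue_on (UNIV - \<Omega>)) = (\<integral>\<^sup>+x. ennreal (\<bar>g0 x\<bar> * (u0 x)\<^sup>2) \<partial>lborel)"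
  proof -
    have "AE x in lebesgue. x \<in> UNIV - \<Omega> \<longrightarrow> ennreal ((sqrt \<bar>g x\<bar> * u x)\<^sup>2) = ennreal (\<bar>g0 x\<bar> * (u0 x)\<^sup>2)"
      using u(1) g(1) by eventually_elim (simp add: power_mult_distrib)
    then have "(\<integral>\<^sup>+ x. ennreal ((sqrt \<bar>g x\<bar> * u x)\<^sup>2) \<partial>lebesgue_on (UNIV - \<Omega>))
        = (\<integral>\<^sup>+x. ennreal (\<bar>g0 x\<bar> * (u0 x)\<^sup>2) * indicator (UNIV - \<Omega>) x \<partial>lborel)"
      by (intro nn_integral_lebesgue_on_eq_lborel) measurable
    also have "\<dots> = (\<integral>\<^sup>+x. ennreal (\<bar>g0 x\<bar> * (u0 x)\<^sup>2) \<partial>lborel)"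
      by (intro nn_integral_cong) (auto simp: indicator_def g(3))
    finally show ?thesis .
  qed
  have 3: "(\<integral>\<^sup>+ (x, y). ennreal (\<bar>u x - u y\<bar>\<^sup>2 / frac_den s x y) \<partial>lebesgue_on (cross_region \<Omega>))
      = (\<integral>\<^sup>+p. ennreal ((increment u0 p)\<^sup>2) \<partial>energy_measure s \<Omega>)"
  proof -
    have F: "(\<lambda>p. ennreal ((increment u0 p)\<^sup>2)) \<in> borel_measurable borel" by measurable
    have "(\<integral>\<^sup>+ (x, y). ennreal (\<bar>u x - u y\<bar>\<^sup>2 / frac_den s x y) \<partial>lebesgue_on (cross_region \<Omega>))
       = (\<integral>\<^sup>+p. ennreal (riesz_kernel s (fst p) (snd p) * (increment u0 p)\<^sup>2) * indicator (cross_region \<Omega>) p \<partial>lborel)"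
    proof (rule nn_integral_lebesgue_on_eq_lborel)
      show "AE p in lebesgue. p \<in> cross_region \<Omega> \<longrightarrow> (case p of (x, y) \<Rightarrow> ennreal (\<bar>u x - u y\<bar>\<^sup>2 / frac_den s x y))
          = ennreal (riesz_kernel s (fst p) (snd p) * (increment u0 p)\<^sup>2)"
        using AE_lebesgue_increment[OF u(1)]
      proof eventually_elim
        case (elim p)
        have "(case p of (x, y) \<Rightarrow> ennreal (\<bar>u x - u y\<bar>\<^sup>2 / frac_den s x y))
            = ennreal (riesz_kernel s (fst p) (snd p) * (increment u p)\<^sup>2)"
          by (simp add: case_prod_unfold increment_def divide_frac_den)
        then show ?case using elim by simp
      qed
    qed measurable
    also have "\<dots> = (\<integral>\<^sup>+p. ennreal ((increment u0 p)\<^sup>2) \<partial>energy_measure s \<Omega>)"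
      unfolding nn_integral_energy_measure[OF F]
      by (intro nn_integral_cong) (auto simp: indicator_def ennreal_mult)
    finally show ?thesis .
  qed
  have m: "(\<lambda>p. (increment u0 p)\<^sup>2) \<in> borel_measurable (energy_measure s \<Omega>)" by measurable
  show ?thesis
    unfolding Hs_space_def mem_Collect_eq Hs_norm_sq_def 1 2 3 test_space_def finite_energy_def
    using meas u(2) m by (simp add: integrable_iff_bounded abs_mult conj_ac)
qed

end

text \<open>Membership of \<open>\<psi>\<close> in \<open>Hs_space\<close> for zero data says that
  its energy is finite; being \<open>C\<^sup>2\<close> does not restrict growth at infinity. This
  energy is the factor coming from \<open>\<psi>\<close> in the Cauchy-Schwarz part of the bound on
  the data functional.\<close>

theorem theorem3p9:
  fixes s :: real
    and \<Omega> :: "(real ^ 'n) set"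
    and f g \<psi> :: "real ^ 'n \<Rightarrow> real"
  assumes s: "0 < s" "s < 1"
    and \<Omega>: "bounded \<Omega>" "lipschitz_domain \<Omega>"
    and f: "f \<in> borel_measurable (lebesgue_on \<Omega>)" "integrable (lebesgue_on \<Omega>) (\<lambda>x. (f x)\<^sup>2)"
    and g: "integrable (lebesgue_on (UNIV - \<Omega>)) g"
    and \<psi>: "C2_function \<psi>" "\<psi> \<in> Hs_space s \<Omega> (\<lambda>_. 0)"
    and \<psi>_g: "AE x in lebesgue_on (UNIV - closure \<Omega>). nonlocal_normal_deriv s \<Omega> \<psi> x = g x"
  shows "((\<exists>u. weak_neumann_solution s \<Omega> f g u) \<longleftrightarrow>
            (LINT x | lebesgue_on \<Omega>. f x) = - (LINT x | lebesgue_on (UNIV - \<Omega>). g x)) \<and>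
         ((LINT x | lebesgue_on \<Omega>. f x) = - (LINT x | lebesgue_on (UNIV - \<Omega>). g x) \<longrightarrow>
            (\<forall>u w. weak_neumann_solution s \<Omega> f g u \<and> weak_neumann_solution s \<Omega> f g w \<longrightarrow>
               (\<exists>c. AE x in lebesgue. u x = w x + c)))"
proof -
  interpret nonlocal_domain s \<Omega> using s \<Omega> by unfold_locales
  define c where "c = frac_const TYPE('n) s"
  have c: "0 < c" unfolding c_def by (rule frac_const_pos[OF s])
  have compl: "UNIV - \<Omega> \<in> sets borel" by measurable
  obtain f0 where f0: "f0 \<in> borel_measurable borel" "AE x in lebesgue. x \<in> \<Omega> \<longrightarrow> f x = f0 x"
    using lebesgue_on_borel_representative[OF domain_borel f(1)] by blast
  obtain g0 where g0: "g0 \<in> borel_measurable borel" "AE x in lebesgue. x \<in> UNIV - \<Omega> \<longrightarrow> g x = g0 x"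
    "\<And>x. x \<notin> UNIV - \<Omega> \<Longrightarrow> g0 x = 0"
    using lebesgue_on_borel_representative[OF compl borel_measurable_integrable[OF g]] by blast
  note [measurable] = f0(1) g0(1) C2_function_borel_measurable[OF \<psi>(1)]
  have g0_ind: "indicator (UNIV - \<Omega>) x * (g0 x * a) = g0 x * a" for x a
    using g0(3)[of x] by (auto simp: indicator_def)
  have f0_sq: "integrable lborel (\<lambda>x. indicator \<Omega> x * (f0 x)\<^sup>2)"
  proof -
    have sq: "AE x in lebesgue. x \<in> \<Omega> \<longrightarrow> (f x)\<^sup>2 = (f0 x)\<^sup>2" using f0(2) by (rule eventually_mono) auto
    show ?thesis using integral_lebesgue_on_eq_lborel(2)[OF domain_borel _ sq] f(2) by simp
  qed
  have g0_int: "integrable lborel g0"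
    using integral_lebesgue_on_eq_lborel(2)[OF compl g0(1,2)] g
    by (simp only: g0_ind[where a = 1, unfolded mult_1_right])
  have g0_zero: "g0 x = 0" if "x \<in> \<Omega>" for x using that g0(3) by simp
  have g_ae: "AE x in lebesgue. x \<notin> \<Omega> \<longrightarrow> g x = g0 x" using g0(2) by simp
  have f_test: "(LINT x | lebesgue_on \<Omega>. f x * v x) = (\<integral>x. indicator \<Omega> x * (f0 x * v0 x) \<partial>lborel)"
    if v: "AE x in lebesgue. v x = v0 x" "v0 \<in> borel_measurable borel" for v v0
  proof (rule integral_lebesgue_on_eq_lborel(1)[OF domain_borel])
    show "AE x in lebesgue. x \<in> \<Omega> \<longrightarrow> f x * v x = f0 x * v0 x" using f0(2) v(1) by eventually_elim simp
    show "(\<lambda>x. f0 x * v0 x) \<in> borel_measurable borel" using v(2) by measurable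
  qed
  have g_test: "(LINT x | lebesgue_on (UNIV - \<Omega>). g x * v x) = (\<integral>x. g0 x * v0 x \<partial>lborel)"
    if v: "AE x in lebesgue. v x = v0 x" "v0 \<in> borel_measurable borel" for v v0
  proof -
    have "(LINT x | lebesgue_on (UNIV - \<Omega>). g x * v x) = (\<integral>x. indicator (UNIV - \<Omega>) x * (g0 x * v0 x) \<partial>lborel)"
    proof (rule integral_lebesgue_on_eq_lborel(1)[OF compl])
      show "AE x in lebesgue. x \<in> UNIV - \<Omega> \<longrightarrow> g x * v x = g0 x * v0 x" using g0(2) v(1) by eventually_elim simp
      show "(\<lambda>x. g0 x * v0 x) \<in> borel_measurable borel" using v(2) by measurable
    qed
    then show ?thesis by (simp only: g0_ind)
  qed
  have f_int: "(LINT x | lebesgue_on \<Omega>. f x) = (\<integral>x. indicator \<Omega> x * f0 x \<partial>lborel)"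
    using f_test[of "\<lambda>_. 1" "\<lambda>_. 1"] by simp
  have g_int: "(LINT x | lebesgue_on (UNIV - \<Omega>). g x) = (\<integral>x. g0 x \<partial>lborel)"
    using g_test[of "\<lambda>_. 1" "\<lambda>_. 1"] by simp
  have finite: "u \<in> Hs_space s \<Omega> (\<lambda>_. 0) \<longleftrightarrow> finite_energy s \<Omega> u0"
    if u: "AE x in lebesgue. u x = u0 x" "u0 \<in> borel_measurable borel" for u u0
    using Hs_space_iff[OF u, of "\<lambda>_. 0" "\<lambda>_. 0"] by (simp add: test_space_def)
  \<comment> \<open>Every Lebesgue test function has a Borel representative with the same integrals,
    and Borel test functions are themselves admissible, so the weak equation may be tested with
    either class.\<close>
  have weak_iff: "weak_neumann_solution s \<Omega> f g u \<longleftrightarrow> finite_energy s \<Omega> u0 \<and>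
      (\<forall>v\<in>test_space g0. c / 2 * energy_form s \<Omega> u0 v = (\<integral>x. indicator \<Omega> x * (f0 x * v x) \<partial>lborel) + (\<integral>x. g0 x * v x \<partial>lborel))"
    if u: "AE x in lebesgue. u x = u0 x" "u0 \<in> borel_measurable borel" for u u0
  proof -
    let ?eq = "\<lambda>v. c / 2 * energy_form s \<Omega> u0 v = (\<integral>x. indicator \<Omega> x * (f0 x * v x) \<partial>lborel) + (\<integral>x. g0 x * v x \<partial>lborel)"
    let ?weq = "\<lambda>v. c / 2 * (LINT (x, y) | lebesgue_on (cross_region \<Omega>). (u x - u y) * (v x - v y) / frac_den s x y) =
        (LINT x | lebesgue_on \<Omega>. f x * v x) + (LINT x | lebesgue_on (UNIV - \<Omega>). g x * v x)"
    have weq_iff: "?weq v \<longleftrightarrow> ?eq v0" if v: "AE x in lebesgue. v x = v0 x" "v0 \<in> borel_measurable borel" for v v0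
      unfolding cross_integral_eq_energy_form[OF u v] f_test[OF v] g_test[OF v] ..
    have "(\<forall>v\<in>Hs_space s \<Omega> g. ?weq v) \<longleftrightarrow> (\<forall>v\<in>test_space g0. ?eq v)"
    proof (intro iffI ballI)
      fix v assume all: "\<forall>v\<in>Hs_space s \<Omega> g. ?weq v" and v: "v \<in> test_space g0"
      have vm: "v \<in> borel_measurable borel" using v by (simp add: test_space_def finite_energy_def)
      have "v \<in> Hs_space s \<Omega> g" using Hs_space_iff[of v v, OF _ vm g_ae g0(1) g0_zero] v by simp
      then show "?eq v" using all weq_iff[of v v] vm by simp
    next
      fix v assume all: "\<forall>v\<in>test_space g0. ?eq v" and v: "v \<in> Hs_space s \<Omega> g"
      obtain v0 where v0: "v0 \<in> borel_measurable borel" "AE x in lebesgue. v x = v0 x"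
        using lebesgue_borel_representative v unfolding Hs_space_def by blast
      have "v0 \<in> test_space g0" using Hs_space_iff[OF v0(2,1) g_ae g0(1) g0_zero] v by simp
      then show "?weq v" using all weq_iff[OF v0(2,1)] by simp
    qed
    then show ?thesis unfolding weak_neumann_solution_def c_def[symmetric] finite[OF u] by simp
  qed
  have \<psi>_fe: "finite_energy s \<Omega> \<psi>" using finite[of \<psi> \<psi>] \<psi>(2) by simp
  have \<psi>_g0: "AE x in lborel. x \<notin> closure \<Omega> \<longrightarrow> g0 x = c * (\<integral>y. indicator \<Omega> y * (riesz_kernel s x y * (\<psi> x - \<psi> y)) \<partial>lborel)"
  proof -
    have "AE x in lebesgue. x \<in> UNIV - closure \<Omega> \<longrightarrow> nonlocal_normal_deriv s \<Omega> \<psi> x = g x"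
      using \<psi>_g by (subst (asm) AE_restrict_space_iff) (auto simp: sets_completionI_sets)
    with g_ae have "AE x in lebesgue. x \<notin> closure \<Omega> \<longrightarrow> g0 x = c * (\<integral>y. indicator \<Omega> y * (riesz_kernel s x y * (\<psi> x - \<psi> y)) \<partial>lborel)"
    proof eventually_elim
      case (elim x)
      have "(LINT y | lebesgue_on \<Omega>. (\<psi> x - \<psi> y) / frac_den s x y) = (\<integral>y. indicator \<Omega> y * (riesz_kernel s x y * (\<psi> x - \<psi> y)) \<partial>lborel)"
      proof (rule integral_lebesgue_on_eq_lborel(1)[OF domain_borel])
        show "AE y in lebesgue. y \<in> \<Omega> \<longrightarrow> (\<psi> x - \<psi> y) / frac_den s x y = riesz_kernel s x y * (\<psi> x - \<psi> y)"
        proof (rule AE_I2)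
          fix y
          show "y \<in> \<Omega> \<longrightarrow> (\<psi> x - \<psi> y) / frac_den s x y = riesz_kernel s x y * (\<psi> x - \<psi> y)"
            by (simp add: divide_frac_den)
        qed
      qed measurable
      then show ?case
        using elim closure_subset[of \<Omega>] by (auto simp: nonlocal_normal_deriv_def c_def)
    qed
    then show ?thesis by (simp add: AE_completion_iff)
  qed
  have necessary: "(LINT x | lebesgue_on \<Omega>. f x) = - (LINT x | lebesgue_on (UNIV - \<Omega>). g x)"
    if weak: "weak_neumann_solution s \<Omega> f g u" for u
  proof -
    obtain u0 where u0: "u0 \<in> borel_measurable borel" "AE x in lebesgue. u x = u0 x"
      using lebesgue_borel_representative weak unfolding weak_neumann_solution_def Hs_space_def by blast
    \<comment> \<open>The constant \<open>1\<close> is an admissible test function because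
      \<open>g0\<close> is integrable and \<open>\<Omega>\<close> has finite measure.\<close>
    have "c / 2 * energy_form s \<Omega> u0 (\<lambda>_. 1) = (\<integral>x. indicator \<Omega> x * (f0 x * 1) \<partial>lborel) + (\<integral>x. g0 x * 1 \<partial>lborel)"
      using weak_iff[OF u0(2,1)] weak test_space_const[OF g0_int, of 1] by blast
    moreover have "energy_form s \<Omega> u0 (\<lambda>_. 1) = 0"
      using energy_form_const_left energy_form_commute[of u0 "\<lambda>_. 1"] by simp
    ultimately show ?thesis unfolding f_int g_int by simp
  qed
  have sufficient: "\<exists>u. weak_neumann_solution s \<Omega> f g u"
    if "(LINT x | lebesgue_on \<Omega>. f x) = - (LINT x | lebesgue_on (UNIV - \<Omega>). g x)"
  proof -
    have "(\<integral>x. indicator \<Omega> x * f0 x \<partial>lborel) + (\<integral>x. g0 x \<partial>lborel) = 0"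
      using that unfolding f_int g_int by simp
    then obtain u where u: "finite_energy s \<Omega> u"
      "\<And>v. v \<in> test_space g0 \<Longrightarrow> c / 2 * energy_form s \<Omega> u v = (\<integral>x. indicator \<Omega> x * (f0 x * v x) \<partial>lborel) + (\<integral>x. g0 x * v x \<partial>lborel)"
      using neumann_existence[OF c f0(1) f0_sq \<psi>(1) \<psi>_fe g0_int g0_zero \<psi>_g0] by blast
    then have "weak_neumann_solution s \<Omega> f g u"
      using weak_iff[of u u] finite_energy_measurable[OF u(1)] by simp
    then show ?thesis by blast
  qed
  have unique: "\<exists>a. AE x in lebesgue. u x = w x + a"
    if weak: "weak_neumann_solution s \<Omega> f g u" "weak_neumann_solution s \<Omega> f g w" for u w
  proof -
    obtain u0 where u0: "u0 \<in> borel_measurable borel" "AE x in lebesgue. u x = u0 x"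
      using lebesgue_borel_representative weak(1) unfolding weak_neumann_solution_def Hs_space_def by blast
    obtain w0 where w0: "w0 \<in> borel_measurable borel" "AE x in lebesgue. w x = w0 x"
      using lebesgue_borel_representative weak(2) unfolding weak_neumann_solution_def Hs_space_def by blast
    have u_weak: "finite_energy s \<Omega> u0" "\<And>v. v \<in> test_space g0 \<Longrightarrow> c / 2 * energy_form s \<Omega> u0 v =
        (\<integral>x. indicator \<Omega> x * (f0 x * v x) \<partial>lborel) + (\<integral>x. g0 x * v x \<partial>lborel)"
      using weak_iff[OF u0(2,1)] weak(1) by auto
    have w_weak: "finite_energy s \<Omega> w0" "\<And>v. v \<in> test_space g0 \<Longrightarrow> c / 2 * energy_form s \<Omega> w0 v =
        (\<integral>x. indicator \<Omega> x * (f0 x * v x) \<partial>lborel) + (\<integral>x. g0 x * v x \<partial>lborel)"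
      using weak_iff[OF w0(2,1)] weak(2) by auto
    have "\<exists>a. AE x in lborel. u0 x - w0 x = a"
    proof (rule neumann_uniqueness[OF g0_int])
      show "finite_energy s \<Omega> (\<lambda>x. u0 x - w0 x)"
        using finite_energy_add[OF u_weak(1) w_weak(1), of "- 1"] by simp
      fix v assume v: "v \<in> test_space g0"
      then have "finite_energy s \<Omega> v" by (simp add: test_space_def)
      from energy_form_add[OF u_weak(1) w_weak(1) this, of "- 1"]
      have "energy_form s \<Omega> (\<lambda>x. u0 x - w0 x) v = energy_form s \<Omega> u0 v - energy_form s \<Omega> w0 v" by simp
      moreover have "c / 2 * energy_form s \<Omega> u0 v = c / 2 * energy_form s \<Omega> w0 v"
        using u_weak(2)[OF v] w_weak(2)[OF v] by simp
      ultimately show "energy_form s \<Omega> (\<lambda>x. u0 x - w0 x) v = 0" using c by simp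
    qed
    then obtain a where "AE x in lebesgue. u0 x - w0 x = a" using AE_completion by blast
    with u0(2) w0(2) have "AE x in lebesgue. u x = w x + a" by eventually_elim simp
    then show ?thesis by blast
  qed
  show ?thesis using necessary sufficient unique by blast
qed

end
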